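(* Let $\alpha,\beta>0$ and let $L$, $(\mu_n)$, $A$, $m_1,m_2$ be as in the context, with $A$ considered in any of the four spaces $\mathcal{H}_1,\dots,\mathcal{H}_4$ given there. The operator $A$ has an infinite number of isolated eigenvalues, all of them with finite algebraic multiplicity. More concretely, for each eigenvalue $\mu_n$ of $L$, $n\in\mathbb{N}$, there exist three corresponding eigenvalues $\lambda_1^n,\lambda_2^n,\lambda_3^n$ of $A$, the three solutions of the characteristic equation $$\alpha\lambda^3+\lambda^2+\beta\mu_n\lambda+\mu_n=0 .$$ Moreover, if $\lambda_j^n=a_n+ib_n$ ($a_n,b_n$ real) is nonreal, then $$8\alpha a_n^3+8a_n^2+2a_n\Big(\frac1\alpha+\beta\mu_n\Big)+\mu_n\Big(\frac\beta\alpha-1\Big)=0,\qquad b_n^2=\frac1\alpha\big(3\alpha a_n^2+2a_n+\beta\mu_n\big).$$ Under the dissipativeness condition $0<\alpha<\beta$, these eigenvalues satisfy the following. 1. (a) If $\frac19<\frac\alpha\beta<1$, then for all $n$ one of the eigenvalues is real and the other two are complex conjugated: $\lambda_1^n\in\mathbb{R}$ and $\lambda_2^n=\overline{\lambda_3^n}\in\mathbb{C}\setminus\mathbb{R}$. (b) If $0<\frac\alpha\beta<\frac19$, the same happens except, maybe, for a finite number of values of $n$. In this case $m_1,m_2$ are real and satisfy $0<m_1<m_2$. If $m_1<\mu_n<m_2$ (which can happen only for a finite number of values of $n$), then $\lambda_1^n,\lambda_2^n,\lambda_3^n\in\mathbb{R}$. The following exceptional case (double root case) can also happen: if there exist $n_1$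 or $n_2$ such that $\mu_{n_1}=m_1$ or $\mu_{n_2}=m_2$, then $\lambda_2^{n_1}=\lambda_3^{n_1}\in\mathbb{R}$ or $\lambda_2^{n_2}=\lambda_3^{n_2}\in\mathbb{R}$ is an eigenvalue with algebraic multiplicity equal to two. Alternatively, if $\mu_n\notin[m_1,m_2]$, then $\lambda_1^n\in\mathbb{R}$ and $\lambda_2^n=\overline{\lambda_3^n}\in\mathbb{C}\setminus\mathbb{R}$, as in (a). (c) If $\frac\alpha\beta=\frac19$, then $m_1=m_2=\frac{3}{\beta^2}>0$ and the same as in (a) also happens, except if there exists $n_1$ such that $\mu_{n_1}=\frac{3}{\beta^2}$. In this exceptional case, $\lambda_1^{n_1}=\lambda_2^{n_1}=\lambda_3^{n_1}=-\frac3\beta\in\mathbb{R}$ is an eigenvalue with algebraic multiplicity equal to three. 2. (a) If $\lambda$ is a real eigenvalue of $A$, then $-\frac1\alpha<\lambda<-\frac1\beta$. If $\lambda$ is a nonreal eigenvalue of $A$, then $-\frac12\big(\frac1\alpha-\frac1\beta\big)<\operatorname{Re}(\lambda)<0$. (b) If $\mu_n<\mu_m$ and $\mu_n,\mu_m\notin[m_1,m_2]$, then $\operatorname{Re}(\lambda_2^n)>\operatorname{Re}(\lambda_2^m)$. (c) The limits of the sequences of eigenvalues are the following: $\lim_{n\to\infty}\lambda_1^n=-\frac1\beta$, which is not an eigenvalue, but the only element in the essential spectrum of $A$; $\lim_{n\to\infty}\operatorname{Re}(\lambda_2^n)=-\frac12\big(\frac1\alpha-\frac1\beta\big)$; and $\lim_{n\to\infty}\operatorname{Im}(\lambda_2^n)=\infty$,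 with $\operatorname{Im}(\lambda_2^n)=\sqrt{\frac\beta\alpha}\sqrt{\mu_n}+o(\sqrt{\mu_n})$. (d) $\lim_{n\to\infty}\operatorname{Re}(\lambda_2^n)$ is lower than (respectively, equal to or higher than) $\lim_{n\to\infty}\lambda_1^n$ if $\frac\alpha\beta$ is lower than (respectively, equal to or higher than) $\frac13$.
   Context: $H$ is a Hilbert space and $L$ is a self-adjoint, strictly positive operator in $H$ with compact resolvent. Its eigenvalues $\mu_n$ are positive, semi-simple, listed in ascending order $0<\mu_1\le\mu_2\le\dots\to\infty$, and the corresponding eigenfunctions $\phi_n$, $L\phi_n=\mu_n\phi_n$, are an orthonormal family in $H$. The operator $A$ is the one obtained by writing the equation $(u+\alpha u_t)_{tt}+L(u+\beta u_t)=0$ as a first order system for $(u,v,w)=(u,u_t,u_{tt})$: $$A(u,v,w)^T=\Big(v,\; w,\; -\tfrac1\alpha L(u+\beta v)-\tfrac1\alpha w\Big)^T ,$$ considered, with the corresponding domain, in any of the Hilbert spaces $$\mathcal{H}_1=D(L^{1/2})\times D(L^{1/2})\times H,\quad \mathcal{H}_2=D(L)\times D(L)\times D(L^{1/2}),$$ $$\mathcal{H}_3=D(L)\times D(L^{1/2})\times H,\quad \mathcal{H}_4=D(L^{3/2})\times D(L)\times D(L^{1/2}).$$ The numbers $m_1,m_2$ (the zeroes, as a function of $\mu_n$, of the nontrivial quadratic factor of the Cardano discriminant of the characteristic equation) are $$m_1=\alpha\frac{-C_1-\sqrt{C_2}}{8\beta^3},\quad m_2=\alpha\frac{-C_1+\sqrt{C_2}}{8\beta^3},$$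 $$C_1=27-18\frac{\beta}{\alpha}-\Big(\frac{\beta}{\alpha}\Big)^2,\quad C_2=C_1^2-64\Big(\frac{\beta}{\alpha}\Big)^3 ;$$ when $m_1,m_2$ are not real, the condition $\mu\notin[m_1,m_2]$ is understood to hold for every $\mu>0$. Labelling: when exactly one of the three roots is real it is called $\lambda_1^n$, and $\lambda_2^n=\overline{\lambda_3^n}$ with $\operatorname{Im}\lambda_2^n>0$; when exactly two of the roots coincide, these are called $\lambda_2^n=\lambda_3^n$. The essential spectrum of $A$ is the set of points of the spectrum that are not isolated eigenvalues of finite algebraic multiplicity.
   Formalization: Finite multiplicity is not claimed for the eigenvalue -1/β when α=β (there it is infinite); a double (triple) root has algebraic multiplicity 2k (3k) for A, k the multiplicity of μ_n for L, and exactly 2 (3) on span(φ_n)^3, so "two" ("three") is literal when μ_n is simple. *)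

theory Defs
  imports "HOL-Analysis.Analysis" "HOL-Library.Landau_Symbols"
    "HOL-Computational_Algebra.Polynomial"
begin

section \<open>Complex vector spaces and complex Hilbert spaces\<close>

class complex_vector = ab_group_add +
  fixes scaleC :: "complex \<Rightarrow> 'a \<Rightarrow> 'a" (infixr \<open>*\<^sub>C\<close> 75)
  assumes scaleC_add_right: "c *\<^sub>C (x + y) = c *\<^sub>C x + c *\<^sub>C y"
    and scaleC_add_left: "(c + d) *\<^sub>C x = c *\<^sub>C x + d *\<^sub>C x"
    and scaleC_scaleC: "c *\<^sub>C (d *\<^sub>C x) = (c * d) *\<^sub>C x"
    and scaleC_one: "1 *\<^sub>C x = x"

global_interpretation cvec: vector_space "scaleC :: complex \<Rightarrow> 'a \<Rightarrow> 'a::complex_vector"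
  by unfold_locales (simp_all add: scaleC_add_right scaleC_add_left scaleC_scaleC scaleC_one)

instantiation prod :: (complex_vector, complex_vector) complex_vector
begin

definition scaleC_prod_def: "c *\<^sub>C p = (c *\<^sub>C fst p, c *\<^sub>C snd p)"

instance
  by standard
    (simp_all add: scaleC_prod_def scaleC_add_right scaleC_add_left scaleC_scaleC scaleC_one)

end

text \<open>The inner product is antilinear in the first argument. Norm and topology are those of the
  underlying real Hilbert space, whose inner product is the real part of the complex one.\<close>

class complex_hilbert = complex_vector + real_inner + complete_space +
  fixes cinner :: "'a \<Rightarrow> 'a \<Rightarrow> complex"
  assumes scaleC_of_real: "complex_of_real r *\<^sub>C x = r *\<^sub>R x"
    and cinner_commute: "cinner x y = cnj (cinner y x)"
    and cinner_add_right: "cinner x (y + z) = cinner x y + cinner x z"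
    and cinner_scaleC_right: "cinner x (c *\<^sub>C y) = c * cinner x y"
    and Re_cinner: "Re (cinner x y) = inner x y"


section \<open>Unbounded operators and their spectra\<close>

text \<open>A normed space is given by a carrier \<open>X\<close> (a subspace of a complex vector space) and a norm
  \<open>N\<close> on it; an unbounded operator in it by its domain \<open>D\<close> and a function \<open>T\<close>,
  of which only the values on \<open>D\<close> matter.\<close>

definition resolvent_set ::
  "'a::complex_vector set \<Rightarrow> ('a \<Rightarrow> real) \<Rightarrow> 'a set \<Rightarrow> ('a \<Rightarrow> 'a) \<Rightarrow> complex set" where
  "resolvent_set X N D T =
    {l. bij_betw (\<lambda>x. T x - l *\<^sub>C x) D X \<and> (\<exists>K. \<forall>x\<in>D. N x \<le> K * N (T x - l *\<^sub>C x))}"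

definition spectrum ::
  "'a::complex_vector set \<Rightarrow> ('a \<Rightarrow> real) \<Rightarrow> 'a set \<Rightarrow> ('a \<Rightarrow> 'a) \<Rightarrow> complex set" where
  "spectrum X N D T = - resolvent_set X N D T"

definition eigenvalue :: "'a::complex_vector set \<Rightarrow> ('a \<Rightarrow> 'a) \<Rightarrow> complex \<Rightarrow> bool" where
  "eigenvalue D T l \<longleftrightarrow> (\<exists>x\<in>D. x \<noteq> 0 \<and> T x = l *\<^sub>C x)"

text \<open>\<open>ker_pow D T l k\<close> is the kernel of \<open>(T - l)\<^sup>k\<close> with its natural domain.\<close>

primrec ker_pow ::
  "'a::complex_vector set \<Rightarrow> ('a \<Rightarrow> 'a) \<Rightarrow> complex \<Rightarrow> nat \<Rightarrow> 'a set" where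
  "ker_pow D T l 0 = {0}"
| "ker_pow D T l (Suc k) = {x\<in>D. T x - l *\<^sub>C x \<in> ker_pow D T l k}"

definition root_space :: "'a::complex_vector set \<Rightarrow> ('a \<Rightarrow> 'a) \<Rightarrow> complex \<Rightarrow> 'a set" where
  "root_space D T l = (\<Union>k. ker_pow D T l k)"

definition finite_alg_mult :: "'a::complex_vector set \<Rightarrow> ('a \<Rightarrow> 'a) \<Rightarrow> complex \<Rightarrow> bool" where
  "finite_alg_mult D T l \<longleftrightarrow> (\<exists>B. finite B \<and> root_space D T l \<subseteq> cvec.span B)"

text \<open>This is \<open>0\<close> if the root space is infinite-dimensional.\<close>

definition alg_mult :: "'a::complex_vector set \<Rightarrow> ('a \<Rightarrow> 'a) \<Rightarrow> complex \<Rightarrow> nat" where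
  "alg_mult D T l = cvec.dim (root_space D T l)"

definition discrete_eigenvalue ::
  "'a::complex_vector set \<Rightarrow> ('a \<Rightarrow> real) \<Rightarrow> 'a set \<Rightarrow> ('a \<Rightarrow> 'a) \<Rightarrow> complex \<Rightarrow> bool" where
  "discrete_eigenvalue X N D T l \<longleftrightarrow>
    eigenvalue D T l \<and> l isolated_in spectrum X N D T \<and> finite_alg_mult D T l"

definition essential_spectrum ::
  "'a::complex_vector set \<Rightarrow> ('a \<Rightarrow> real) \<Rightarrow> 'a set \<Rightarrow> ('a \<Rightarrow> 'a) \<Rightarrow> complex set" where
  "essential_spectrum X N D T = {l \<in> spectrum X N D T. \<not> discrete_eigenvalue X N D T l}"


section \<open>The operator \<open>L\<close>\<close>

definition linear_on :: "'a::complex_vector set \<Rightarrow> ('a \<Rightarrow> 'a) \<Rightarrow> bool" where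
  "linear_on D T \<longleftrightarrow> cvec.subspace D \<and>
    (\<forall>x\<in>D. \<forall>y\<in>D. T (x + y) = T x + T y) \<and> (\<forall>c. \<forall>x\<in>D. T (c *\<^sub>C x) = c *\<^sub>C T x)"

text \<open>The last conjunct says that the graph of \<open>T\<close> is the graph of its adjoint.\<close>

definition self_adjoint :: "'a::complex_hilbert set \<Rightarrow> ('a \<Rightarrow> 'a) \<Rightarrow> bool" where
  "self_adjoint D T \<longleftrightarrow> linear_on D T \<and> closure D = UNIV \<and>
    (\<forall>y z. (y \<in> D \<and> T y = z) \<longleftrightarrow> (\<forall>x\<in>D. cinner (T x) y = cinner x z))"

definition strictly_positive :: "'a::complex_hilbert set \<Rightarrow> ('a \<Rightarrow> 'a) \<Rightarrow> bool" where
  "strictly_positive D T \<longleftrightarrow> (\<forall>x\<in>D. x \<noteq> 0 \<longrightarrow> 0 < Re (cinner x (T x)))"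

definition compact_resolvent :: "'a::complex_hilbert set \<Rightarrow> ('a \<Rightarrow> 'a) \<Rightarrow> bool" where
  "compact_resolvent D T \<longleftrightarrow>
    (\<exists>l \<in> resolvent_set UNIV norm D T.
      compact (closure (inv_into D (\<lambda>x. T x - l *\<^sub>C x) ` ball 0 1)))"

text \<open>\<open>\<mu>\<close> enumerates, from index \<open>0\<close>, all eigenvalues of \<open>L\<close> in ascending order, repeated according
  to multiplicity (last conjunct), and \<open>\<phi>\<close> is a corresponding orthonormal family of
  eigenvectors.\<close>

definition eigen_enumeration ::
  "'a::complex_hilbert set \<Rightarrow> ('a \<Rightarrow> 'a) \<Rightarrow> (nat \<Rightarrow> real) \<Rightarrow> (nat \<Rightarrow> 'a) \<Rightarrow> bool" where
  "eigen_enumeration D L \<mu> \<phi> \<longleftrightarrow>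
    (\<forall>n. 0 < \<mu> n) \<and> incseq \<mu> \<and> filterlim \<mu> at_top sequentially \<and>
    (\<forall>n. \<phi> n \<in> D \<and> L (\<phi> n) = complex_of_real (\<mu> n) *\<^sub>C \<phi> n) \<and>
    (\<forall>m n. cinner (\<phi> m) (\<phi> n) = (if m = n then 1 else 0)) \<and>
    (\<forall>c. \<forall>x\<in>D. L x = c *\<^sub>C x \<longrightarrow> x \<in> cvec.span {\<phi> n |n. complex_of_real (\<mu> n) = c})"

text \<open>Powers of \<open>L\<close> by its eigenfunction expansion:
  \<open>L\<^sup>s u = (\<Sum>n. \<mu>\<^sub>n\<^sup>s \<langle>\<phi>\<^sub>n, u\<rangle> \<phi>\<^sub>n)\<close>, with domain all \<open>u\<close> for which the series converges in \<open>H\<close>.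
  Since \<open>\<mu>\<close> is bounded below by a positive number, \<open>u \<mapsto> \<parallel>L\<^sup>s u\<parallel>\<close> is a norm on
  \<open>D(L\<^sup>s)\<close> equivalent to the graph norm, for \<open>s \<ge> 0\<close>.\<close>

definition pow_term ::
  "(nat \<Rightarrow> real) \<Rightarrow> (nat \<Rightarrow> 'a::complex_hilbert) \<Rightarrow> real \<Rightarrow> 'a \<Rightarrow> nat \<Rightarrow> 'a" where
  "pow_term \<mu> \<phi> s u n = (complex_of_real (\<mu> n powr s) * cinner (\<phi> n) u) *\<^sub>C \<phi> n"

definition pow_dom :: "(nat \<Rightarrow> real) \<Rightarrow> (nat \<Rightarrow> 'a::complex_hilbert) \<Rightarrow> real \<Rightarrow> 'a set" where
  "pow_dom \<mu> \<phi> s = {u. summable (pow_term \<mu> \<phi> s u)}"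

definition pow_op :: "(nat \<Rightarrow> real) \<Rightarrow> (nat \<Rightarrow> 'a::complex_hilbert) \<Rightarrow> real \<Rightarrow> 'a \<Rightarrow> 'a" where
  "pow_op \<mu> \<phi> s u = (\<Sum>n. pow_term \<mu> \<phi> s u n)"


section \<open>The operator \<open>A\<close>\<close>

text \<open>The exponents \<open>(s, t, r)\<close> stand for the space \<open>D(L\<^sup>s) \<times> D(L\<^sup>t) \<times> D(L\<^sup>r)\<close>.\<close>

definition phase_exponents :: "(real \<times> real \<times> real) set" where
  "phase_exponents = {(1/2, 1/2, 0), (1, 1, 1/2), (1, 1/2, 0), (3/2, 1, 1/2)}"

definition phase_space ::
  "(nat \<Rightarrow> real) \<Rightarrow> (nat \<Rightarrow> 'a::complex_hilbert) \<Rightarrow> real \<times> real \<times> real \<Rightarrow> ('a \<times> 'a \<times> 'a) set" where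
  "phase_space \<mu> \<phi> = (\<lambda>(s, t, r). pow_dom \<mu> \<phi> s \<times> pow_dom \<mu> \<phi> t \<times> pow_dom \<mu> \<phi> r)"

definition phase_norm ::
  "(nat \<Rightarrow> real) \<Rightarrow> (nat \<Rightarrow> 'a::complex_hilbert) \<Rightarrow> real \<times> real \<times> real \<Rightarrow> 'a \<times> 'a \<times> 'a \<Rightarrow> real"
  where
  "phase_norm \<mu> \<phi> = (\<lambda>(s, t, r) (u, v, w).
    sqrt ((norm (pow_op \<mu> \<phi> s u))\<^sup>2 + (norm (pow_op \<mu> \<phi> t v))\<^sup>2 + (norm (pow_op \<mu> \<phi> r w))\<^sup>2))"

definition A_op ::
  "real \<Rightarrow> real \<Rightarrow> ('a::complex_hilbert \<Rightarrow> 'a) \<Rightarrow> 'a \<times> 'a \<times> 'a \<Rightarrow> 'a \<times> 'a \<times> 'a" where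
  "A_op \<alpha> \<beta> L = (\<lambda>(u, v, w). (v, w, - (1 / \<alpha>) *\<^sub>R L (u + \<beta> *\<^sub>R v) - (1 / \<alpha>) *\<^sub>R w))"

text \<open>The maximal domain of \<open>A\<close> in the chosen space.\<close>

definition A_dom ::
  "real \<Rightarrow> real \<Rightarrow> 'a::complex_hilbert set \<Rightarrow> ('a \<Rightarrow> 'a) \<Rightarrow> (nat \<Rightarrow> real) \<Rightarrow> (nat \<Rightarrow> 'a)
    \<Rightarrow> real \<times> real \<times> real \<Rightarrow> ('a \<times> 'a \<times> 'a) set" where
  "A_dom \<alpha> \<beta> D L \<mu> \<phi> s =
    {(u, v, w) \<in> phase_space \<mu> \<phi> s.
      u + \<beta> *\<^sub>R v \<in> D \<and> A_op \<alpha> \<beta> L (u, v, w) \<in> phase_space \<mu> \<phi> s}"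

text \<open>For an eigenvector \<open>e\<close> of \<open>L\<close>, this three-dimensional subspace is invariant under \<open>A\<close>.\<close>

definition block :: "'a::complex_vector \<Rightarrow> ('a \<times> 'a \<times> 'a) set" where
  "block e = {(a *\<^sub>C e, b *\<^sub>C e, c *\<^sub>C e) |a b c. True}"


section \<open>The characteristic equation\<close>

definition char_poly :: "real \<Rightarrow> real \<Rightarrow> real \<Rightarrow> complex poly" where
  "char_poly \<alpha> \<beta> m = map_poly complex_of_real [:m, \<beta> * m, 1, \<alpha>:]"

text \<open>The three roots, with multiplicity, labelled so that a single real root comes first (with the
  root in the upper half-plane second) and exactly two coinciding roots come last.\<close>

definition labelled_roots ::
  "real \<Rightarrow> real \<Rightarrow> real \<Rightarrow> complex \<Rightarrow> complex \<Rightarrow> complex \<Rightarrow> bool" where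
  "labelled_roots \<alpha> \<beta> m l1 l2 l3 \<longleftrightarrow>
    char_poly \<alpha> \<beta> m = smult (complex_of_real \<alpha>) ([:- l1, 1:] * [:- l2, 1:] * [:- l3, 1:]) \<and>
    (length (filter (\<lambda>z. z \<in> \<real>) [l1, l2, l3]) = 1 \<longrightarrow> l1 \<in> \<real> \<and> l2 = cnj l3 \<and> 0 < Im l2) \<and>
    (card {l1, l2, l3} = 2 \<longrightarrow> l2 = l3)"

definition one_real_two_conj :: "complex \<Rightarrow> complex \<Rightarrow> complex \<Rightarrow> bool" where
  "one_real_two_conj l1 l2 l3 \<longleftrightarrow> l1 \<in> \<real> \<and> l2 = cnj l3 \<and> l2 \<notin> \<real> \<and> l3 \<notin> \<real>"

definition C1 :: "real \<Rightarrow> real \<Rightarrow> real" where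
  "C1 \<alpha> \<beta> = 27 - 18 * (\<beta> / \<alpha>) - (\<beta> / \<alpha>)\<^sup>2"

definition C2 :: "real \<Rightarrow> real \<Rightarrow> real" where
  "C2 \<alpha> \<beta> = (C1 \<alpha> \<beta>)\<^sup>2 - 64 * (\<beta> / \<alpha>) ^ 3"

text \<open>Complex square roots, because \<open>C2\<close> may be negative.\<close>

definition m1 :: "real \<Rightarrow> real \<Rightarrow> complex" where
  "m1 \<alpha> \<beta> = of_real \<alpha> * (- of_real (C1 \<alpha> \<beta>) - csqrt (of_real (C2 \<alpha> \<beta>))) / of_real (8 * \<beta> ^ 3)"

definition m2 :: "real \<Rightarrow> real \<Rightarrow> complex" where
  "m2 \<alpha> \<beta> = of_real \<alpha> * (- of_real (C1 \<alpha> \<beta>) + csqrt (of_real (C2 \<alpha> \<beta>))) / of_real (8 * \<beta> ^ 3)"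

text \<open>\<open>m \<notin> [m\<^sub>1, m\<^sub>2]\<close>, which holds for all \<open>m\<close> if \<open>m\<^sub>1\<close>, \<open>m\<^sub>2\<close> are not real.\<close>

definition outside_m1_m2 :: "real \<Rightarrow> real \<Rightarrow> real \<Rightarrow> bool" where
  "outside_m1_m2 \<alpha> \<beta> m \<longleftrightarrow>
    \<not> (m1 \<alpha> \<beta> \<in> \<real> \<and> m2 \<alpha> \<beta> \<in> \<real> \<and> Re (m1 \<alpha> \<beta>) \<le> m \<and> m \<le> Re (m2 \<alpha> \<beta>))"

end

theory Submission
  imports Defs
begin

text \<open>
  The eigenvectors \<open>\<phi>\<^sub>n\<close> of \<open>L\<close> are complete, by the spectral theorem for the compact symmetric
  operator \<open>(L + 1)\<inverse>\<close> (\<open>eigenvectors_complete\<close>). In their coordinates \<open>L\<close> is the multiplication by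
  \<open>\<mu>\<^sub>n\<close>, the phase spaces are weighted sequence spaces, and \<open>A\<close> is the diagonal family of the
  three-by-three blocks \<open>blk \<mu>\<^sub>n\<close> on its maximal domain (\<open>A_iff\<close>). The characteristic polynomial of
  \<open>blk m\<close> is, up to a constant factor, the cubic \<open>\<alpha> l\<^sup>3 + l\<^sup>2 + m (\<beta> l + 1)\<close>, so the eigenvalues of
  \<open>A\<close> are the roots of these cubics for \<open>m = \<mu>\<^sub>n\<close> (\<open>A_eigenvalue_iff\<close>).

  The spectral statements rest on the fact that the cubic is affine in \<open>m\<close>, with slope \<open>\<beta> l + 1\<close>.
  If \<open>l \<noteq> -1/\<beta>\<close> is not a root for any \<open>n\<close>, then the cubic at \<open>l\<close> grows like \<open>\<mu>\<^sub>n\<close>, which makes the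
  resolvents of the blocks bounded uniformly in \<open>n\<close>, for the weights of each phase space
  (\<open>A_resolvent\<close>). Moreover, an \<open>l \<noteq> -1/\<beta>\<close> determines the \<open>m\<close> of which it is a root, continuously in
  \<open>l\<close>. Hence the eigenvalues other than \<open>-1/\<beta>\<close> are isolated (\<open>spectrum_isolated\<close>), and the root space
  of such an eigenvalue consists of one copy, for each of the finitely many \<open>n\<close> with \<open>\<mu>\<^sub>n = m\<close>, of the
  root space of \<open>blk m\<close> (\<open>alg_mult_A\<close>). For \<open>\<alpha> < \<beta>\<close> the point \<open>-1/\<beta>\<close> itself lies in the spectrum,
  without being an eigenvalue, as the limit of the real eigenvalues (\<open>essential_spectrum_A\<close>).

  The rest is about the cubic. Its discriminant is \<open>- m\<close> times a quadratic polynomial in \<open>m\<close> with the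
  zeroes \<open>m\<^sub>1\<close> and \<open>m\<^sub>2\<close>, and the discriminant of that quadratic factors as
  \<open>C\<^sub>2 = (\<beta>/\<alpha> - 1) (\<beta>/\<alpha> - 9)\<^sup>3\<close> up to a positive factor (\<open>C2_eq\<close>); this is where the threshold
  \<open>\<alpha>/\<beta> = 1/9\<close> comes from. For \<open>\<alpha> < \<beta>\<close>, in the form
  \<open>m (\<beta> x + 1) = - x\<^sup>2 (\<alpha> x + 1)\<close> the equation confines a real root to \<open>(-1/\<alpha>, -1/\<beta>)\<close>
  and forces it to \<open>-1/\<beta>\<close> as \<open>m \<rightarrow> \<infinity>\<close>, and the real root, where it is unique, is
  increasing in \<open>m\<close> (\<open>real_root_mono\<close>). As the three roots have the sum \<open>-1/\<alpha>\<close>, each of these facts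
  about the real root is one about the real part of the conjugate pair.
\<close>

section \<open>Complex Hilbert spaces\<close>

instance complex_hilbert \<subseteq> banach ..

lemma cinner_add_left: "cinner (x + y) z = cinner x z + cinner y z"
  by (metis cinner_add_right cinner_commute complex_cnj_add)

lemma cinner_scaleC_left: "cinner (c *\<^sub>C x) y = cnj c * cinner x y"
  by (metis cinner_commute cinner_scaleC_right complex_cnj_mult)

lemma cinner_scaleR_right: "cinner x (r *\<^sub>R y) = of_real r * cinner x y"
  by (metis cinner_scaleC_right scaleC_of_real)

lemma cinner_scaleR_left: "cinner (r *\<^sub>R x) y = of_real r * cinner x y"
  by (metis cinner_scaleC_left scaleC_of_real complex_cnj_complex_of_real)

lemma cinner_self: "cinner x x = of_real ((norm x)\<^sup>2)"
proof -
  have "Im (cinner x x) = 0"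
    by (metis cinner_commute complex_cnj_cancel_iff complex_In_mult_cnj_zero
        Reals_cnj_iff complex_is_Real_iff)
  then show ?thesis
    by (simp add: complex_eq_iff Re_cinner dot_square_norm)
qed

lemma norm_scaleC: "norm (c *\<^sub>C x) = cmod c * norm (x :: 'a::complex_hilbert)"
proof -
  have "complex_of_real ((norm (c *\<^sub>C x))\<^sup>2) = of_real ((cmod c * norm x)\<^sup>2)"
    using complex_norm_square[of c]
    by (simp only: cinner_self[symmetric] cinner_scaleC_left cinner_scaleC_right)
      (simp add: cinner_self power_mult_distrib mult_ac)
  then show ?thesis
    by (simp only: of_real_eq_iff) (simp add: power2_eq_iff_nonneg)
qed

text \<open>Rotating \<open>y\<close> by a phase makes the complex inner product real and nonnegative, which reduces
  the Cauchy--Schwarz inequality to the real one.\<close>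

lemma norm_cinner_le: "cmod (cinner x y) \<le> norm x * norm y"
proof (cases "cinner x y = 0")
  case False
  define c where "c = cnj (cinner x y) / of_real (cmod (cinner x y))"
  have c: "cmod c = 1"
    using False by (simp add: c_def norm_divide)
  have "c * cinner x y = of_real (cmod (cinner x y))"
    using False complex_norm_square[of "cinner x y"]
    by (simp add: c_def power2_eq_square mult.commute nonzero_divide_eq_eq)
  then have "cmod (cinner x y) = inner x (c *\<^sub>C y)"
    by (metis Re_cinner Re_complex_of_real cinner_scaleC_right)
  also have "\<dots> \<le> norm x * norm y"
    using norm_cauchy_schwarz[of x "c *\<^sub>C y"] by (simp add: norm_scaleC c)
  finally show ?thesis .
qed simp

lemma bounded_bilinear_cinner: "bounded_bilinear (cinner :: 'a::complex_hilbert \<Rightarrow> 'a \<Rightarrow> complex)"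
proof
  show "\<exists>K. \<forall>a b :: 'a. cmod (cinner a b) \<le> norm a * norm b * K"
    by (intro exI[of _ 1]) (simp add: norm_cinner_le)
qed (simp_all add: cinner_add_left cinner_add_right cinner_scaleR_left cinner_scaleR_right
      scaleR_conv_of_real)

interpretation cinner: bounded_bilinear "cinner :: 'a::complex_hilbert \<Rightarrow> 'a \<Rightarrow> complex"
  by (rule bounded_bilinear_cinner)

lemma bounded_bilinear_scaleC:
  "bounded_bilinear (scaleC :: complex \<Rightarrow> 'a::complex_hilbert \<Rightarrow> 'a)"
proof
  show "\<exists>K. \<forall>a. \<forall>b :: 'a. norm (a *\<^sub>C b) \<le> norm a * norm b * K"
    by (intro exI[of _ 1]) (simp add: norm_scaleC)
next
  fix r :: real and a :: complex and b :: 'a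
  show "(r *\<^sub>R a) *\<^sub>C b = r *\<^sub>R (a *\<^sub>C b)" "a *\<^sub>C (r *\<^sub>R b) = r *\<^sub>R (a *\<^sub>C b)"
    by (simp_all only: scaleC_of_real[symmetric] scaleC_scaleC scaleR_conv_of_real mult.commute)
qed (simp_all add: scaleC_add_left scaleC_add_right)

interpretation scaleC: bounded_bilinear "scaleC :: complex \<Rightarrow> 'a::complex_hilbert \<Rightarrow> 'a"
  by (rule bounded_bilinear_scaleC)

text \<open>A minimising sequence for the distance to \<open>S\<close> is Cauchy by the parallelogram law; at the
  limit \<open>p\<close> the first variation of the distance vanishes, so \<open>y - p\<close> is orthogonal to \<open>S\<close>.\<close>

lemma orthogonal_to_closed_subspace:
  fixes S :: "'a::{real_inner, complete_space} set"
  assumes "subspace S" "closed S" "y \<notin> S"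
  obtains z where "z \<noteq> 0" "\<And>s. s \<in> S \<Longrightarrow> inner z s = 0"
proof -
  define d where "d = infdist y S"
  have ne: "S \<noteq> {}"
    using assms(1) subspace_0 by blast
  have d_le: "d \<le> norm (y - s)" if "s \<in> S" for s
    unfolding d_def using infdist_le[OF that, of y] by (simp add: dist_norm)
  have d0: "0 \<le> d"
    unfolding d_def by (rule infdist_nonneg)
  have "\<exists>s\<in>S. norm (y - s) < d + inverse (real (Suc n))" for n
  proof (rule ccontr)
    assume "\<not> ?thesis"
    then have "d + inverse (real (Suc n)) \<le> dist y s" if "s \<in> S" for s
      using that by (auto simp: dist_norm not_less)
    then have "d + inverse (real (Suc n)) \<le> d"
      unfolding d_def by (subst (2) infdist_notempty[OF ne]) (rule cINF_greatest[OF ne])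
    then show False
      by simp
  qed
  then obtain p where pS: "\<And>n. p n \<in> S" and p: "\<And>n. norm (y - p n) < d + inverse (real (Suc n))"
    by metis
  have lim_d: "(\<lambda>n. norm (y - p n)) \<longlonglongrightarrow> d"
  proof (rule tendsto_sandwich[of "\<lambda>_. d" _ _ "\<lambda>n. d + inverse (real (Suc n))"])
    show "(\<lambda>n. d + inverse (real (Suc n))) \<longlonglongrightarrow> d"
      using tendsto_add[OF tendsto_const LIMSEQ_inverse_real_of_nat] by simp
  qed (use d_le[OF pS] less_imp_le[OF p] in \<open>auto intro!: always_eventually simp del: of_nat_Suc\<close>)
  have para: "(norm (p m - p n))\<^sup>2 \<le> 2 * (norm (y - p m))\<^sup>2 + 2 * (norm (y - p n))\<^sup>2 - 4 * d\<^sup>2" for m n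
  proof -
    have "(1/2) *\<^sub>R (p m + p n) \<in> S"
      by (intro subspace_scale subspace_add assms(1) pS)
    then have "d\<^sup>2 \<le> (norm (y - (1/2) *\<^sub>R (p m + p n)))\<^sup>2"
      using d_le d0 by (intro power_mono) auto
    moreover have "(norm (p m - p n))\<^sup>2 = 2 * (norm (y - p m))\<^sup>2 + 2 * (norm (y - p n))\<^sup>2
        - 4 * (norm (y - (1/2) *\<^sub>R (p m + p n)))\<^sup>2"
      by (simp add: power2_norm_eq_inner inner_simps inner_commute algebra_simps)
    ultimately show ?thesis
      by linarith
  qed
  have "Cauchy p"
  proof (rule CauchyI)
    fix e :: real
    assume e: "0 < e"
    have "(\<lambda>n. (norm (y - p n))\<^sup>2) \<longlonglongrightarrow> d\<^sup>2"
      by (intro tendsto_power lim_d)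
    then have "eventually (\<lambda>n. (norm (y - p n))\<^sup>2 < d\<^sup>2 + e\<^sup>2 / 4) sequentially"
      using e by (intro order_tendstoD(2)) auto
    then obtain M where M: "\<And>n. n \<ge> M \<Longrightarrow> (norm (y - p n))\<^sup>2 < d\<^sup>2 + e\<^sup>2 / 4"
      by (auto simp: eventually_sequentially)
    have "norm (p m - p n) < e" if "m \<ge> M" "n \<ge> M" for m n
    proof -
      have "(norm (p m - p n))\<^sup>2 < e\<^sup>2"
        using para[of m n] M[OF that(1)] M[OF that(2)] by linarith
      then show ?thesis
        using e by (intro power_less_imp_less_base[of _ 2 e]) auto
    qed
    then show "\<exists>M. \<forall>m\<ge>M. \<forall>n\<ge>M. norm (p m - p n) < e"
      by blast
  qed
  then obtain q where q: "p \<longlonglongrightarrow> q"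
    using Cauchy_convergent convergent_def by blast
  have qS: "q \<in> S"
    using assms(2) pS q by (auto simp: closed_sequential_limits)
  have norm_q: "norm (y - q) = d"
    using LIMSEQ_unique[OF tendsto_norm[OF tendsto_diff[OF tendsto_const q]] lim_d] .
  have orth: "inner (y - q) s = 0" if s: "s \<in> S" for s
  proof (cases "s = 0")
    case False
    \<comment> \<open>the point \<open>q + t s\<close> nearest to \<open>y\<close>; as \<open>q\<close> is already nearest, \<open>t = 0\<close>\<close>
    define t where "t = inner (y - q) s / (norm s)\<^sup>2"
    have "q + t *\<^sub>R s \<in> S"
      by (intro subspace_scale subspace_add assms(1) qS s)
    then have "d\<^sup>2 \<le> (norm (y - (q + t *\<^sub>R s)))\<^sup>2"
      using d_le d0 by (intro power_mono) auto
    also have "\<dots> = d\<^sup>2 - 2 * t * inner (y - q) s + t\<^sup>2 * (norm s)\<^sup>2"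
      using dot_norm_neg[of "y - q" "t *\<^sub>R s"]
      by (simp add: norm_q power_mult_distrib algebra_simps)
    also have "\<dots> = d\<^sup>2 - (inner (y - q) s)\<^sup>2 / (norm s)\<^sup>2"
      using False by (simp add: t_def power2_eq_square field_simps)
    finally show ?thesis
      using False by (simp add: divide_le_0_iff)
  qed simp
  show ?thesis
    using that[of "y - q"] orth qS assms(3) by auto
qed

subsection \<open>Orthonormal sequences\<close>

locale orthonormal_sequence =
  fixes \<phi> :: "nat \<Rightarrow> 'a::complex_hilbert"
  assumes orthonormal: "cinner (\<phi> m) (\<phi> n) = (if m = n then 1 else 0)"
begin

lemma norm_sum_sq:
  assumes "finite F"
  shows "(norm (\<Sum>n\<in>F. c n *\<^sub>C \<phi> n))\<^sup>2 = (\<Sum>n\<in>F. (cmod (c n))\<^sup>2)"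
proof -
  have "complex_of_real ((norm (\<Sum>n\<in>F. c n *\<^sub>C \<phi> n))\<^sup>2) = (\<Sum>n\<in>F. \<Sum>m\<in>F. c m * (cnj (c n) * (if n = m then 1 else 0)))"
    unfolding cinner_self[symmetric] cinner.sum_left
    by (simp only: cinner.sum_right cinner_scaleC_left cinner_scaleC_right orthonormal)
  also have "\<dots> = (\<Sum>n\<in>F. cnj (c n) * c n)"
  proof (rule sum.cong[OF refl])
    fix n assume n: "n \<in> F"
    have "(\<Sum>m\<in>F. c m * (cnj (c n) * (if n = m then 1 else 0))) = (\<Sum>m\<in>F. if n = m then cnj (c n) * c m else 0)"
      by (rule sum.cong) auto
    then show "(\<Sum>m\<in>F. c m * (cnj (c n) * (if n = m then 1 else 0))) = cnj (c n) * c n"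
      using assms n by simp
  qed
  also have "\<dots> = of_real (\<Sum>n\<in>F. (cmod (c n))\<^sup>2)"
    by (simp only: of_real_sum complex_norm_square mult.commute)
  finally show ?thesis
    by (simp only: of_real_eq_iff)
qed

text \<open>Riesz--Fischer: partial sums of both series have the same increments, by Pythagoras.\<close>

lemma summable_iff: "summable (\<lambda>n. c n *\<^sub>C \<phi> n) \<longleftrightarrow> summable (\<lambda>n. (cmod (c n))\<^sup>2)"
proof
  assume "summable (\<lambda>n. c n *\<^sub>C \<phi> n)"
  then have "\<exists>N. \<forall>m\<ge>N. \<forall>n. norm (\<Sum>k=m..<n. (cmod (c k))\<^sup>2) < e" if "0 < e" for e
  proof -
    obtain N where N: "norm (\<Sum>k=m..<n. c k *\<^sub>C \<phi> k) < sqrt e" if "m \<ge> N" for m n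
      using iffD1[OF summable_Cauchy \<open>summable (\<lambda>n. c n *\<^sub>C \<phi> n)\<close>, THEN spec[of _ "sqrt e"]] \<open>0 < e\<close>
      by auto
    have "norm (\<Sum>k=m..<n. (cmod (c k))\<^sup>2) < e" if "m \<ge> N" for m n
    proof -
      have "(norm (\<Sum>k=m..<n. c k *\<^sub>C \<phi> k))\<^sup>2 < (sqrt e)\<^sup>2"
        using N[OF that, of n] by (intro power_strict_mono) auto
      then show ?thesis
        using \<open>0 < e\<close> by (simp add: norm_sum_sq sum_nonneg)
    qed
    then show ?thesis
      by blast
  qed
  then show "summable (\<lambda>n. (cmod (c n))\<^sup>2)"
    unfolding summable_Cauchy by blast
next
  assume "summable (\<lambda>n. (cmod (c n))\<^sup>2)"
  then have "\<exists>N. \<forall>m\<ge>N. \<forall>n. norm (\<Sum>k=m..<n. c k *\<^sub>C \<phi> k) < e" if "0 < e" for e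
  proof -
    obtain N where N: "norm (\<Sum>k=m..<n. (cmod (c k))\<^sup>2) < e\<^sup>2" if "m \<ge> N" for m n
      using iffD1[OF summable_Cauchy \<open>summable (\<lambda>n. (cmod (c n))\<^sup>2)\<close>, THEN spec[of _ "e\<^sup>2"]] \<open>0 < e\<close>
      by auto
    have "norm (\<Sum>k=m..<n. c k *\<^sub>C \<phi> k) < e" if "m \<ge> N" for m n
      using N[OF that, of n] \<open>0 < e\<close>
      by (intro power_less_imp_less_base[of _ 2 e]) (auto simp: norm_sum_sq sum_nonneg)
    then show ?thesis
      by blast
  qed
  then show "summable (\<lambda>n. c n *\<^sub>C \<phi> n)"
    unfolding summable_Cauchy by blast
qed

lemma cinner_suminf:
  assumes "summable (\<lambda>n. c n *\<^sub>C \<phi> n)"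
  shows "cinner (\<phi> m) (\<Sum>n. c n *\<^sub>C \<phi> n) = c m"
proof -
  have "(\<lambda>n. cinner (\<phi> m) (c n *\<^sub>C \<phi> n)) sums cinner (\<phi> m) (\<Sum>n. c n *\<^sub>C \<phi> n)"
    by (rule bounded_linear.sums[OF cinner.bounded_linear_right summable_sums[OF assms]])
  moreover have "(\<lambda>n. cinner (\<phi> m) (c n *\<^sub>C \<phi> n)) = (\<lambda>n. if n = m then c m else 0)"
    by (auto simp: cinner_scaleC_right orthonormal)
  ultimately show ?thesis
    using sums_single[of m "\<lambda>_. c m"] sums_unique2 by auto
qed

lemma norm_suminf_sq:
  assumes "summable (\<lambda>n. c n *\<^sub>C \<phi> n)"
  shows "(norm (\<Sum>n. c n *\<^sub>C \<phi> n))\<^sup>2 = (\<Sum>n. (cmod (c n))\<^sup>2)"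
proof -
  have "(\<lambda>N. (norm (\<Sum>n<N. c n *\<^sub>C \<phi> n))\<^sup>2) \<longlonglongrightarrow> (norm (\<Sum>n. c n *\<^sub>C \<phi> n))\<^sup>2"
    by (intro tendsto_intros summable_LIMSEQ assms)
  then have "(\<lambda>n. (cmod (c n))\<^sup>2) sums (norm (\<Sum>n. c n *\<^sub>C \<phi> n))\<^sup>2"
    by (simp add: norm_sum_sq sums_def)
  then show ?thesis
    by (simp add: sums_iff)
qed

text \<open>Bessel: subtracting a partial sum of the expansion from \<open>x\<close> leaves a nonnegative square.\<close>

lemma bessel: "summable (\<lambda>n. (cmod (cinner (\<phi> n) x))\<^sup>2)"
proof (rule summableI_nonneg_bounded[of _ "(norm x)\<^sup>2"])
  fix N
  define s where "s = (\<Sum>n<N. cinner (\<phi> n) x *\<^sub>C \<phi> n)"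
  have sx: "cinner s x = of_real (\<Sum>n<N. (cmod (cinner (\<phi> n) x))\<^sup>2)"
    unfolding s_def
    by (simp only: cinner.sum_left cinner_scaleC_left of_real_sum complex_norm_square mult.commute)
  have "(norm s)\<^sup>2 = (\<Sum>n<N. (cmod (cinner (\<phi> n) x))\<^sup>2)"
    unfolding s_def by (simp add: norm_sum_sq)
  moreover have "inner s x = (\<Sum>n<N. (cmod (cinner (\<phi> n) x))\<^sup>2)"
    by (metis Re_cinner Re_complex_of_real sx)
  moreover have "0 \<le> (norm (x - s))\<^sup>2"
    by simp
  moreover have "(norm (x - s))\<^sup>2 = (norm x)\<^sup>2 - 2 * inner s x + (norm s)\<^sup>2"
    by (simp add: power2_norm_eq_inner inner_simps inner_commute)
  ultimately show "(\<Sum>n<N. (cmod (cinner (\<phi> n) x))\<^sup>2) \<le> (norm x)\<^sup>2"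
    by linarith
qed simp

end

locale orthonormal_basis = orthonormal_sequence +
  assumes complete: "(\<And>n. cinner (\<phi> n) x = 0) \<Longrightarrow> x = 0"
begin

lemma coords_eqI: "(\<And>n. cinner (\<phi> n) x = cinner (\<phi> n) y) \<Longrightarrow> x = y"
  using complete[of "x - y"] by (simp add: cinner.diff_right)

lemma expansion: "(\<lambda>n. cinner (\<phi> n) x *\<^sub>C \<phi> n) sums x"
proof -
  have s: "summable (\<lambda>n. cinner (\<phi> n) x *\<^sub>C \<phi> n)"
    by (simp add: summable_iff bessel)
  then have "(\<Sum>n. cinner (\<phi> n) x *\<^sub>C \<phi> n) = x"
    by (intro coords_eqI) (simp add: cinner_suminf)
  then show ?thesis
    using s by (simp add: sums_iff)
qed

end

subsection \<open>The spectral theorem\<close>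

text \<open>With \<open>c\<close> the norm of \<open>T\<close> on \<open>M\<close>, a sequence of unit vectors \<open>x\<^sub>n\<close> with
  \<open>\<parallel>T x\<^sub>n\<parallel> \<rightarrow> c\<close> satisfies \<open>T\<^sup>2 x\<^sub>n - c\<^sup>2 x\<^sub>n \<rightarrow> 0\<close>. By compactness a subsequence of \<open>T\<^sup>2 x\<^sub>n\<close>, hence of
  \<open>x\<^sub>n\<close>, converges, to an \<open>x\<close> with \<open>(T - c) (T + c) x = 0\<close>; so \<open>x\<close> or \<open>(T + c) x\<close> is an
  eigenvector.\<close>

lemma compact_symmetric_eigenvector:
  fixes T :: "'a::real_inner \<Rightarrow> 'a"
  assumes T: "bounded_linear T" and M: "subspace M" "closed M"
    and inv: "\<And>x. x \<in> M \<Longrightarrow> T x \<in> M"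
    and sym: "\<And>x y. inner (T x) y = inner x (T y)"
    and cpt: "\<And>x :: nat \<Rightarrow> 'a. (\<And>n. norm (x n) \<le> 1) \<Longrightarrow> \<exists>r y. strict_mono r \<and> (\<lambda>n. T (x (r n))) \<longlonglongrightarrow> y"
    and ne: "\<exists>x\<in>M. T x \<noteq> 0"
  obtains z k where "z \<in> M" "z \<noteq> 0" "k \<noteq> 0" "T z = k *\<^sub>R z"
proof -
  interpret T: bounded_linear T by (rule T)
  define U where "U = {x\<in>M. norm x = 1}"
  define c where "c = (SUP x\<in>U. norm (T x))"
  obtain K where K: "\<And>x. norm (T x) \<le> norm x * K"
    using T.bounded by blast
  have bdd: "bdd_above ((\<lambda>x. norm (T x)) ` U)"
    using K by (intro bdd_aboveI[of _ K]) (auto simp: U_def, metis mult_1)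
  obtain x0 where x0: "x0 \<in> M" "T x0 \<noteq> 0"
    using ne by blast
  then have "x0 \<noteq> 0"
    using T.zero by auto
  then have x0U: "(1 / norm x0) *\<^sub>R x0 \<in> U"
    using x0 M by (simp add: U_def subspace_scale)
  have "0 < norm (T ((1 / norm x0) *\<^sub>R x0))"
    using x0 \<open>x0 \<noteq> 0\<close> by (simp add: T.scaleR)
  also have "\<dots> \<le> c"
    unfolding c_def by (rule cSUP_upper[OF x0U bdd])
  finally have c: "0 < c" .
  have Tc: "norm (T x) \<le> c * norm x" if "x \<in> M" for x
  proof (cases "x = 0")
    case False
    then have "(1 / norm x) *\<^sub>R x \<in> U"
      using that M by (simp add: U_def subspace_scale)
    then have "norm (T ((1 / norm x) *\<^sub>R x)) \<le> c"
      unfolding c_def by (rule cSUP_upper[OF _ bdd])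
    then show ?thesis
      using False by (simp add: T.scaleR field_simps)
  qed (simp add: T.zero)
  have "\<exists>x\<in>U. c - inverse (real (Suc n)) < norm (T x)" for n
  proof -
    have "c - inverse (real (Suc n)) < (SUP x\<in>U. norm (T x))"
      unfolding c_def by simp
    then show ?thesis
      using less_cSUP_iff[OF _ bdd, of "c - inverse (real (Suc n))"] x0U by blast
  qed
  then obtain x where xU: "\<And>n. x n \<in> U" and xc: "\<And>n. c - inverse (real (Suc n)) < norm (T (x n))"
    by metis
  have xM: "x n \<in> M" and x1: "norm (x n) = 1" for n
    using xU[of n] by (auto simp: U_def)
  have lim_c: "(\<lambda>n. norm (T (x n))) \<longlonglongrightarrow> c"
  proof (rule tendsto_sandwich[of "\<lambda>n. c - inverse (real (Suc n))" _ _ "\<lambda>_. c"])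
    show "(\<lambda>n. c - inverse (real (Suc n))) \<longlonglongrightarrow> c"
      using tendsto_diff[OF tendsto_const LIMSEQ_inverse_real_of_nat] by simp
    show "eventually (\<lambda>n. norm (T (x n)) \<le> c) sequentially"
      using Tc[OF xM] by (intro always_eventually) (simp add: x1)
  qed (use less_imp_le[OF xc] in \<open>auto intro!: always_eventually simp del: of_nat_Suc\<close>)
  have sq: "(norm (T (T (x n)) - c\<^sup>2 *\<^sub>R x n))\<^sup>2 \<le> 2 * c\<^sup>2 * (c\<^sup>2 - (norm (T (x n)))\<^sup>2)" for n
  proof -
    have "norm (T (T (x n))) \<le> c * norm (T (x n))"
      using Tc inv xM by blast
    also have "\<dots> \<le> c * c"
      using Tc[OF xM, of n] c by (simp add: x1)
    finally have "(norm (T (T (x n))))\<^sup>2 \<le> (c * c)\<^sup>2"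
      by (rule power_mono) simp
    moreover have "(norm (T (T (x n)) - c\<^sup>2 *\<^sub>R x n))\<^sup>2
        = (norm (T (T (x n))))\<^sup>2 - 2 * c\<^sup>2 * (norm (T (x n)))\<^sup>2 + c\<^sup>2 * c\<^sup>2 * (norm (x n))\<^sup>2"
      using dot_norm_neg[of "T (T (x n))" "c\<^sup>2 *\<^sub>R x n"]
      by (simp add: sym[of "T (x n)" "x n"] power_mult_distrib power2_eq_square[of "c\<^sup>2"]
          flip: power2_norm_eq_inner)
    ultimately show ?thesis
      by (simp add: x1 power2_eq_square algebra_simps)
  qed
  have "(\<lambda>n. 2 * c\<^sup>2 * (c\<^sup>2 - (norm (T (x n)))\<^sup>2)) \<longlonglongrightarrow> 2 * c\<^sup>2 * (c\<^sup>2 - c\<^sup>2)"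
    by (intro tendsto_intros lim_c)
  then have "(\<lambda>n. (norm (T (T (x n)) - c\<^sup>2 *\<^sub>R x n))\<^sup>2) \<longlonglongrightarrow> 0"
    by (intro tendsto_sandwich[OF _ always_eventually[OF allI[OF sq]] tendsto_const]) simp_all
  then have "(\<lambda>n. sqrt ((norm (T (T (x n)) - c\<^sup>2 *\<^sub>R x n))\<^sup>2)) \<longlonglongrightarrow> sqrt 0"
    by (rule tendsto_real_sqrt)
  then have lim0: "(\<lambda>n. T (T (x n)) - c\<^sup>2 *\<^sub>R x n) \<longlonglongrightarrow> 0"
    by (simp add: tendsto_norm_zero_iff)
  obtain r y where r: "strict_mono r" and y: "(\<lambda>n. T (x (r n))) \<longlonglongrightarrow> y"
    using cpt[of x, OF eq_refl[OF x1]] by blast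
  have "(\<lambda>n. (1 / c\<^sup>2) *\<^sub>R (T (T (x (r n))) - (T (T (x (r n))) - c\<^sup>2 *\<^sub>R x (r n))))
      \<longlonglongrightarrow> (1 / c\<^sup>2) *\<^sub>R (T y - 0)"
    using LIMSEQ_subseq_LIMSEQ[OF lim0 r] unfolding o_def
    by (intro tendsto_intros T.tendsto y)
  then have lim_x: "(\<lambda>n. x (r n)) \<longlonglongrightarrow> (1 / c\<^sup>2) *\<^sub>R T y"
    using c by simp
  define w where "w = (1 / c\<^sup>2) *\<^sub>R T y"
  have wM: "w \<in> M"
    unfolding w_def by (rule closed_sequentially[OF M(2) xM lim_x])
  have "norm w = 1"
    by (rule LIMSEQ_unique[OF tendsto_norm[OF lim_x, folded w_def, unfolded x1] tendsto_const])
  then have w0: "w \<noteq> 0"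
    by auto
  have "T w = y"
    using LIMSEQ_unique[OF T.tendsto[OF lim_x] y] by (simp add: w_def)
  then have TTw: "T (T w) = c\<^sup>2 *\<^sub>R w"
    using c by (simp add: w_def)
  show ?thesis
  proof (cases "T w + c *\<^sub>R w = 0")
    case True
    then have "T w = (- c) *\<^sub>R w"
      by (simp add: eq_neg_iff_add_eq_0)
    then show ?thesis
      using that[of w "- c"] wM w0 c by simp
  next
    case False
    have "T (T w + c *\<^sub>R w) = c *\<^sub>R (T w + c *\<^sub>R w)"
      by (simp add: T.add T.scaleR TTw scaleR_add_right power2_eq_square)
    then show ?thesis
      using that[of "T w + c *\<^sub>R w" c] False c wM inv M(1) by (simp add: subspace_add subspace_scale)
  qed
qed

lemma self_adjoint_symmetric:
  "self_adjoint D L \<Longrightarrow> x \<in> D \<Longrightarrow> y \<in> D \<Longrightarrow> cinner (L x) y = cinner x (L y)"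
  unfolding self_adjoint_def by blast

lemma self_adjointD:
  "self_adjoint D L \<Longrightarrow> (\<And>x. x \<in> D \<Longrightarrow> cinner (L x) y = cinner x z) \<Longrightarrow> y \<in> D \<and> L y = z"
  unfolding self_adjoint_def by blast

locale positive_operator =
  fixes D :: "'a::complex_hilbert set" and L :: "'a \<Rightarrow> 'a"
  assumes sa: "self_adjoint D L" and pos: "strictly_positive D L"
begin

lemma subspace_D: "cvec.subspace D"
  and L_add: "x \<in> D \<Longrightarrow> y \<in> D \<Longrightarrow> L (x + y) = L x + L y"
  and L_scaleC: "x \<in> D \<Longrightarrow> L (c *\<^sub>C x) = c *\<^sub>C L x"
  using sa unfolding self_adjoint_def linear_on_def by blast+

lemma L_0: "L 0 = 0"
  using L_scaleC[OF cvec.subspace_0[OF subspace_D], of 0] by simp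

lemma L_diff: "x \<in> D \<Longrightarrow> y \<in> D \<Longrightarrow> L (x - y) = L x - L y"
  using L_add[of "x - y" y] cvec.subspace_diff[OF subspace_D] by simp

lemma inner_L_nonneg: "x \<in> D \<Longrightarrow> 0 \<le> inner x (L x)"
  using pos unfolding strictly_positive_def Re_cinner by (cases "x = 0") (auto intro: less_imp_le)

lemma norm_le_L_plus_1: "x \<in> D \<Longrightarrow> norm x \<le> norm (L x + x)"
proof -
  assume x: "x \<in> D"
  have "norm x * norm x \<le> inner x (L x + x)"
    using inner_L_nonneg[OF x] by (simp add: inner_add_right flip: power2_norm_eq_inner power2_eq_square)
  also have "\<dots> \<le> norm x * norm (L x + x)"
    by (rule norm_cauchy_schwarz)
  finally show ?thesis
    by (cases "x = 0") auto
qed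

text \<open>The range of \<open>L + 1\<close> is closed, because \<open>L\<close> is closed and \<open>L + 1\<close> is bounded below. A
  vector orthogonal to the range would, by self-adjointness, be an eigenvector of \<open>L\<close> to the
  eigenvalue \<open>-1\<close>.\<close>

lemma L_plus_1_surj: "(\<lambda>x. L x + x) ` D = UNIV"
proof (rule ccontr)
  define S where "S = (\<lambda>x. L x + x) ` D"
  assume "(\<lambda>x. L x + x) ` D \<noteq> UNIV"
  then obtain y where y: "y \<notin> S"
    unfolding S_def by blast
  have scaleS: "c *\<^sub>C s \<in> S" if "s \<in> S" for c s
  proof -
    obtain x where "x \<in> D" "s = L x + x"
      using \<open>s \<in> S\<close> by (auto simp: S_def)
    then show ?thesis
      unfolding S_def using cvec.subspace_scale[OF subspace_D]
      by (intro image_eqI[of _ _ "c *\<^sub>C x"]) (auto simp: L_scaleC scaleC_add_right)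
  qed
  have sub: "subspace S"
  proof (rule subspaceI)
    show "0 \<in> S"
      unfolding S_def using cvec.subspace_0[OF subspace_D] by (intro image_eqI[of _ _ 0]) (auto simp: L_0)
    show "r *\<^sub>R s \<in> S" if "s \<in> S" for r s
      using scaleS[OF that, of "of_real r"] by (simp add: scaleC_of_real)
    show "s + t \<in> S" if st: "s \<in> S" "t \<in> S" for s t
    proof -
      obtain a b where "a \<in> D" "s = L a + a" "b \<in> D" "t = L b + b"
        using st by (auto simp: S_def)
      then show ?thesis
        unfolding S_def using cvec.subspace_add[OF subspace_D]
        by (intro image_eqI[of _ _ "a + b"]) (auto simp: L_add)
    qed
  qed
  have "closed S"
    unfolding closed_sequential_limits
  proof (intro allI impI, elim conjE)
    fix f l
    assume f: "\<forall>n. f n \<in> S" and fl: "f \<longlonglongrightarrow> l"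
    obtain x where xD: "\<And>n. x n \<in> D" and x: "\<And>n. f n = L (x n) + x n"
      using f choice[of "\<lambda>n x. x \<in> D \<and> f n = L x + x"] unfolding S_def by blast
    have "dist (x m) (x n) \<le> dist (f m) (f n)" for m n
      using norm_le_L_plus_1[OF cvec.subspace_diff[OF subspace_D xD xD], of m n]
      by (simp add: dist_norm L_diff xD x algebra_simps)
    then have "Cauchy x"
      using LIMSEQ_imp_Cauchy[OF fl] unfolding Cauchy_def by (meson le_less_trans)
    then obtain a where a: "x \<longlonglongrightarrow> a"
      using Cauchy_convergent convergent_def by blast
    have "a \<in> D \<and> L a = l - a"
    proof (rule self_adjointD[OF sa])
      fix z assume z: "z \<in> D"
      have "(\<lambda>n. cinner (L z) (x n)) \<longlonglongrightarrow> cinner (L z) a"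
        by (intro cinner.tendsto tendsto_const a)
      moreover have "(\<lambda>n. cinner z (f n - x n)) \<longlonglongrightarrow> cinner z (l - a)"
        by (intro cinner.tendsto tendsto_const tendsto_diff fl a)
      moreover have "cinner z (f n - x n) = cinner (L z) (x n)" for n
        by (simp add: x self_adjoint_symmetric[OF sa z xD])
      ultimately show "cinner (L z) a = cinner z (l - a)"
        using LIMSEQ_unique by simp
    qed
    then show "l \<in> S"
      unfolding S_def by (intro image_eqI[of _ _ a]) auto
  qed
  then obtain z where z: "z \<noteq> 0" and orth: "\<And>s. s \<in> S \<Longrightarrow> inner z s = 0"
    using orthogonal_to_closed_subspace[OF sub _ y] by blast
  have orthC: "cinner z s = 0" if "s \<in> S" for s
  proof -
    have "Re (cinner z s) = 0"
      using orth[OF that] by (simp add: Re_cinner)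
    moreover have "Re (cinner z (\<i> *\<^sub>C s)) = 0"
      using orth[OF scaleS[OF that]] by (simp add: Re_cinner)
    ultimately show ?thesis
      by (simp add: complex_eq_iff cinner_scaleC_right)
  qed
  have "z \<in> D \<and> L z = - z"
  proof (rule self_adjointD[OF sa])
    fix x assume x: "x \<in> D"
    have "cinner (L x + x) z = 0"
      using orthC[of "L x + x"] x by (metis S_def cinner_commute complex_cnj_zero imageI)
    then show "cinner (L x) z = cinner x (- z)"
      by (simp add: cinner_add_left cinner.minus_right eq_neg_iff_add_eq_0)
  qed
  then have "0 \<le> inner z (- z)"
    using inner_L_nonneg by metis
  then show False
    using z by (metis inner_gt_zero_iff inner_minus_right neg_0_le_iff_le not_less)
qed

definition T where "T y = inv_into D (\<lambda>x. L x + x) y"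

lemma T_D: "T y \<in> D" and L_T: "L (T y) + T y = y"
  unfolding T_def using L_plus_1_surj inv_into_into[of y "\<lambda>x. L x + x" D]
    f_inv_into_f[of y "\<lambda>x. L x + x" D] by auto

lemma T_unique: "x \<in> D \<Longrightarrow> L x + x = y \<Longrightarrow> T y = x"
proof -
  assume x: "x \<in> D" "L x + x = y"
  have "norm (T y - x) \<le> norm (L (T y - x) + (T y - x))"
    by (intro norm_le_L_plus_1 cvec.subspace_diff[OF subspace_D] T_D x)
  also have "L (T y - x) + (T y - x) = (L (T y) + T y) - (L x + x)"
    by (simp add: L_diff T_D x(1))
  finally show ?thesis
    by (simp add: L_T x)
qed

lemma T_scaleC: "T (c *\<^sub>C y) = c *\<^sub>C T y"
  by (intro T_unique cvec.subspace_scale[OF subspace_D] T_D)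
    (simp add: L_scaleC T_D L_T flip: scaleC_add_right)

lemma bounded_linear_T: "bounded_linear T"
proof (rule bounded_linear_intro[of _ 1])
  show "T (x + y) = T x + T y" for x y
    using L_T[of x] L_T[of y]
    by (intro T_unique cvec.subspace_add[OF subspace_D] T_D) (simp add: L_add T_D algebra_simps)
  show "T (r *\<^sub>R x) = r *\<^sub>R T x" for r x
    using T_scaleC[of "of_real r"] by (simp add: scaleC_of_real)
  show "norm (T x) \<le> norm x * 1" for x
    using norm_le_L_plus_1[OF T_D, of x] by (simp add: L_T)
qed

lemma T_symmetric: "cinner (T x) y = cinner x (T y)"
proof -
  have "cinner (T x) (L (T y) + T y) = cinner (L (T x) + T x) (T y)"
    by (simp add: cinner_add_left cinner_add_right self_adjoint_symmetric[OF sa T_D T_D])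
  then show ?thesis
    by (simp add: L_T)
qed

text \<open>Compactness passes from one resolvent to another, because
  \<open>T = (L - l)\<inverse> (1 - (1 + l) T)\<close>.\<close>

lemma T_compact:
  assumes "compact_resolvent D L" and x: "\<And>n :: nat. norm (x n) \<le> 1"
  shows "\<exists>r y. strict_mono r \<and> (\<lambda>n. T (x (r n))) \<longlonglongrightarrow> y"
proof -
  obtain l where bij: "bij_betw (\<lambda>x. L x - l *\<^sub>C x) D UNIV"
    and cpt: "compact (closure (inv_into D (\<lambda>x. L x - l *\<^sub>C x) ` ball 0 1))"
    using assms(1) unfolding compact_resolvent_def resolvent_set_def by blast
  \<comment> \<open>large enough to bring \<open>y\<^sub>n\<close> below into the open unit ball\<close>
  define C where "C = 2 + cmod (1 + l)"
  have C: "0 < C"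
    by (simp add: C_def add_pos_nonneg)
  define y where "y n = x n - (1 + l) *\<^sub>C T (x n)" for n
  have "(1 / C) *\<^sub>R T (x n) \<in> inv_into D (\<lambda>x. L x - l *\<^sub>C x) ` ball 0 1" for n
  proof (rule image_eqI)
    have TD: "(1 / C) *\<^sub>R T (x n) \<in> D"
      using cvec.subspace_scale[OF subspace_D T_D, of "of_real (1 / C)"] by (simp only: scaleC_of_real)
    have "L (T (x n)) - l *\<^sub>C T (x n) = y n"
      using L_T[of "x n"] by (simp add: y_def scaleC_add_left scaleC_one algebra_simps)
    then have "L ((1 / C) *\<^sub>R T (x n)) - l *\<^sub>C ((1 / C) *\<^sub>R T (x n)) = (1 / C) *\<^sub>R y n"
      by (simp only: scaleC_of_real[symmetric] L_scaleC[OF T_D] scaleC_scaleC mult.commute[of l])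
        (simp only: scaleC_scaleC[symmetric] cvec.scale_right_diff_distrib[symmetric])
    then show "(1 / C) *\<^sub>R T (x n) = inv_into D (\<lambda>x. L x - l *\<^sub>C x) ((1 / C) *\<^sub>R y n)"
      using inv_into_f_f[OF bij_betw_imp_inj_on[OF bij] TD] by simp
    have "norm (T (x n)) \<le> norm (x n)"
      using norm_le_L_plus_1[OF T_D, of "x n"] by (simp add: L_T)
    then have "norm (y n) \<le> norm (x n) + cmod (1 + l) * norm (x n)"
      unfolding y_def by (intro order_trans[OF norm_triangle_ineq4] add_mono order_refl)
        (auto simp: norm_scaleC intro: mult_left_mono)
    also have "\<dots> \<le> 1 + cmod (1 + l) * 1"
      by (intro add_mono mult_left_mono x) auto
    finally show "(1 / C) *\<^sub>R y n \<in> ball 0 1"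
      using C by (simp add: C_def)
  qed
  then have "\<forall>n. (1 / C) *\<^sub>R T (x n) \<in> closure (inv_into D (\<lambda>x. L x - l *\<^sub>C x) ` ball 0 1)"
    using closure_subset by blast
  then obtain a r where r: "strict_mono r" and "((\<lambda>n. (1 / C) *\<^sub>R T (x n)) \<circ> r) \<longlonglongrightarrow> a"
    using seq_compactE[OF cpt[unfolded compact_eq_seq_compact_metric]] by metis
  then have "(\<lambda>n. C *\<^sub>R ((1 / C) *\<^sub>R T (x (r n)))) \<longlonglongrightarrow> C *\<^sub>R a"
    unfolding o_def by (intro tendsto_intros)
  then show ?thesis
    using r C by auto
qed

text \<open>On the orthogonal complement of all eigenvectors the compact operator \<open>T\<close> would have a
  further eigenvector.\<close>

lemma eigenvectors_complete:
  assumes cr: "compact_resolvent D L" and en: "eigen_enumeration D L \<mu> \<phi>"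
  shows "orthonormal_basis \<phi>"
proof
  show "cinner (\<phi> m) (\<phi> n) = (if m = n then 1 else 0)" for m n
    using en unfolding eigen_enumeration_def by blast
  have mupos: "0 < \<mu> n" and phiD: "\<phi> n \<in> D" and Lphi: "L (\<phi> n) = complex_of_real (\<mu> n) *\<^sub>C \<phi> n" for n
    using en unfolding eigen_enumeration_def by blast+
  have all_eigenvectors: "x \<in> cvec.span {\<phi> n |n. complex_of_real (\<mu> n) = c}"
    if "x \<in> D" "L x = c *\<^sub>C x" for c x
    using en that unfolding eigen_enumeration_def by blast
  define M where "M = {x. \<forall>n. cinner (\<phi> n) x = 0}"
  interpret T: bounded_linear T by (rule bounded_linear_T)
  fix x0 assume x0: "\<And>n. cinner (\<phi> n) x0 = 0"
  show "x0 = 0"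
  proof (rule ccontr)
    assume "x0 \<noteq> 0"
    have subM: "subspace M"
      by (rule subspaceI) (auto simp: M_def cinner_add_right cinner_scaleR_right cinner.zero_right)
    have "M = (\<Inter>n. {x. cinner (\<phi> n) x = 0})"
      by (auto simp: M_def)
    then have clM: "closed M"
      by (auto intro!: closed_Collect_eq continuous_intros linear_continuous_on cinner.bounded_linear_right)
    have invM: "T x \<in> M" if "x \<in> M" for x
    proof -
      have "T (\<phi> n) = (1 / (1 + complex_of_real (\<mu> n))) *\<^sub>C \<phi> n" for n
      proof (rule T_unique)
        have "1 + complex_of_real (\<mu> n) \<noteq> 0"
          using mupos[of n] by (metis add_pos_pos of_real_1 of_real_add of_real_eq_0_iff less_irrefl zero_less_one)
        then show "L ((1 / (1 + complex_of_real (\<mu> n))) *\<^sub>C \<phi> n) + (1 / (1 + complex_of_real (\<mu> n))) *\<^sub>C \<phi> n = \<phi> n"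
          by (simp add: L_scaleC phiD Lphi scaleC_scaleC scaleC_one flip: scaleC_add_left)
            (simp add: field_simps scaleC_one flip: add_divide_distrib)
      qed (intro cvec.subspace_scale[OF subspace_D] phiD)
      then show ?thesis
        using that by (simp add: M_def T_symmetric[symmetric] cinner_scaleC_left)
    qed
    have symT: "inner (T x) y = inner x (T y)" for x y
      by (metis Re_cinner T_symmetric)
    have "T x0 \<noteq> 0"
      using L_T[of x0] L_0 \<open>x0 \<noteq> 0\<close> by auto
    then have "\<exists>x\<in>M. T x \<noteq> 0"
      using x0 by (auto simp: M_def)
    then obtain z k where zM: "z \<in> M" and z: "z \<noteq> 0" and k: "k \<noteq> 0" "T z = k *\<^sub>R z"
      using compact_symmetric_eigenvector[OF bounded_linear_T subM clM invM symT T_compact[OF cr]]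
      by (metis (no_types, lifting))
    have Tz: "T z = complex_of_real k *\<^sub>C z"
      using k by (simp add: scaleC_of_real)
    have z_eq: "z = complex_of_real (1 / k) *\<^sub>C T z"
      unfolding Tz scaleC_scaleC of_real_mult[symmetric] using k(1) by (simp add: scaleC_one)
    have zD: "z \<in> D"
      by (subst z_eq) (intro cvec.subspace_scale[OF subspace_D] T_D)
    have "L z = complex_of_real (1 / k) *\<^sub>C L (T z)"
      by (subst z_eq) (rule L_scaleC[OF T_D])
    also have "L (T z) = z - T z"
      using L_T[of z] by (simp add: algebra_simps)
    also have "complex_of_real (1 / k) *\<^sub>C (z - T z) = complex_of_real (1 / k) *\<^sub>C z - z"
      by (simp only: cvec.scale_right_diff_distrib z_eq[symmetric])
    also have "\<dots> = complex_of_real (1 / k - 1) *\<^sub>C z"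
      by (simp add: cvec.scale_left_diff_distrib scaleC_one)
    finally have "z \<in> cvec.span {\<phi> n |n. complex_of_real (\<mu> n) = complex_of_real (1 / k - 1)}"
      by (rule all_eigenvectors[OF zD])
    moreover have "cinner z y = 0" if "y \<in> cvec.span {\<phi> n |n. complex_of_real (\<mu> n) = c}" for y c
      using that
    proof (induction rule: cvec.span_induct_alt)
      case (step c x y)
      then show ?case
        using zM cinner_commute[of z x] by (auto simp: M_def cinner_add_right cinner_scaleC_right)
    qed (simp add: cinner.zero_right)
    ultimately have "cinner z z = 0"
      by blast
    then show False
      using z by (simp add: cinner_self)
  qed
qed

end

section \<open>The characteristic cubic\<close>

lemma char_poly_eq: "char_poly \<alpha> \<beta> m = [:of_real m, of_real (\<beta> * m), 1, of_real \<alpha>:]"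
  by (cases "\<alpha> = 0") (simp_all add: char_poly_def map_poly_pCons)

lemma poly_char_poly:
  "poly (char_poly \<alpha> \<beta> m) z = of_real \<alpha> * z ^ 3 + z\<^sup>2 + of_real (\<beta> * m) * z + of_real m"
  by (simp add: char_poly_eq power2_eq_square power3_eq_cube algebra_simps)

lemma vieta:
  assumes "char_poly \<alpha> \<beta> m = smult (of_real \<alpha>) ([:- l1, 1:] * [:- l2, 1:] * [:- l3, 1:])"
  shows "of_real \<alpha> * (l1 + l2 + l3) = -1"
    and "of_real \<alpha> * (l1 * l2 + l1 * l3 + l2 * l3) = of_real (\<beta> * m)"
    and "of_real \<alpha> * (l1 * l2 * l3) = - of_real m"
proof -
  have "[:of_real m, of_real (\<beta> * m), 1, of_real \<alpha>:] = smult (of_real \<alpha>) ([:- l1, 1:] * [:- l2, 1:] * [:- l3, 1:])"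
    using assms unfolding char_poly_eq .
  also have "\<dots> = [: - (of_real \<alpha> * (l1 * l2 * l3)), of_real \<alpha> * (l1 * l2 + l1 * l3 + l2 * l3),
      - (of_real \<alpha> * (l1 + l2 + l3)), of_real \<alpha>:]"
    by (simp add: algebra_simps)
  finally have e: "complex_of_real m = - (of_real \<alpha> * (l1 * l2 * l3))"
    "complex_of_real (\<beta> * m) = of_real \<alpha> * (l1 * l2 + l1 * l3 + l2 * l3)"
    "1 = - (of_real \<alpha> * (l1 + l2 + l3))"
    by (simp_all only: pCons_eq_iff)
  show "of_real \<alpha> * (l1 + l2 + l3) = -1"
    using e(3) by algebra
  show "of_real \<alpha> * (l1 * l2 + l1 * l3 + l2 * l3) = of_real (\<beta> * m)"
    by (rule e(2)[symmetric])
  show "of_real \<alpha> * (l1 * l2 * l3) = - of_real m"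
    using e(1) by algebra
qed

lemma poly_char_poly_factored:
  assumes "char_poly \<alpha> \<beta> m = smult (of_real \<alpha>) ([:- l1, 1:] * [:- l2, 1:] * [:- l3, 1:])"
  shows "poly (char_poly \<alpha> \<beta> m) z = of_real \<alpha> * ((z - l1) * (z - l2) * (z - l3))"
  unfolding assms poly_smult poly_mult by simp

lemma root_iff:
  assumes "char_poly \<alpha> \<beta> m = smult (of_real \<alpha>) ([:- l1, 1:] * [:- l2, 1:] * [:- l3, 1:])" "\<alpha> \<noteq> 0"
  shows "poly (char_poly \<alpha> \<beta> m) z = 0 \<longleftrightarrow> z \<in> {l1, l2, l3}"
  using assms(2) unfolding poly_char_poly_factored[OF assms(1)] by auto

lemma root_real_eq:
  assumes "poly (char_poly \<alpha> \<beta> m) (of_real x) = 0"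
  shows "\<alpha> * x ^ 3 + x\<^sup>2 + \<beta> * m * x + m = 0"
proof -
  have "complex_of_real (\<alpha> * x ^ 3 + x\<^sup>2 + \<beta> * m * x + m) = 0"
    using assms by (simp add: poly_char_poly)
  then show ?thesis
    by (simp only: of_real_eq_0_iff)
qed

lemma root_cnj: "poly (char_poly \<alpha> \<beta> m) z = 0 \<Longrightarrow> poly (char_poly \<alpha> \<beta> m) (cnj z) = 0"
proof -
  assume "poly (char_poly \<alpha> \<beta> m) z = 0"
  then have "cnj (poly (char_poly \<alpha> \<beta> m) z) = 0"
    by simp
  then show ?thesis
    by (simp add: poly_char_poly)
qed

subsection \<open>Real and nonreal roots\<close>

text \<open>The two formulas are the imaginary part of the equation, divided by \<open>b\<close>, and its real part with
  \<open>b\<^sup>2\<close> eliminated.\<close>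

lemma nonreal_root:
  assumes "0 < \<alpha>" and z: "poly (char_poly \<alpha> \<beta> m) z = 0" and "z \<notin> \<real>"
  shows "8 * \<alpha> * Re z ^ 3 + 8 * (Re z)\<^sup>2 + 2 * Re z * (1 / \<alpha> + \<beta> * m) + m * (\<beta> / \<alpha> - 1) = 0"
    and "(Im z)\<^sup>2 = 1 / \<alpha> * (3 * \<alpha> * (Re z)\<^sup>2 + 2 * Re z + \<beta> * m)"
proof -
  define a b where "a = Re z" and "b = Im z"
  have b0: "b \<noteq> 0"
    using assms(3) by (auto simp: b_def complex_is_Real_iff)
  have re: "\<alpha> * (a ^ 3 - 3 * a * b\<^sup>2) + (a\<^sup>2 - b\<^sup>2) + \<beta> * m * a + m = 0"
    using arg_cong[OF z, of Re] unfolding poly_char_poly a_def b_def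
    by (simp add: power2_eq_square power3_eq_cube algebra_simps)
  have im: "b * (\<alpha> * (3 * a\<^sup>2 - b\<^sup>2) + 2 * a + \<beta> * m) = 0"
    using arg_cong[OF z, of Im] unfolding poly_char_poly a_def b_def
    by (simp add: power2_eq_square power3_eq_cube algebra_simps)
  then have "\<alpha> * (3 * a\<^sup>2 - b\<^sup>2) + 2 * a + \<beta> * m = 0"
    using b0 by simp
  then have ab: "\<alpha> * b\<^sup>2 = 3 * \<alpha> * a\<^sup>2 + 2 * a + \<beta> * m"
    by algebra
  then show "(Im z)\<^sup>2 = 1 / \<alpha> * (3 * \<alpha> * (Re z)\<^sup>2 + 2 * Re z + \<beta> * m)"
    using assms(1) by (simp add: a_def b_def field_simps)
  have "\<alpha> * (\<alpha> * (a ^ 3 - 3 * a * b\<^sup>2) + (a\<^sup>2 - b\<^sup>2) + \<beta> * m * a + m)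
      = - (8 * \<alpha>\<^sup>2 * a ^ 3 + 8 * \<alpha> * a\<^sup>2 + 2 * a * (1 + \<alpha> * \<beta> * m) + m * (\<beta> - \<alpha>))"
    using ab by algebra
  then have "8 * \<alpha>\<^sup>2 * a ^ 3 + 8 * \<alpha> * a\<^sup>2 + 2 * a * (1 + \<alpha> * \<beta> * m) + m * (\<beta> - \<alpha>) = 0"
    using re by simp
  then have "\<alpha> * (8 * \<alpha> * a ^ 3 + 8 * a\<^sup>2 + 2 * a * (1 / \<alpha> + \<beta> * m) + m * (\<beta> / \<alpha> - 1)) = 0"
    using assms(1) by (simp add: power2_eq_square algebra_simps)
  then show "8 * \<alpha> * Re z ^ 3 + 8 * (Re z)\<^sup>2 + 2 * Re z * (1 / \<alpha> + \<beta> * m) + m * (\<beta> / \<alpha> - 1) = 0"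
    using assms(1) by (simp add: a_def)
qed

lemma labelled_rootsD:
  assumes "labelled_roots \<alpha> \<beta> m l1 l2 l3"
  shows "char_poly \<alpha> \<beta> m = smult (of_real \<alpha>) ([:- l1, 1:] * [:- l2, 1:] * [:- l3, 1:])"
  using assms unfolding labelled_roots_def by blast

text \<open>The sum of the roots is real and nonreal roots come in conjugate pairs; so a nonreal root leaves
  exactly one real one, and the labelling applies.\<close>

lemma labelled_cases:
  assumes lab: "labelled_roots \<alpha> \<beta> m l1 l2 l3" and "0 < \<alpha>"
  shows "(l1 \<in> \<real> \<and> l2 \<in> \<real> \<and> l3 \<in> \<real>) \<or> (one_real_two_conj l1 l2 l3 \<and> 0 < Im l2)"
proof (cases "l1 \<in> \<real> \<and> l2 \<in> \<real> \<and> l3 \<in> \<real>")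
  case True
  then show ?thesis ..
next
  case False
  note fac = labelled_rootsD[OF lab]
  have cnj_root: "cnj z \<in> {l1, l2, l3}" if "z \<in> {l1, l2, l3}" for z
    using that root_iff[OF fac] root_cnj \<open>0 < \<alpha>\<close> by blast
  have sum: "l1 + l2 + l3 = of_real (- 1 / \<alpha>)"
    using vieta(1)[OF fac] \<open>0 < \<alpha>\<close> by (simp add: field_simps)
  have im: "Im l1 + Im l2 + Im l3 = 0"
    using arg_cong[OF sum, of Im] by simp
  from cnj_root[of l1] have "cnj l1 = l1 \<or> cnj l1 = l2 \<or> cnj l1 = l3"
    by simp
  then have "- Im l1 = Im l1 \<or> - Im l1 = Im l2 \<or> - Im l1 = Im l3"
    by (metis cnj.sel(2))
  then have one: "(Im l1 = 0 \<and> Im l2 \<noteq> 0 \<and> Im l3 \<noteq> 0) \<or> (Im l1 \<noteq> 0 \<and> Im l2 = 0 \<and> Im l3 \<noteq> 0)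
      \<or> (Im l1 \<noteq> 0 \<and> Im l2 \<noteq> 0 \<and> Im l3 = 0)"
    using False im unfolding complex_is_Real_iff by linarith
  then have "length (filter (\<lambda>z. z \<in> \<real>) [l1, l2, l3]) = 1"
    by (auto simp: complex_is_Real_iff)
  then have "l1 \<in> \<real> \<and> l2 = cnj l3 \<and> 0 < Im l2"
    using lab unfolding labelled_roots_def by blast
  then show ?thesis
    by (auto simp: one_real_two_conj_def complex_is_Real_iff)
qed

text \<open>A real root exists by the intermediate value theorem between \<open>- max (1/\<alpha>) (1/\<beta>)\<close> and \<open>0\<close>.\<close>

lemma real_root_exists:
  assumes "0 < \<alpha>" "0 < \<beta>" "0 < m"
  obtains x where "\<alpha> * x ^ 3 + x\<^sup>2 + \<beta> * m * x + m = (0::real)"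
proof -
  define f where "f x = \<alpha> * x ^ 3 + x\<^sup>2 + \<beta> * m * x + m" for x :: real
  have f_eq: "f x = x\<^sup>2 * (\<alpha> * x + 1) + m * (\<beta> * x + 1)" for x
    by (simp add: f_def power2_eq_square power3_eq_cube algebra_simps)
  define y where "y = - max (1 / \<alpha>) (1 / \<beta>)"
  have y: "y \<le> - (1 / \<alpha>)" "y \<le> - (1 / \<beta>)"
    by (auto simp: y_def)
  have "\<alpha> * y \<le> \<alpha> * (- (1 / \<alpha>))" "\<beta> * y \<le> \<beta> * (- (1 / \<beta>))"
    using assms by (intro mult_left_mono y; simp)+
  then have "\<alpha> * y + 1 \<le> 0" "\<beta> * y + 1 \<le> 0"
    using assms by simp_all
  then have "y\<^sup>2 * (\<alpha> * y + 1) \<le> 0" "m * (\<beta> * y + 1) \<le> 0"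
    using assms by (simp_all add: mult_nonneg_nonpos)
  then have "f y \<le> 0"
    unfolding f_eq by linarith
  moreover have "0 \<le> f 0"
    using assms by (simp add: f_def)
  moreover have "y \<le> 0"
    using y(1) assms(1) by (meson divide_nonneg_pos le_minus_iff less_imp_le neg_0_le_iff_le order_trans zero_le_one)
  moreover have "continuous_on {y..0} f"
    unfolding f_def by (intro continuous_intros)
  ultimately obtain x where "f x = 0"
    using IVT'[of f y 0 0] by blast
  then show ?thesis
    using that by (simp add: f_def)
qed

lemma labelled_roots_exist:
  assumes "0 < \<alpha>" "0 < \<beta>" "0 < m"
  shows "\<exists>l1 l2 l3. labelled_roots \<alpha> \<beta> m l1 l2 l3"
proof -
  obtain x where x: "\<alpha> * x ^ 3 + x\<^sup>2 + \<beta> * m * x + m = 0"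
    using real_root_exists[OF assms] by blast
  define q where "q = - (1 + \<alpha> * x) / (2 * \<alpha>)"
  define d where "d = (1 + \<alpha> * x)\<^sup>2 - 4 * \<alpha> * (\<beta> * m + x + \<alpha> * x\<^sup>2)"
  define w where "w = csqrt (of_real d) / of_real (2 * \<alpha>)"
  define y z where "y = of_real q + w" and "z = of_real q - w"
  have w2: "w\<^sup>2 = of_real (d / (4 * \<alpha>\<^sup>2))"
    by (simp add: w_def power_divide power_mult_distrib)
  have yz: "y + z = of_real (- (1 + \<alpha> * x) / \<alpha>)"
    using assms by (simp add: y_def z_def q_def field_simps)
  have "y * z = (of_real q)\<^sup>2 - w\<^sup>2"
    by (simp add: y_def z_def power2_eq_square algebra_simps)
  also have "\<dots> = of_real (q\<^sup>2 - d / (4 * \<alpha>\<^sup>2))"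
    by (simp add: w2)
  also have "q\<^sup>2 - d / (4 * \<alpha>\<^sup>2) = (\<beta> * m + x + \<alpha> * x\<^sup>2) / \<alpha>"
    using assms by (simp add: q_def d_def power_divide power_mult_distrib field_simps power2_eq_square)
  finally have yz': "y * z = of_real ((\<beta> * m + x + \<alpha> * x\<^sup>2) / \<alpha>)" .
  have "smult (of_real \<alpha>) ([:- of_real x, 1:] * [:- y, 1:] * [:- z, 1:])
      = [: - (of_real \<alpha> * (of_real x * (y * z))), of_real \<alpha> * (of_real x * (y + z) + y * z),
          - (of_real \<alpha> * (of_real x + (y + z))), of_real \<alpha>:]"
    by (simp add: algebra_simps)
  also have "\<dots> = [:of_real (- (\<alpha> * (x * ((\<beta> * m + x + \<alpha> * x\<^sup>2) / \<alpha>)))),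
      of_real (\<alpha> * (x * (- (1 + \<alpha> * x) / \<alpha>) + (\<beta> * m + x + \<alpha> * x\<^sup>2) / \<alpha>)),
      of_real (- (\<alpha> * (x + - (1 + \<alpha> * x) / \<alpha>))), of_real \<alpha>:]"
    unfolding yz yz' by simp
  also have "- (\<alpha> * (x * ((\<beta> * m + x + \<alpha> * x\<^sup>2) / \<alpha>))) = - (x * (\<beta> * m + x + \<alpha> * x\<^sup>2))"
    using assms by simp
  also have "\<dots> = m"
    using x by algebra
  also have "\<alpha> * (x * (- (1 + \<alpha> * x) / \<alpha>) + (\<beta> * m + x + \<alpha> * x\<^sup>2) / \<alpha>) = \<beta> * m"
    using assms by (simp add: power2_eq_square field_simps)
  also have "- (\<alpha> * (x + - (1 + \<alpha> * x) / \<alpha>)) = 1"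
    using assms by (simp add: field_simps)
  finally have fac: "char_poly \<alpha> \<beta> m = smult (of_real \<alpha>) ([:- of_real x, 1:] * [:- y, 1:] * [:- z, 1:])"
    by (simp add: char_poly_eq)
  have perm: "[:- of_real x, 1:] * [:- y, 1:] * [:- z, 1:] = [:- y, 1:] * [:- z, 1:] * [:- of_real x, 1:]"
    "[:- of_real x, 1:] * [:- y, 1:] * [:- z, 1:] = [:- z, 1:] * [:- y, 1:] * [:- of_real x, 1:]"
    by (simp_all only: mult_ac)
  show ?thesis
  proof (cases "0 \<le> d")
    case True
    then have "csqrt (of_real d) = of_real (sqrt d)"
      by (simp add: csqrt_of_real_nonneg)
    then have "w = of_real (sqrt d / (2 * \<alpha>))"
      by (simp add: w_def)
    then have re: "y \<in> \<real>" "z \<in> \<real>"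
      by (auto simp: y_def z_def)
    consider "y = of_real x" | "z = of_real x" | "y \<noteq> of_real x" "z \<noteq> of_real x"
      by blast
    then show ?thesis
    proof cases
      case 1
      have "labelled_roots \<alpha> \<beta> m z y (of_real x)"
        unfolding labelled_roots_def using fac perm re 1 by simp
      then show ?thesis
        by blast
    next
      case 2
      have "labelled_roots \<alpha> \<beta> m y z (of_real x)"
        unfolding labelled_roots_def using fac perm re 2 by simp
      then show ?thesis
        by blast
    next
      case 3
      have "labelled_roots \<alpha> \<beta> m (of_real x) y z"
        unfolding labelled_roots_def using fac re 3 by (auto simp: card_insert_if)
      then show ?thesis
        by blast
    qed
  next
    case False
    then have "csqrt (of_real d) = \<i> * of_real (sqrt (- d))"
      by (simp add: csqrt_of_real_nonpos)
    then have "w = \<i> * of_real (sqrt (- d) / (2 * \<alpha>))"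
      by (simp add: w_def)
    moreover have "0 < sqrt (- d) / (2 * \<alpha>)"
      using False assms by simp
    ultimately have im: "Im y > 0" "Im z < 0" "y = cnj z"
      by (simp_all add: y_def z_def complex_eq_iff)
    then have "y \<notin> \<real>" "z \<notin> \<real>" "y \<noteq> z"
      by (metis complex_is_Real_iff less_irrefl less_asym)+
    moreover from this have "of_real x \<noteq> y" "of_real x \<noteq> z"
      using Reals_of_real by blast+
    ultimately have "labelled_roots \<alpha> \<beta> m (of_real x) y z"
      unfolding labelled_roots_def using fac im by simp
    then show ?thesis
      by blast
  qed
qed

subsection \<open>The discriminant\<close>

text \<open>\<open>- m\<close> times this is the discriminant of the cubic; its zeroes are \<open>m\<^sub>1\<close> and \<open>m\<^sub>2\<close>.\<close>

definition disc :: "real \<Rightarrow> real \<Rightarrow> real \<Rightarrow> real" where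
  "disc \<alpha> \<beta> m = 4 * \<alpha> * \<beta> ^ 3 * m\<^sup>2 + \<alpha>\<^sup>2 * C1 \<alpha> \<beta> * m + 4"

lemma disc_eq: "\<alpha> \<noteq> 0 \<Longrightarrow> disc \<alpha> \<beta> m = 4 * \<alpha> * \<beta> ^ 3 * m\<^sup>2 + (27 * \<alpha>\<^sup>2 - 18 * \<alpha> * \<beta> - \<beta>\<^sup>2) * m + 4"
  by (simp add: disc_def C1_def field_simps power2_eq_square)

lemma disc_roots:
  assumes "char_poly \<alpha> \<beta> m = smult (of_real \<alpha>) ([:- l1, 1:] * [:- l2, 1:] * [:- l3, 1:])" "\<alpha> \<noteq> 0"
  shows "(of_real (\<alpha>\<^sup>2) * ((l1 - l2) * (l1 - l3) * (l2 - l3)))\<^sup>2 = of_real (- m * disc \<alpha> \<beta> m)"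
proof -
  define a b c where "a = complex_of_real \<alpha>" and "b = complex_of_real \<beta>" and "c = complex_of_real m"
  have v: "a * (l1 + l2 + l3) = -1" "a * (l1 * l2 + l1 * l3 + l2 * l3) = b * c" "a * (l1 * l2 * l3) = - c"
    using vieta[OF assms(1)] by (simp_all add: a_def b_def c_def)
  define e1 e2 e3 where "e1 = l1 + l2 + l3" and "e2 = l1 * l2 + l1 * l3 + l2 * l3" and "e3 = l1 * l2 * l3"
  have "((l1 - l2) * (l1 - l3) * (l2 - l3))\<^sup>2
      = e1\<^sup>2 * e2\<^sup>2 - 4 * e2 ^ 3 - 4 * e1 ^ 3 * e3 + 18 * e1 * e2 * e3 - 27 * e3\<^sup>2"
    unfolding e1_def e2_def e3_def by algebra
  then have "(a\<^sup>2 * ((l1 - l2) * (l1 - l3) * (l2 - l3)))\<^sup>2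
      = (a * e1)\<^sup>2 * (a * e2)\<^sup>2 - 4 * a * (a * e2) ^ 3 - 4 * (a * e1) ^ 3 * (a * e3)
        + 18 * a * (a * e1) * (a * e2) * (a * e3) - 27 * a\<^sup>2 * (a * e3)\<^sup>2"
    by algebra
  also have "\<dots> = - c * (4 * a * b ^ 3 * c\<^sup>2 + (27 * a\<^sup>2 - 18 * a * b - b\<^sup>2) * c + 4)"
    unfolding v[folded e1_def e2_def e3_def] by algebra
  finally show ?thesis
    by (simp add: a_def b_def c_def disc_eq[OF assms(2)])
qed

lemma disc_cases:
  assumes lab: "labelled_roots \<alpha> \<beta> m l1 l2 l3" and "0 < \<alpha>" "0 < m"
  shows "0 < disc \<alpha> \<beta> m \<Longrightarrow> one_real_two_conj l1 l2 l3 \<and> 0 < Im l2"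
    and "disc \<alpha> \<beta> m < 0 \<Longrightarrow> l1 \<in> \<real> \<and> l2 \<in> \<real> \<and> l3 \<in> \<real>"
    and "disc \<alpha> \<beta> m = 0 \<Longrightarrow> l1 \<in> \<real> \<and> l2 \<in> \<real> \<and> l3 = l2"
proof -
  note D = disc_roots[OF labelled_rootsD[OF lab] less_imp_neq[OF \<open>0 < \<alpha>\<close>, symmetric]]
  have real: "0 \<le> - m * disc \<alpha> \<beta> m" if "l1 \<in> \<real>" "l2 \<in> \<real>" "l3 \<in> \<real>"
  proof -
    obtain x1 x2 x3 where "l1 = of_real x1" "l2 = of_real x2" "l3 = of_real x3"
      using \<open>l1 \<in> \<real>\<close> \<open>l2 \<in> \<real>\<close> \<open>l3 \<in> \<real>\<close> by (auto simp: Reals_def)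
    then have "complex_of_real ((\<alpha>\<^sup>2 * ((x1 - x2) * (x1 - x3) * (x2 - x3)))\<^sup>2) = of_real (- m * disc \<alpha> \<beta> m)"
      using D \<open>0 < \<alpha>\<close> by simp
    then have "(\<alpha>\<^sup>2 * ((x1 - x2) * (x1 - x3) * (x2 - x3)))\<^sup>2 = - m * disc \<alpha> \<beta> m"
      by (simp only: of_real_eq_iff)
    then show ?thesis
      by (metis zero_le_power2)
  qed
  have conj: "- m * disc \<alpha> \<beta> m < 0" if orc: "one_real_two_conj l1 l2 l3"
  proof -
    obtain x where x: "l1 = of_real x"
      using orc by (auto simp: one_real_two_conj_def Reals_def)
    define a b where "a = Re l2" and "b = Im l2"
    have l2: "l2 = Complex a b" and l3: "l3 = Complex a (- b)" and b: "b \<noteq> 0"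
      using orc by (auto simp: one_real_two_conj_def a_def b_def complex_eq_iff complex_is_Real_iff)
    have E: "of_real (\<alpha>\<^sup>2) * ((l1 - l2) * (l1 - l3) * (l2 - l3)) = \<i> * of_real (\<alpha>\<^sup>2 * (((x - a)\<^sup>2 + b\<^sup>2) * (2 * b)))"
      by (simp add: x l2 l3 complex_eq_iff power2_eq_square algebra_simps)
    have "of_real (- m * disc \<alpha> \<beta> m) = (\<i> * of_real (\<alpha>\<^sup>2 * (((x - a)\<^sup>2 + b\<^sup>2) * (2 * b))))\<^sup>2"
      by (rule D[unfolded E, symmetric])
    also have "\<dots> = of_real (- (\<alpha>\<^sup>2 * (((x - a)\<^sup>2 + b\<^sup>2) * (2 * b)))\<^sup>2)"
      by (subst power_mult_distrib) (simp only: power2_i of_real_minus of_real_power mult_minus1)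
    finally have "- m * disc \<alpha> \<beta> m = - (\<alpha>\<^sup>2 * (((x - a)\<^sup>2 + b\<^sup>2) * (2 * b)))\<^sup>2"
      by (simp only: of_real_eq_iff)
    moreover have "\<alpha>\<^sup>2 * (((x - a)\<^sup>2 + b\<^sup>2) * (2 * b)) \<noteq> 0"
      using b \<open>0 < \<alpha>\<close> by (simp add: sum_power2_eq_zero_iff)
    ultimately show ?thesis
      by (simp del: mult_eq_0_iff)
  qed
  note cases = labelled_cases[OF lab \<open>0 < \<alpha>\<close>]
  show "one_real_two_conj l1 l2 l3 \<and> 0 < Im l2" if "0 < disc \<alpha> \<beta> m"
    using cases real mult_pos_pos[OF \<open>0 < m\<close> that] by auto
  show "l1 \<in> \<real> \<and> l2 \<in> \<real> \<and> l3 \<in> \<real>" if "disc \<alpha> \<beta> m < 0"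
    using cases conj mult_pos_neg[OF \<open>0 < m\<close> that] by auto
  show "l1 \<in> \<real> \<and> l2 \<in> \<real> \<and> l3 = l2" if d0: "disc \<alpha> \<beta> m = 0"
  proof -
    have all_real: "l1 \<in> \<real>" "l2 \<in> \<real>"
      using cases conj d0 by auto
    have "(l1 - l2) * (l1 - l3) * (l2 - l3) = 0"
      using D d0 \<open>0 < \<alpha>\<close> by simp
    then have "card {l1, l2, l3} = 2 \<or> l1 = l2 \<and> l2 = l3"
      by (auto simp: card_insert_if)
    then have "l2 = l3"
      using lab unfolding labelled_roots_def by blast
    then show ?thesis
      using all_real by simp
  qed
qed

lemma C2_eq: "C2 \<alpha> \<beta> = (\<beta> / \<alpha> - 1) * (\<beta> / \<alpha> - 9) ^ 3"
  unfolding C2_def C1_def by algebra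

text \<open>Completing the square in \<open>m\<close>: the sign of \<open>C\<^sub>2\<close> decides whether \<open>disc\<close> has real
  zeroes.\<close>

lemma disc_square:
  assumes "0 < \<alpha>" "0 < \<beta>"
  shows "16 * \<alpha> * \<beta> ^ 3 * disc \<alpha> \<beta> m = (8 * \<alpha> * \<beta> ^ 3 * m + \<alpha>\<^sup>2 * C1 \<alpha> \<beta>)\<^sup>2 - \<alpha> ^ 4 * C2 \<alpha> \<beta>"
proof -
  have "\<alpha> ^ 4 * C2 \<alpha> \<beta> = (\<alpha>\<^sup>2 * C1 \<alpha> \<beta>)\<^sup>2 - 64 * \<alpha> * \<beta> ^ 3"
    using assms by (simp add: C2_def power_divide power_mult_distrib field_simps eval_nat_numeral)
  then show ?thesis
    unfolding disc_def by algebra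
qed

lemma disc_pos:
  assumes "0 < \<alpha>" "\<alpha> < \<beta>" "1 / 9 < \<alpha> / \<beta>"
  shows "0 < disc \<alpha> \<beta> m"
proof -
  have "1 < \<beta> / \<alpha>" "\<beta> / \<alpha> < 9"
    using assms by (simp_all add: field_simps)
  then have "C2 \<alpha> \<beta> < 0"
    unfolding C2_eq by (intro mult_pos_neg) (simp_all add: power_less_zero_eq)
  then have "\<alpha> ^ 4 * C2 \<alpha> \<beta> < 0"
    using assms by (intro mult_pos_neg) auto
  moreover have "0 \<le> (8 * \<alpha> * \<beta> ^ 3 * m + \<alpha>\<^sup>2 * C1 \<alpha> \<beta>)\<^sup>2"
    by simp
  ultimately have "0 < (8 * \<alpha> * \<beta> ^ 3 * m + \<alpha>\<^sup>2 * C1 \<alpha> \<beta>)\<^sup>2 - \<alpha> ^ 4 * C2 \<alpha> \<beta>"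
    by linarith
  then have "0 < 16 * \<alpha> * \<beta> ^ 3 * disc \<alpha> \<beta> m"
    using disc_square[of \<alpha> \<beta> m] assms by simp
  then show ?thesis
    by (rule zero_less_mult_pos) (use assms in simp)
qed

lemma m1_m2_real:
  assumes "0 < \<alpha>" "\<alpha> < \<beta>" "\<alpha> / \<beta> \<le> 1 / 9"
  shows "m1 \<alpha> \<beta> = of_real (\<alpha> * (- C1 \<alpha> \<beta> - sqrt (C2 \<alpha> \<beta>)) / (8 * \<beta> ^ 3))"
    and "m2 \<alpha> \<beta> = of_real (\<alpha> * (- C1 \<alpha> \<beta> + sqrt (C2 \<alpha> \<beta>)) / (8 * \<beta> ^ 3))"
    and "disc \<alpha> \<beta> m = 4 * \<alpha> * \<beta> ^ 3 * ((m - Re (m1 \<alpha> \<beta>)) * (m - Re (m2 \<alpha> \<beta>)))"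
    and "0 < Re (m1 \<alpha> \<beta>)" "Re (m1 \<alpha> \<beta>) \<le> Re (m2 \<alpha> \<beta>)"
    and "\<alpha> / \<beta> < 1 / 9 \<Longrightarrow> Re (m1 \<alpha> \<beta>) < Re (m2 \<alpha> \<beta>)"
proof -
  define k where "k = \<beta> / \<alpha>"
  have k: "9 \<le> k"
    using assms by (simp add: k_def field_simps)
  have C2: "0 \<le> C2 \<alpha> \<beta>"
    using k unfolding C2_eq k_def[symmetric] by simp
  have "C1 \<alpha> \<beta> = 27 - (18 * k + k\<^sup>2)"
    by (simp add: C1_def k_def)
  moreover have "0 \<le> k\<^sup>2"
    by simp
  ultimately have C1: "C1 \<alpha> \<beta> < 0"
    using k by linarith
  have lt: "sqrt (C2 \<alpha> \<beta>) < - C1 \<alpha> \<beta>"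
  proof (rule real_less_lsqrt)
    show "C2 \<alpha> \<beta> < (- C1 \<alpha> \<beta>)\<^sup>2"
      using k by (simp add: C2_def k_def[symmetric])
  qed (use C1 in auto)
  have cs: "csqrt (of_real (C2 \<alpha> \<beta>)) = of_real (sqrt (C2 \<alpha> \<beta>))"
    using C2 by (simp add: csqrt_of_real_nonneg)
  show m1: "m1 \<alpha> \<beta> = of_real (\<alpha> * (- C1 \<alpha> \<beta> - sqrt (C2 \<alpha> \<beta>)) / (8 * \<beta> ^ 3))"
    and m2: "m2 \<alpha> \<beta> = of_real (\<alpha> * (- C1 \<alpha> \<beta> + sqrt (C2 \<alpha> \<beta>)) / (8 * \<beta> ^ 3))"
    unfolding m1_def m2_def cs by simp_all
  show "0 < Re (m1 \<alpha> \<beta>)"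
    using lt assms unfolding m1 by simp
  show "Re (m1 \<alpha> \<beta>) \<le> Re (m2 \<alpha> \<beta>)"
    using assms C2 unfolding m1 m2 Re_complex_of_real by (intro divide_right_mono mult_left_mono) auto
  show "Re (m1 \<alpha> \<beta>) < Re (m2 \<alpha> \<beta>)" if "\<alpha> / \<beta> < 1 / 9"
  proof -
    have "9 < k"
      using that assms by (simp add: k_def field_simps)
    then have "0 < sqrt (C2 \<alpha> \<beta>)"
      unfolding C2_eq k_def[symmetric] by simp
    then show ?thesis
      using assms unfolding m1 m2 Re_complex_of_real by (intro divide_strict_right_mono mult_strict_left_mono) auto
  qed
  have "16 * \<alpha> * \<beta> ^ 3 * (4 * \<alpha> * \<beta> ^ 3 * ((m - Re (m1 \<alpha> \<beta>)) * (m - Re (m2 \<alpha> \<beta>))))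
      = (8 * \<alpha> * \<beta> ^ 3 * (m - Re (m1 \<alpha> \<beta>))) * (8 * \<alpha> * \<beta> ^ 3 * (m - Re (m2 \<alpha> \<beta>)))"
    by (simp add: algebra_simps)
  also have "8 * \<alpha> * \<beta> ^ 3 * (m - Re (m1 \<alpha> \<beta>)) = (8 * \<alpha> * \<beta> ^ 3 * m + \<alpha>\<^sup>2 * C1 \<alpha> \<beta>) + \<alpha>\<^sup>2 * sqrt (C2 \<alpha> \<beta>)"
    using assms unfolding m1 by (simp add: field_simps power2_eq_square)
  also have "8 * \<alpha> * \<beta> ^ 3 * (m - Re (m2 \<alpha> \<beta>)) = (8 * \<alpha> * \<beta> ^ 3 * m + \<alpha>\<^sup>2 * C1 \<alpha> \<beta>) - \<alpha>\<^sup>2 * sqrt (C2 \<alpha> \<beta>)"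
    using assms unfolding m2 by (simp add: field_simps power2_eq_square)
  also have "((8 * \<alpha> * \<beta> ^ 3 * m + \<alpha>\<^sup>2 * C1 \<alpha> \<beta>) + \<alpha>\<^sup>2 * sqrt (C2 \<alpha> \<beta>))
      * ((8 * \<alpha> * \<beta> ^ 3 * m + \<alpha>\<^sup>2 * C1 \<alpha> \<beta>) - \<alpha>\<^sup>2 * sqrt (C2 \<alpha> \<beta>))
      = (8 * \<alpha> * \<beta> ^ 3 * m + \<alpha>\<^sup>2 * C1 \<alpha> \<beta>)\<^sup>2 - \<alpha> ^ 4 * (sqrt (C2 \<alpha> \<beta>))\<^sup>2"
    by algebra
  also have "\<dots> = 16 * \<alpha> * \<beta> ^ 3 * disc \<alpha> \<beta> m"
    using assms C2 disc_square[of \<alpha> \<beta> m] by simp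
  finally show "disc \<alpha> \<beta> m = 4 * \<alpha> * \<beta> ^ 3 * ((m - Re (m1 \<alpha> \<beta>)) * (m - Re (m2 \<alpha> \<beta>)))"
    using assms by simp
qed

lemma disc_pos_large:
  assumes "0 < \<alpha>" "\<alpha> < \<beta>"
  obtains B where "\<And>m. B < m \<Longrightarrow> 0 < disc \<alpha> \<beta> m"
proof (cases "1 / 9 < \<alpha> / \<beta>")
  case True
  then show ?thesis
    using that disc_pos[OF assms] by blast
next
  case False
  then have le: "\<alpha> / \<beta> \<le> 1 / 9"
    by simp
  note M = m1_m2_real[OF assms le]
  have "0 < disc \<alpha> \<beta> m" if "Re (m2 \<alpha> \<beta>) < m" for m
    unfolding M(3) using that M(5) assms by (intro mult_pos_pos) auto
  then show ?thesis
    by (rule that)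
qed

lemma disc_pos_outside:
  assumes "0 < \<alpha>" "\<alpha> < \<beta>" "outside_m1_m2 \<alpha> \<beta> m"
  shows "0 < disc \<alpha> \<beta> m"
proof (cases "1 / 9 < \<alpha> / \<beta>")
  case True
  then show ?thesis
    by (rule disc_pos[OF assms(1,2)])
next
  case False
  then have le: "\<alpha> / \<beta> \<le> 1 / 9"
    by simp
  note M = m1_m2_real[OF assms(1,2) le]
  have "m1 \<alpha> \<beta> \<in> \<real>" "m2 \<alpha> \<beta> \<in> \<real>"
    unfolding M(1,2) by (rule Reals_of_real)+
  then consider "m < Re (m1 \<alpha> \<beta>)" | "Re (m2 \<alpha> \<beta>) < m"
    using assms(3) unfolding outside_m1_m2_def by fastforce
  then have "0 < (m - Re (m1 \<alpha> \<beta>)) * (m - Re (m2 \<alpha> \<beta>))"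
  proof cases
    case 1
    then show ?thesis
      using M(5) by (intro mult_neg_neg) auto
  next
    case 2
    then show ?thesis
      using M(5) by (intro mult_pos_pos) auto
  qed
  then show ?thesis
    unfolding M(3) using assms by simp
qed

lemma m1_m2_coincide:
  assumes "0 < \<alpha>" "\<beta> = 9 * \<alpha>"
  shows "m1 \<alpha> \<beta> = of_real (3 / \<beta>\<^sup>2)" "m2 \<alpha> \<beta> = of_real (3 / \<beta>\<^sup>2)"
proof -
  have "C1 \<alpha> \<beta> = - 216" "C2 \<alpha> \<beta> = 0"
    using assms by (simp_all add: C1_def C2_eq)
  moreover have "\<alpha> < \<beta>" "\<alpha> / \<beta> \<le> 1 / 9"
    using assms by simp_all
  moreover have "\<alpha> * 216 / (8 * \<beta> ^ 3) = 3 / \<beta>\<^sup>2"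
    using assms by (simp add: power2_eq_square power3_eq_cube)
  ultimately show "m1 \<alpha> \<beta> = of_real (3 / \<beta>\<^sup>2)" "m2 \<alpha> \<beta> = of_real (3 / \<beta>\<^sup>2)"
    using m1_m2_real(1,2)[OF assms(1), of \<beta>] by simp_all
qed

subsection \<open>Triple roots\<close>

text \<open>Comparing coefficients with \<open>\<alpha> (z - l)\<^sup>3\<close> gives two expressions for \<open>m\<close>.\<close>

lemma triple_root:
  assumes fac: "char_poly \<alpha> \<beta> m = smult (of_real \<alpha>) ([:- l, 1:] * [:- l, 1:] * [:- l, 1:])" and "0 < \<alpha>"
  shows "\<beta> = 9 * \<alpha>"
proof -
  define a b c where "a = complex_of_real \<alpha>" and "b = complex_of_real \<beta>" and "c = complex_of_real m"
  have v: "a * (l + l + l) = -1" "a * (l * l + l * l + l * l) = b * c" "a * (l * l * l) = - c"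
    using vieta[OF fac] by (simp_all add: a_def b_def c_def)
  have a0: "a \<noteq> 0"
    using \<open>0 < \<alpha>\<close> by (simp add: a_def)
  have "27 * a\<^sup>2 * c = 1" "3 * a * b * c = 1"
    using v by algebra+
  then have "c \<noteq> 0" "3 * a * c * (9 * a - b) = 0"
    by (auto simp: power2_eq_square algebra_simps)
  then have "b = 9 * a"
    using a0 by simp
  then have "complex_of_real \<beta> = of_real (9 * \<alpha>)"
    by (simp add: a_def b_def)
  then show ?thesis
    by (simp only: of_real_eq_iff)
qed

text \<open>Eliminating \<open>l1\<close> from the first two of Vieta's formulas leaves \<open>(3 \<alpha> l2 + 1)\<^sup>2 = 0\<close>.\<close>

lemma triple_root_value:
  assumes fac: "char_poly \<alpha> \<beta> m = smult (of_real \<alpha>) ([:- l1, 1:] * [:- l2, 1:] * [:- l2, 1:])" and "0 < \<alpha>"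
    and "\<beta> = 9 * \<alpha>" "m = 3 / \<beta>\<^sup>2"
  shows "l1 = - of_real (3 / \<beta>)" "l2 = - of_real (3 / \<beta>)"
proof -
  define a where "a = complex_of_real \<alpha>"
  have a0: "a \<noteq> 0"
    using \<open>0 < \<alpha>\<close> by (simp add: a_def)
  have "\<alpha> * (\<beta> * m) = 1 / 3"
    using assms(2-4) by (simp add: power2_eq_square)
  then have eq: "a * of_real (\<beta> * m) = 1 / 3"
    unfolding a_def by (metis of_real_1 of_real_divide of_real_mult of_real_numeral)
  have "3 * (a * of_real (\<beta> * m)) = 1"
    unfolding eq by simp
  then have v: "a * (l1 + l2 + l2) = -1" "3 * (a * (a * (l1 * l2 + l1 * l2 + l2 * l2))) = 1"
    using vieta(1,2)[OF fac] by (simp_all only: a_def)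
  then have "(3 * a * l2 + 1)\<^sup>2 = 0"
    by algebra
  then have 3: "3 * a * l2 = -1"
    by (simp add: eq_neg_iff_add_eq_0)
  then have "3 * a * l1 = -1"
    using v(1) by algebra
  moreover have "l = - of_real (3 / \<beta>)" if "3 * a * l = -1" for l
  proof -
    have "l = 3 * a * l / (3 * a)"
      using a0 by simp
    also have "\<dots> = - of_real (3 / \<beta>)"
      unfolding that using assms(2,3) by (simp add: a_def)
    finally show ?thesis .
  qed
  ultimately show "l1 = - of_real (3 / \<beta>)" "l2 = - of_real (3 / \<beta>)"
    using 3 by blast+
qed

subsection \<open>Location and monotonicity of the roots\<close>

text \<open>The equation reads \<open>m (\<beta> x + 1) = - x\<^sup>2 (\<alpha> x + 1)\<close>, so that the two linear factors have opposite
  signs.\<close>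

lemma real_root_bounds:
  assumes "0 < \<alpha>" "\<alpha> < \<beta>" "0 < m" and x: "\<alpha> * x ^ 3 + x\<^sup>2 + \<beta> * m * x + m = (0::real)"
  shows "- (1 / \<alpha>) < x" "x < - (1 / \<beta>)"
proof -
  have eq: "x\<^sup>2 * (\<alpha> * x + 1) + m * (\<beta> * x + 1) = 0"
    using x by (simp add: power2_eq_square power3_eq_cube algebra_simps)
  have x0: "x < 0"
  proof (rule ccontr)
    assume "\<not> x < 0"
    then have "0 \<le> x\<^sup>2 * (\<alpha> * x + 1)" "0 < m * (\<beta> * x + 1)"
      using assms by (auto intro!: mult_nonneg_nonneg mult_pos_pos add_nonneg_nonneg add_nonneg_pos)
    then show False
      using eq by linarith
  qed
  have lt: "\<beta> * x < \<alpha> * x"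
    using x0 assms by simp
  have "0 < \<alpha> * x + 1"
  proof (rule ccontr)
    assume "\<not> 0 < \<alpha> * x + 1"
    then have "x\<^sup>2 * (\<alpha> * x + 1) \<le> 0" "m * (\<beta> * x + 1) < 0"
      using assms lt by (auto intro!: mult_nonneg_nonpos mult_pos_neg)
    then show False
      using eq by linarith
  qed
  then have "0 < x\<^sup>2 * (\<alpha> * x + 1)"
    using x0 by simp
  then have "m * (\<beta> * x + 1) < 0"
    using eq by linarith
  then have "\<beta> * x + 1 < 0"
    using assms by (simp add: mult_less_0_iff)
  then show "x < - (1 / \<beta>)"
    using assms by (simp add: field_simps)
  show "- (1 / \<alpha>) < x"
    using \<open>0 < \<alpha> * x + 1\<close> assms by (simp add: field_simps)
qed

lemma one_real_sum:
  assumes "char_poly \<alpha> \<beta> m = smult (of_real \<alpha>) ([:- l1, 1:] * [:- l2, 1:] * [:- l3, 1:])"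
    and "one_real_two_conj l1 l2 l3" "0 < \<alpha>"
  shows "Re l2 = (- (1 / \<alpha>) - Re l1) / 2"
proof -
  have "\<alpha> * (Re l1 + 2 * Re l2) = -1"
    using arg_cong[OF vieta(1)[OF assms(1)], of Re] assms(2)
    by (auto simp: one_real_two_conj_def algebra_simps)
  then show ?thesis
    using assms(3) by (simp add: field_simps)
qed

lemma nonreal_root_bounds:
  assumes lab: "labelled_roots \<alpha> \<beta> m l1 l2 l3" and "0 < \<alpha>" "\<alpha> < \<beta>" "0 < m"
    and z: "z \<in> {l1, l2, l3}" "z \<notin> \<real>"
  shows "- (1 / 2) * (1 / \<alpha> - 1 / \<beta>) < Re z" "Re z < 0"
proof -
  note fac = labelled_rootsD[OF lab]
  have orc: "one_real_two_conj l1 l2 l3"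
    using z labelled_cases[OF lab \<open>0 < \<alpha>\<close>] by blast
  then have zl2: "Re z = Re l2" and l1: "l1 = of_real (Re l1)"
    using z by (auto simp: one_real_two_conj_def)
  have "poly (char_poly \<alpha> \<beta> m) (of_real (Re l1)) = 0"
    using root_iff[OF fac, of l1] l1 \<open>0 < \<alpha>\<close> by simp
  then have less: "Re l1 < - (1 / \<beta>)"
    using real_root_bounds(2)[OF assms(2-4)] root_real_eq by blast
  have aux: "- (1 / 2) * (p - q) < (- p - x) / 2" if "x < - q" for p q x :: real
    using that by (simp add: field_simps)
  show "- (1 / 2) * (1 / \<alpha> - 1 / \<beta>) < Re z"
    unfolding zl2 one_real_sum[OF fac orc \<open>0 < \<alpha>\<close>] by (rule aux[OF less])
  have root: "poly (char_poly \<alpha> \<beta> m) z = 0"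
    using root_iff[OF fac] z \<open>0 < \<alpha>\<close> by simp
  show "Re z < 0"
  proof (rule ccontr)
    assume "\<not> Re z < 0"
    then have "0 \<le> 8 * \<alpha> * Re z ^ 3 + 8 * (Re z)\<^sup>2 + 2 * Re z * (1 / \<alpha> + \<beta> * m)"
      using assms by (auto intro!: add_nonneg_nonneg mult_nonneg_nonneg)
    moreover have "0 < m * (\<beta> / \<alpha> - 1)"
      using assms by simp
    ultimately show False
      using nonreal_root(1)[OF \<open>0 < \<alpha>\<close> root z(2)] by linarith
  qed
qed

text \<open>At the real root for \<open>m\<close>, the cubic for \<open>m' > m\<close> has the value \<open>(m' - m) (\<beta> x + 1) < 0\<close>; so
  its own real root, being unique, lies to the right.\<close>

lemma real_root_mono:
  assumes lab: "labelled_roots \<alpha> \<beta> m l1 l2 l3" and lab': "labelled_roots \<alpha> \<beta> m' l1' l2' l3'"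
    and orc: "one_real_two_conj l1 l2 l3" and orc': "one_real_two_conj l1' l2' l3'"
    and "0 < \<alpha>" "\<alpha> < \<beta>" "0 < m" "m < m'"
  shows "Re l1 < Re l1'"
proof -
  define x x' where "x = Re l1" and "x' = Re l1'"
  have l1: "l1 = of_real x" "l1' = of_real x'"
    using orc orc' by (auto simp: one_real_two_conj_def x_def x'_def)
  have "poly (char_poly \<alpha> \<beta> m) (of_real x) = 0"
    using root_iff[OF labelled_rootsD[OF lab], of l1] l1 \<open>0 < \<alpha>\<close> by simp
  then have x: "\<alpha> * x ^ 3 + x\<^sup>2 + \<beta> * m * x + m = 0"
    by (rule root_real_eq)
  have "\<beta> * x < -1"
    using real_root_bounds(2)[OF assms(5-7) x] assms(5,6) by (simp add: field_simps)
  then have "(m' - m) * (\<beta> * x + 1) < 0"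
    using \<open>m < m'\<close> by (simp add: mult_pos_neg)
  define a b where "a = Re l2'" and "b = Im l2'"
  have l2: "l2' = Complex a b" "l3' = Complex a (- b)"
    using orc' by (auto simp: one_real_two_conj_def a_def b_def complex_eq_iff)
  have "poly (char_poly \<alpha> \<beta> m') (of_real x) = of_real \<alpha> * ((of_real x - l1') * (of_real x - l2') * (of_real x - l3'))"
    by (rule poly_char_poly_factored[OF labelled_rootsD[OF lab']])
  also have "\<dots> = of_real (\<alpha> * ((x - x') * ((x - a)\<^sup>2 + b\<^sup>2)))"
    by (simp add: l1 l2 complex_eq_iff power2_eq_square algebra_simps)
  finally have "complex_of_real (\<alpha> * x ^ 3 + x\<^sup>2 + \<beta> * m' * x + m') = of_real (\<alpha> * ((x - x') * ((x - a)\<^sup>2 + b\<^sup>2)))"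
    by (simp add: poly_char_poly)
  then have "\<alpha> * x ^ 3 + x\<^sup>2 + \<beta> * m' * x + m' = \<alpha> * ((x - x') * ((x - a)\<^sup>2 + b\<^sup>2))"
    by (simp only: of_real_eq_iff)
  moreover have "\<alpha> * x ^ 3 + x\<^sup>2 + \<beta> * m' * x + m' = (m' - m) * (\<beta> * x + 1)"
    using x by (simp add: algebra_simps)
  ultimately have "\<alpha> * ((x - x') * ((x - a)\<^sup>2 + b\<^sup>2)) < 0"
    using \<open>(m' - m) * (\<beta> * x + 1) < 0\<close> by simp
  then have "x - x' < 0"
    using \<open>0 < \<alpha>\<close> mult_nonneg_nonneg[of \<alpha> "(x - x') * ((x - a)\<^sup>2 + b\<^sup>2)"]
      mult_nonneg_nonneg[of "x - x'" "(x - a)\<^sup>2 + b\<^sup>2"] sum_power2_ge_zero[of "x - a" b]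
    by linarith
  then show ?thesis
    by (simp add: x_def x'_def)
qed

section \<open>The operator as a diagonal family of three-by-three blocks\<close>

instantiation complex :: complex_vector
begin

definition scaleC_complex_def: "c *\<^sub>C (z :: complex) = c * z"

instance
  by standard (simp_all add: scaleC_complex_def algebra_simps)

end

lemma scaleC_triple: "c *\<^sub>C (u, v, w) = (c *\<^sub>C u, c *\<^sub>C v, c *\<^sub>C w)"
  by (simp add: scaleC_prod_def)

text \<open>The phase spaces enter only through the inequalities between their exponents: \<open>t \<le> s\<close> and
  \<open>r \<le> t\<close> say that the first two equations of the resolvent system are solvable in the space, and
  \<open>s \<le> r + 1\<close> that the third one gains enough regularity.\<close>

locale third_order_equation =
  positive_operator D L + orthonormal_basis \<phi>
  for D :: "'a::complex_hilbert set" and L :: "'a \<Rightarrow> 'a" and \<phi> :: "nat \<Rightarrow> 'a" +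
  fixes \<mu> :: "nat \<Rightarrow> real" and \<alpha> \<beta> s t r :: real
  assumes mu_pos: "0 < \<mu> n" and mu_mono: "incseq \<mu>" and mu_top: "filterlim \<mu> at_top sequentially"
    and phi_D: "\<phi> n \<in> D" and L_phi: "L (\<phi> n) = complex_of_real (\<mu> n) *\<^sub>C \<phi> n"
    and alpha: "0 < \<alpha>" and beta: "0 < \<beta>"
    and exponents: "0 \<le> r" "r \<le> t" "t \<le> s" "s \<le> r + 1"
begin

subsection \<open>Coordinates\<close>

text \<open>Self-adjointness upgrades the coordinatewise identity to membership in the domain.\<close>

lemma L_iff: "x \<in> D \<and> L x = z \<longleftrightarrow> (\<forall>n. cinner (\<phi> n) z = of_real (\<mu> n) * cinner (\<phi> n) x)"
proof
  show "\<forall>n. cinner (\<phi> n) z = of_real (\<mu> n) * cinner (\<phi> n) x" if "x \<in> D \<and> L x = z"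
    using that self_adjoint_symmetric[OF sa phi_D, of x] by (auto simp: L_phi cinner_scaleC_left)
next
  assume z: "\<forall>n. cinner (\<phi> n) z = of_real (\<mu> n) * cinner (\<phi> n) x"
  show "x \<in> D \<and> L x = z"
  proof (rule self_adjointD[OF sa])
    fix y assume y: "y \<in> D"
    have "(\<lambda>n. cinner (L y) (cinner (\<phi> n) x *\<^sub>C \<phi> n)) sums cinner (L y) x"
      by (rule bounded_linear.sums[OF cinner.bounded_linear_right expansion])
    moreover have "(\<lambda>n. cinner y (cinner (\<phi> n) z *\<^sub>C \<phi> n)) sums cinner y z"
      by (rule bounded_linear.sums[OF cinner.bounded_linear_right expansion])
    moreover have "cinner (L y) (cinner (\<phi> n) x *\<^sub>C \<phi> n) = cinner y (cinner (\<phi> n) z *\<^sub>C \<phi> n)" for n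
      using z by (simp add: cinner_scaleC_right self_adjoint_symmetric[OF sa y phi_D] L_phi)
    ultimately show "cinner (L y) x = cinner y z"
      using sums_unique2 by simp
  qed
qed

lemma pow_dom_iff: "u \<in> pow_dom \<mu> \<phi> a \<longleftrightarrow> summable (\<lambda>n. (\<mu> n powr a * cmod (cinner (\<phi> n) u))\<^sup>2)"
  using summable_iff[of "\<lambda>n. of_real (\<mu> n powr a) * cinner (\<phi> n) u"]
  by (simp add: pow_dom_def pow_term_def[abs_def] norm_mult)

lemma norm_pow_op_sq:
  assumes "u \<in> pow_dom \<mu> \<phi> a"
  shows "(norm (pow_op \<mu> \<phi> a u))\<^sup>2 = (\<Sum>n. (\<mu> n powr a * cmod (cinner (\<phi> n) u))\<^sup>2)"
  using norm_suminf_sq[of "\<lambda>n. of_real (\<mu> n powr a) * cinner (\<phi> n) u"] assms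
  by (simp add: pow_dom_def pow_op_def pow_term_def[abs_def] norm_mult)

definition coords :: "nat \<Rightarrow> 'a \<times> 'a \<times> 'a \<Rightarrow> complex \<times> complex \<times> complex" where
  "coords n = (\<lambda>(u, v, w). (cinner (\<phi> n) u, cinner (\<phi> n) v, cinner (\<phi> n) w))"

definition embed :: "nat \<Rightarrow> complex \<times> complex \<times> complex \<Rightarrow> 'a \<times> 'a \<times> 'a" where
  "embed n = (\<lambda>(a, b, c). (a *\<^sub>C \<phi> n, b *\<^sub>C \<phi> n, c *\<^sub>C \<phi> n))"

definition weight :: "nat \<Rightarrow> complex \<times> complex \<times> complex \<Rightarrow> real" where
  "weight n = (\<lambda>(a, b, c). (\<mu> n powr s * cmod a)\<^sup>2 + (\<mu> n powr t * cmod b)\<^sup>2 + (\<mu> n powr r * cmod c)\<^sup>2)"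

lemma coords_add: "coords n (x + y) = coords n x + coords n y"
  and coords_diff: "coords n (x - y) = coords n x - coords n y"
  and coords_scaleC: "coords n (c *\<^sub>C x) = c *\<^sub>C coords n x"
  and coords_0: "coords n 0 = 0"
  by (cases x; cases y; simp add: coords_def scaleC_triple scaleC_complex_def cinner_add_right
      cinner.diff_right cinner_scaleC_right cinner.zero_right zero_prod_def)+

lemma coords_embed: "coords m (embed n p) = (if m = n then p else 0)"
  by (cases p) (simp add: coords_def embed_def cinner_scaleC_right orthonormal zero_prod_def)

lemma coords_inject: "(\<And>n. coords n x = coords n y) \<Longrightarrow> x = y"
  by (cases x; cases y) (auto simp: coords_def intro!: coords_eqI)

lemma coords_sum: "coords n (\<Sum>i\<in>I. f i) = (\<Sum>i\<in>I. coords n (f i))"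
  by (induction I rule: infinite_finite_induct) (simp_all add: coords_0 coords_add)

lemma weight_nonneg: "0 \<le> weight n p"
  by (auto simp: weight_def split: prod.split)

lemma weight_eq_0_iff: "weight n p = 0 \<longleftrightarrow> p = 0"
  using mu_pos[of n] by (auto simp: weight_def zero_prod_def add_nonneg_eq_0_iff split: prod.split)

lemma weight_scaleC: "weight n (c *\<^sub>C p) = (cmod c)\<^sup>2 * weight n p"
  by (cases p) (simp add: weight_def scaleC_triple scaleC_complex_def norm_mult power_mult_distrib
      algebra_simps)

abbreviation "X \<equiv> phase_space \<mu> \<phi> (s, t, r)"
abbreviation "N \<equiv> phase_norm \<mu> \<phi> (s, t, r)"
abbreviation "DA \<equiv> A_dom \<alpha> \<beta> D L \<mu> \<phi> (s, t, r)"
abbreviation "A \<equiv> A_op \<alpha> \<beta> L"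

lemma phase_space_iff: "x \<in> X \<longleftrightarrow> summable (\<lambda>n. weight n (coords n x))"
proof -
  obtain u v w where x: "x = (u, v, w)"
    by (cases x)
  define f g h where "f n = (\<mu> n powr s * cmod (cinner (\<phi> n) u))\<^sup>2"
    and "g n = (\<mu> n powr t * cmod (cinner (\<phi> n) v))\<^sup>2"
    and "h n = (\<mu> n powr r * cmod (cinner (\<phi> n) w))\<^sup>2" for n
  have nn: "0 \<le> f n" "0 \<le> g n" "0 \<le> h n" for n
    by (simp_all add: f_def g_def h_def)
  have "x \<in> X \<longleftrightarrow> summable f \<and> summable g \<and> summable h"
    by (simp add: x phase_space_def pow_dom_iff f_def[abs_def] g_def[abs_def] h_def[abs_def])
  also have "\<dots> \<longleftrightarrow> summable (\<lambda>n. f n + g n + h n)"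
  proof
    assume S: "summable (\<lambda>n. f n + g n + h n)"
    show "summable f \<and> summable g \<and> summable h"
      using nn by (intro conjI summable_comparison_test'[OF S, of 0]) (auto simp: add_nonneg_nonneg)
  qed (intro summable_add, auto)
  finally show ?thesis
    by (simp add: x weight_def coords_def f_def g_def h_def)
qed

lemma phase_norm_eq:
  assumes "x \<in> X"
  shows "N x = sqrt (\<Sum>n. weight n (coords n x))"
proof -
  obtain u v w where x: "x = (u, v, w)"
    by (cases x)
  have d: "u \<in> pow_dom \<mu> \<phi> s" "v \<in> pow_dom \<mu> \<phi> t" "w \<in> pow_dom \<mu> \<phi> r"
    using assms by (auto simp: x phase_space_def)
  then show ?thesis
    by (simp add: x phase_norm_def weight_def coords_def norm_pow_op_sq suminf_add pow_dom_iff
        summable_add)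
qed

lemma X_add: "x \<in> X \<Longrightarrow> y \<in> X \<Longrightarrow> x + y \<in> X"
  by (cases x; cases y) (simp add: phase_space_def pow_dom_def pow_term_def[abs_def]
      cinner_add_right distrib_left scaleC_add_left summable_add)

lemma X_scaleC: "x \<in> X \<Longrightarrow> c *\<^sub>C x \<in> X"
  by (auto simp: phase_space_iff coords_scaleC weight_scaleC intro: summable_mult)

lemma X_diff: "x \<in> X \<Longrightarrow> y \<in> X \<Longrightarrow> x - y \<in> X"
  using X_add[of x "(-1) *\<^sub>C y"] X_scaleC[of y "-1"] by simp

lemma X_finite_support:
  assumes "finite J" "\<And>n. n \<notin> J \<Longrightarrow> coords n x = 0"
  shows "x \<in> X"
  unfolding phase_space_iff
  by (rule summable_finite[OF assms(1)]) (use assms(2) weight_eq_0_iff in auto)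

lemma embed_X: "embed n p \<in> X"
  by (rule X_finite_support[of "{n}"]) (auto simp: coords_embed)

text \<open>The eigenvalues \<open>\<mu>\<^sub>n\<close> are bounded away from \<open>0\<close>, so that the spaces \<open>D(L\<^sup>a)\<close> decrease with
  \<open>a\<close>.\<close>

lemma powr_dominated:
  assumes "a \<le> b"
  obtains C where "0 < C" "\<And>n. \<mu> n powr a \<le> C * \<mu> n powr b"
proof (rule that[of "\<mu> 0 powr (a - b)"])
  show "0 < \<mu> 0 powr (a - b)"
    using mu_pos[of 0] by simp
  fix n
  have "\<mu> n powr (a - b) \<le> \<mu> 0 powr (a - b)"
    using assms mu_pos[of 0] incseqD[OF mu_mono, of 0 n] by (intro powr_mono2') auto
  then have "\<mu> n powr (a - b) * \<mu> n powr b \<le> \<mu> 0 powr (a - b) * \<mu> n powr b"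
    by (rule mult_right_mono) simp
  then show "\<mu> n powr a \<le> \<mu> 0 powr (a - b) * \<mu> n powr b"
    by (simp flip: powr_add)
qed

lemma coords_surj:
  assumes S: "summable (\<lambda>n. weight n (f n))"
  obtains x where "\<And>n. coords n x = f n" "x \<in> X"
proof -
  have ex: "\<exists>u. \<forall>n. cinner (\<phi> n) u = h n"
    if h: "\<And>n. (\<mu> n powr a * cmod (h n))\<^sup>2 \<le> weight n (f n)" and a: "0 \<le> a" for h a
  proof -
    obtain C where C: "0 < C" "\<And>n. \<mu> n powr 0 \<le> C * \<mu> n powr a"
      using powr_dominated[OF a] by blast
    have "summable (\<lambda>n. (cmod (h n))\<^sup>2)"
    proof (rule summable_comparison_test'[OF summable_mult[OF S, of "C\<^sup>2"], of 0])
      fix n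
      have "cmod (h n) \<le> (C * \<mu> n powr a) * cmod (h n)"
        using C(2)[of n] mu_pos[of n] mult_right_mono[of 1 "C * \<mu> n powr a" "cmod (h n)"] by simp
      then have "(cmod (h n))\<^sup>2 \<le> (C * \<mu> n powr a * cmod (h n))\<^sup>2"
        by (rule power_mono) simp
      also have "\<dots> = C\<^sup>2 * (\<mu> n powr a * cmod (h n))\<^sup>2"
        by (simp add: power_mult_distrib)
      also have "\<dots> \<le> C\<^sup>2 * weight n (f n)"
        by (intro mult_left_mono h) simp
      finally show "norm ((cmod (h n))\<^sup>2) \<le> C\<^sup>2 * weight n (f n)"
        by simp
    qed
    then have "summable (\<lambda>n. h n *\<^sub>C \<phi> n)"
      by (simp add: summable_iff)
    then show ?thesis
      using cinner_suminf by blast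
  qed
  obtain u where u: "\<And>n. cinner (\<phi> n) u = fst (f n)"
    using ex[of s "\<lambda>n. fst (f n)"] exponents by (auto simp: weight_def split_beta)
  obtain v where v: "\<And>n. cinner (\<phi> n) v = fst (snd (f n))"
    using ex[of t "\<lambda>n. fst (snd (f n))"] exponents by (auto simp: weight_def split_beta)
  obtain w where w: "\<And>n. cinner (\<phi> n) w = snd (snd (f n))"
    using ex[of r "\<lambda>n. snd (snd (f n))"] exponents by (auto simp: weight_def split_beta)
  have "coords n (u, v, w) = f n" for n
    by (simp add: coords_def u v w)
  then show ?thesis
    using that[of "(u, v, w)"] S by (simp add: phase_space_iff)
qed

subsection \<open>The blocks\<close>

definition blk :: "real \<Rightarrow> complex \<times> complex \<times> complex \<Rightarrow> complex \<times> complex \<times> complex" where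
  "blk m = (\<lambda>(a, b, c). (b, c, - (of_real m / of_real \<alpha>) * (a + of_real \<beta> * b) - c / of_real \<alpha>))"

definition chr :: "real \<Rightarrow> complex \<Rightarrow> complex" where
  "chr m l = of_real \<alpha> * l ^ 3 + l\<^sup>2 + of_real (\<beta> * m) * l + of_real m"

text \<open>The domain of \<open>A\<close> is maximal, so that \<open>A\<close> is determined by its action on the coordinates: the
  third equation expresses \<open>\<mu>\<^sub>n\<close> times the coordinates of \<open>u + \<beta> v\<close> by those of an element of \<open>H\<close>,
  which puts \<open>u + \<beta> v\<close> into \<open>D\<close> by \<open>L_iff\<close>.\<close>

lemma A_iff: "x \<in> DA \<and> A x = z \<longleftrightarrow> x \<in> X \<and> z \<in> X \<and> (\<forall>n. coords n z = blk (\<mu> n) (coords n x))"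
proof -
  obtain u v w where x: "x = (u, v, w)"
    by (cases x)
  obtain f g h where z: "z = (f, g, h)"
    by (cases z)
  have a0: "complex_of_real \<alpha> \<noteq> 0"
    using alpha by simp
  show ?thesis
  proof
    assume as: "x \<in> DA \<and> A x = z"
    then have "u + \<beta> *\<^sub>R v \<in> D"
      by (simp add: x A_dom_def)
    then have "cinner (\<phi> n) (L (u + \<beta> *\<^sub>R v)) = of_real (\<mu> n) * (cinner (\<phi> n) u + of_real \<beta> * cinner (\<phi> n) v)" for n
      using L_iff[of "u + \<beta> *\<^sub>R v" "L (u + \<beta> *\<^sub>R v)"]
      by (simp add: cinner_add_right cinner_scaleR_right)
    then show "x \<in> X \<and> z \<in> X \<and> (\<forall>n. coords n z = blk (\<mu> n) (coords n x))"
      using as a0 by (auto simp: x A_dom_def A_op_def coords_def blk_def cinner.diff_right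
          cinner.minus_right cinner_scaleR_right)
  next
    assume as: "x \<in> X \<and> z \<in> X \<and> (\<forall>n. coords n z = blk (\<mu> n) (coords n x))"
    then have fg: "f = v" "g = w"
      by (auto intro!: coords_eqI simp: x z coords_def blk_def)
    have "cinner (\<phi> n) (- (\<alpha> *\<^sub>R h) - w) = of_real (\<mu> n) * cinner (\<phi> n) (u + \<beta> *\<^sub>R v)" for n
    proof -
      have h: "cinner (\<phi> n) h = - (of_real (\<mu> n) / of_real \<alpha>) * (cinner (\<phi> n) u + of_real \<beta> * cinner (\<phi> n) v)
          - cinner (\<phi> n) w / of_real \<alpha>"
        using as by (simp add: x z coords_def blk_def)
      have "cinner (\<phi> n) (- (\<alpha> *\<^sub>R h) - w) = - (of_real \<alpha> * cinner (\<phi> n) h) - cinner (\<phi> n) w"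
        by (simp add: cinner.diff_right cinner.minus_right cinner_scaleR_right)
      also have "\<dots> = of_real (\<mu> n) * (cinner (\<phi> n) u + of_real \<beta> * cinner (\<phi> n) v)"
        unfolding h using a0 by (simp add: field_simps)
      finally show ?thesis
        by (simp add: cinner_add_right cinner_scaleR_right)
    qed
    then have "u + \<beta> *\<^sub>R v \<in> D \<and> L (u + \<beta> *\<^sub>R v) = - (\<alpha> *\<^sub>R h) - w"
      using L_iff by blast
    then show "x \<in> DA \<and> A x = z"
      using as alpha by (simp add: x z fg A_dom_def A_op_def scaleR_diff_right)
  qed
qed

lemma A_D:
  assumes "x \<in> DA"
  shows "x \<in> X" "A x \<in> X" "coords n (A x) = blk (\<mu> n) (coords n x)"
  using assms A_iff[of x "A x"] by auto

lemma A_I: "x \<in> X \<Longrightarrow> z \<in> X \<Longrightarrow> (\<And>n. coords n z = blk (\<mu> n) (coords n x)) \<Longrightarrow> x \<in> DA \<and> A x = z"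
  using A_iff by blast

lemma blk_minus_eq_iff:
  "blk m (a, b, c) - l *\<^sub>C (a, b, c) = (f, g, h) \<longleftrightarrow>
    b = f + l * a \<and> c = g + l * b \<and>
    chr m l * a = - (of_real \<alpha> * h + (1 + of_real \<alpha> * l) * (g + l * f) + of_real (\<beta> * m) * f)"
proof -
  have a0: "complex_of_real \<alpha> \<noteq> 0"
    using alpha by simp
  have "- (of_real m / of_real \<alpha>) * (a + of_real \<beta> * b) - c / of_real \<alpha> - l * c = h \<longleftrightarrow>
      chr m l * a = - (of_real \<alpha> * h + (1 + of_real \<alpha> * l) * (g + l * f) + of_real (\<beta> * m) * f)"
    if "b = f + l * a" "c = g + l * b"
  proof -
    have "- (of_real m / of_real \<alpha>) * (a + of_real \<beta> * b) - c / of_real \<alpha> - l * c = h \<longleftrightarrow>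
        of_real \<alpha> * (- (of_real m / of_real \<alpha>) * (a + of_real \<beta> * b) - c / of_real \<alpha> - l * c) = of_real \<alpha> * h"
      using a0 by simp
    also have "of_real \<alpha> * (- (of_real m / of_real \<alpha>) * (a + of_real \<beta> * b) - c / of_real \<alpha> - l * c)
        = - (of_real m * (a + of_real \<beta> * b)) - c - of_real \<alpha> * l * c"
      using a0 by (simp add: field_simps)
    also have "\<dots> = of_real \<alpha> * h \<longleftrightarrow>
      chr m l * a = - (of_real \<alpha> * h + (1 + of_real \<alpha> * l) * (g + l * f) + of_real (\<beta> * m) * f)"
      unfolding that chr_def of_real_mult by algebra
    finally show ?thesis .
  qed
  moreover have "b - l * a = f \<longleftrightarrow> b = f + l * a" "c - l * b = g \<longleftrightarrow> c = g + l * b"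
    by (auto simp: algebra_simps)
  ultimately show ?thesis
    by (auto simp: blk_def scaleC_triple scaleC_complex_def)
qed

lemma blk_eigenvector_iff: "blk m p = l *\<^sub>C p \<longleftrightarrow> (\<exists>a. p = (a, l * a, l\<^sup>2 * a) \<and> chr m l * a = 0)"
proof -
  obtain a b c where p: "p = (a, b, c)"
    by (cases p)
  have "blk m p = l *\<^sub>C p \<longleftrightarrow> blk m p - l *\<^sub>C p = (0, 0, 0)"
    by (simp flip: zero_prod_def)
  then show ?thesis
    unfolding p blk_minus_eq_iff by (auto simp: power2_eq_square)
qed

lemma blk_0: "blk m 0 = 0"
  by (simp add: blk_def zero_prod_def)

lemma embed_eigenvector:
  assumes "chr (\<mu> n) l = 0"
  shows "embed n (1, l, l\<^sup>2) \<in> DA \<and> A (embed n (1, l, l\<^sup>2)) = l *\<^sub>C embed n (1, l, l\<^sup>2)"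
proof (rule A_I)
  fix k
  have "blk (\<mu> n) (1, l, l\<^sup>2) = l *\<^sub>C (1, l, l\<^sup>2)"
    unfolding blk_eigenvector_iff using assms by auto
  then show "coords k (l *\<^sub>C embed n (1, l, l\<^sup>2)) = blk (\<mu> k) (coords k (embed n (1, l, l\<^sup>2)))"
    by (simp add: coords_scaleC coords_embed blk_0)
qed (simp_all add: embed_X X_scaleC)

lemma A_eigenvalue_iff: "eigenvalue DA A l \<longleftrightarrow> (\<exists>n. chr (\<mu> n) l = 0)"
proof
  assume "eigenvalue DA A l"
  then obtain x where x: "x \<in> DA" "x \<noteq> 0" "A x = l *\<^sub>C x"
    unfolding eigenvalue_def by blast
  obtain n where n: "coords n x \<noteq> 0"
    using coords_inject[of x 0] x(2) by (auto simp: coords_0)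
  have "blk (\<mu> n) (coords n x) = l *\<^sub>C coords n x"
    using A_D(3)[OF x(1)] by (simp add: x(3) coords_scaleC)
  then show "\<exists>n. chr (\<mu> n) l = 0"
    using n by (auto simp: blk_eigenvector_iff zero_prod_def)
next
  assume "\<exists>n. chr (\<mu> n) l = 0"
  then obtain n where n: "chr (\<mu> n) l = 0"
    by blast
  have "embed n (1, l, l\<^sup>2) \<noteq> 0"
    using coords_embed[of n n "(1, l, l\<^sup>2)"] coords_0[of n] by (auto simp: zero_prod_def)
  then show "eigenvalue DA A l"
    using embed_eigenvector[OF n] unfolding eigenvalue_def by blast
qed

subsection \<open>The resolvent\<close>

text \<open>\<open>chr m l\<close> grows like \<open>m\<close>, with factor \<open>1 + \<beta> l\<close>.\<close>

lemma chr_lower_bound: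
  assumes l: "l \<noteq> - of_real (1 / \<beta>)" and nz: "\<And>n. chr (\<mu> n) l \<noteq> 0"
  obtains d where "0 < d" "\<And>n. d * \<mu> n \<le> cmod (chr (\<mu> n) l)"
proof -
  define q where "q n = cmod (chr (\<mu> n) l / of_real (\<mu> n))" for n
  have "1 + of_real \<beta> * l \<noteq> 0"
    using l beta by (auto simp: field_simps add_eq_0_iff minus_equation_iff)
  then have c: "0 < cmod (1 + of_real \<beta> * l)"
    by simp
  have "(\<lambda>n. (of_real \<alpha> * l ^ 3 + l\<^sup>2) * of_real (inverse (\<mu> n)) + (1 + of_real \<beta> * l))
      \<longlonglongrightarrow> (of_real \<alpha> * l ^ 3 + l\<^sup>2) * of_real 0 + (1 + of_real \<beta> * l)"
    by (intro tendsto_intros tendsto_inverse_0_at_top mu_top)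
  moreover have "chr (\<mu> n) l / of_real (\<mu> n)
      = (of_real \<alpha> * l ^ 3 + l\<^sup>2) * of_real (inverse (\<mu> n)) + (1 + of_real \<beta> * l)" for n
    using mu_pos[of n] by (simp add: chr_def field_simps)
  ultimately have "q \<longlonglongrightarrow> cmod (1 + of_real \<beta> * l)"
    unfolding q_def[abs_def] by (intro tendsto_norm) simp
  then have "eventually (\<lambda>n. cmod (1 + of_real \<beta> * l) / 2 < q n) sequentially"
    using c by (intro order_tendstoD(1)) auto
  then obtain M where M: "\<And>n. n \<ge> M \<Longrightarrow> cmod (1 + of_real \<beta> * l) / 2 < q n"
    by (auto simp: eventually_sequentially)
  define d where "d = Min (insert (cmod (1 + of_real \<beta> * l) / 2) (q ` {..<M}))"
  have qpos: "0 < q n" for n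
    using nz[of n] mu_pos[of n] by (simp add: q_def)
  have "0 < d"
    unfolding d_def using c qpos by (subst Min_gr_iff) auto
  moreover have dq: "d \<le> q n" for n
  proof (cases "n < M")
    case True
    then show ?thesis
      unfolding d_def by (intro Min_le) auto
  next
    case False
    have "d \<le> cmod (1 + of_real \<beta> * l) / 2"
      unfolding d_def by (intro Min_le) auto
    then show ?thesis
      using M[of n] False by linarith
  qed
  then have "d * \<mu> n \<le> cmod (chr (\<mu> n) l)" for n
    using mu_pos[of n] dq[of n] by (simp add: q_def norm_divide pos_le_divide_eq)
  ultimately show ?thesis
    using that by blast
qed

text \<open>The resolvent of a block is given by \<open>blk_minus_eq_iff\<close>. Its first component is divided by
  \<open>chr m l\<close>, which gains a power of \<open>m\<close> and so needs \<open>s - 1 \<le> r, t, s\<close>; the others are passed down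
  along \<open>s \<ge> t \<ge> r\<close>.\<close>

lemma blk_resolvent_bound:
  assumes d: "0 < d" "\<And>n. d * \<mu> n \<le> cmod (chr (\<mu> n) l)"
  obtains K where "0 \<le> K" "\<And>n p. weight n p \<le> K * weight n (blk (\<mu> n) p - l *\<^sub>C p)"
proof -
  obtain C1 where C1: "0 < C1" "\<And>n. \<mu> n powr (s - 1) \<le> C1 * \<mu> n powr r"
    by (rule powr_dominated[of "s - 1" r]) (use exponents in auto)
  obtain C2 where C2: "0 < C2" "\<And>n. \<mu> n powr (s - 1) \<le> C2 * \<mu> n powr t"
    by (rule powr_dominated[of "s - 1" t]) (use exponents in auto)
  obtain C3 where C3: "0 < C3" "\<And>n. \<mu> n powr (s - 1) \<le> C3 * \<mu> n powr s"
    by (rule powr_dominated[of "s - 1" s]) auto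
  obtain C4 where C4: "0 < C4" "\<And>n. \<mu> n powr t \<le> C4 * \<mu> n powr s"
    by (rule powr_dominated[of t s]) (use exponents in auto)
  obtain C5 where C5: "0 < C5" "\<And>n. \<mu> n powr r \<le> C5 * \<mu> n powr t"
    by (rule powr_dominated[of r t]) (use exponents in auto)
  define c1 where "c1 = cmod (1 + of_real \<alpha> * l)"
  define K1 where "K1 = (\<alpha> * C1 + c1 * C2 + c1 * cmod l * C3 + \<beta>) / d"
  define K2 where "K2 = C4 * (1 + cmod l * K1)"
  define K3 where "K3 = C5 * (1 + cmod l * K2)"
  define K where "K = 3 * (K1\<^sup>2 + K2\<^sup>2 + K3\<^sup>2)"
  have "weight n p \<le> K * weight n (blk (\<mu> n) p - l *\<^sub>C p)" for n p
  proof -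
    obtain a b c where p: "p = (a, b, c)"
      by (cases p)
    obtain f g h where q: "blk (\<mu> n) p - l *\<^sub>C p = (f, g, h)"
      by (metis surj_pair)
    define m where "m = \<mu> n"
    have m: "0 < m"
      using mu_pos by (simp add: m_def)
    have b: "b = f + l * a" and c: "c = g + l * b"
      and a: "chr m l * a = - (of_real \<alpha> * h + (1 + of_real \<alpha> * l) * (g + l * f) + of_real (\<beta> * m) * f)"
      using q unfolding p blk_minus_eq_iff m_def by auto
    define F G H where "F = m powr s * cmod f" and "G = m powr t * cmod g" and "H = m powr r * cmod h"
    have nn: "0 \<le> F" "0 \<le> G" "0 \<le> H"
      by (auto simp: F_def G_def H_def)
    define M where "M = F + G + H"
    have M: "F \<le> M" "G \<le> M" "H \<le> M"
      using nn by (auto simp: M_def)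
    have "d * m * cmod a \<le> cmod (chr m l) * cmod a"
      by (intro mult_right_mono d(2)[folded m_def]) (simp_all add: m_def d(2))
    also have "\<dots> = cmod (of_real \<alpha> * h + (1 + of_real \<alpha> * l) * (g + l * f) + of_real (\<beta> * m) * f)"
      by (metis a norm_minus_cancel norm_mult)
    also have "\<dots> \<le> \<alpha> * cmod h + c1 * (cmod g + cmod l * cmod f) + \<beta> * m * cmod f"
      unfolding c1_def
      by (intro order_trans[OF norm_triangle_ineq] add_mono)
        (use alpha beta m in \<open>auto simp: norm_mult intro!: mult_left_mono order_trans[OF norm_triangle_ineq]\<close>)
    finally have "m powr (s - 1) * (d * m * cmod a)
        \<le> m powr (s - 1) * (\<alpha> * cmod h + c1 * (cmod g + cmod l * cmod f) + \<beta> * m * cmod f)"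
      by (rule mult_left_mono) simp
    moreover have ms: "m powr (s - 1) * m = m powr s"
      using m powr_add[of m "s - 1" 1] by simp
    ultimately have "d * (m powr s * cmod a) \<le> \<alpha> * (m powr (s - 1) * cmod h) + c1 * (m powr (s - 1) * cmod g)
        + c1 * cmod l * (m powr (s - 1) * cmod f) + \<beta> * F"
      unfolding F_def ms[symmetric] by (simp add: algebra_simps)
    also have "\<dots> \<le> \<alpha> * (C1 * M) + c1 * (C2 * M) + c1 * cmod l * (C3 * M) + \<beta> * M"
    proof (intro add_mono mult_left_mono)
      have "m powr (s - 1) * cmod h \<le> C1 * H"
        using mult_right_mono[OF C1(2)[of n], of "cmod h"] by (simp add: m_def H_def mult_ac)
      then show "m powr (s - 1) * cmod h \<le> C1 * M"
        using M(3) C1(1) by (meson mult_left_mono less_imp_le order_trans)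
      have "m powr (s - 1) * cmod g \<le> C2 * G"
        using mult_right_mono[OF C2(2)[of n], of "cmod g"] by (simp add: m_def G_def mult_ac)
      then show "m powr (s - 1) * cmod g \<le> C2 * M"
        using M(2) C2(1) by (meson mult_left_mono less_imp_le order_trans)
      have "m powr (s - 1) * cmod f \<le> C3 * F"
        using mult_right_mono[OF C3(2)[of n], of "cmod f"] by (simp add: m_def F_def mult_ac)
      then show "m powr (s - 1) * cmod f \<le> C3 * M"
        using M(1) C3(1) by (meson mult_left_mono less_imp_le order_trans)
    qed (use alpha beta M in \<open>auto simp: c1_def\<close>)
    finally have A1: "m powr s * cmod a \<le> K1 * M"
      using d(1) by (simp add: K1_def field_simps)
    have "m powr s * cmod b \<le> F + cmod l * (m powr s * cmod a)"
      using mult_left_mono[OF norm_triangle_ineq[of f "l * a"], of "m powr s"]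
      by (simp add: b F_def norm_mult algebra_simps)
    also have "\<dots> \<le> M + cmod l * (K1 * M)"
      by (intro add_mono mult_left_mono A1 M) simp
    finally have "C4 * (m powr s * cmod b) \<le> C4 * (M + cmod l * (K1 * M))"
      using C4(1) by (intro mult_left_mono) auto
    moreover have "m powr t * cmod b \<le> C4 * (m powr s * cmod b)"
      using mult_right_mono[OF C4(2)[of n], of "cmod b"] by (simp add: m_def mult_ac)
    ultimately have A2: "m powr t * cmod b \<le> K2 * M"
      by (simp add: K2_def algebra_simps)
    have "m powr t * cmod c \<le> G + cmod l * (m powr t * cmod b)"
      using mult_left_mono[OF norm_triangle_ineq[of g "l * b"], of "m powr t"]
      by (simp add: c G_def norm_mult algebra_simps)
    also have "\<dots> \<le> M + cmod l * (K2 * M)"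
      by (intro add_mono mult_left_mono A2 M) simp
    finally have "C5 * (m powr t * cmod c) \<le> C5 * (M + cmod l * (K2 * M))"
      using C5(1) by (intro mult_left_mono) auto
    moreover have "m powr r * cmod c \<le> C5 * (m powr t * cmod c)"
      using mult_right_mono[OF C5(2)[of n], of "cmod c"] by (simp add: m_def mult_ac)
    ultimately have A3: "m powr r * cmod c \<le> K3 * M"
      by (simp add: K3_def algebra_simps)
    have "weight n p \<le> (K1 * M)\<^sup>2 + (K2 * M)\<^sup>2 + (K3 * M)\<^sup>2"
      unfolding p weight_def m_def[symmetric] prod.case
      by (intro add_mono power_mono A1 A2 A3) auto
    also have "\<dots> = (K1\<^sup>2 + K2\<^sup>2 + K3\<^sup>2) * M\<^sup>2"
      by (simp add: power_mult_distrib algebra_simps)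
    also have "\<dots> \<le> (K1\<^sup>2 + K2\<^sup>2 + K3\<^sup>2) * (3 * (F\<^sup>2 + G\<^sup>2 + H\<^sup>2))"
    proof (rule mult_left_mono)
      have "0 \<le> (F - G)\<^sup>2 + (G - H)\<^sup>2 + (F - H)\<^sup>2"
        by simp
      then show "M\<^sup>2 \<le> 3 * (F\<^sup>2 + G\<^sup>2 + H\<^sup>2)"
        unfolding M_def by (simp add: power2_eq_square algebra_simps)
    qed simp
    also have "\<dots> = K * weight n (blk (\<mu> n) p - l *\<^sub>C p)"
      unfolding K_def q weight_def F_def G_def H_def m_def prod.case by (simp only: mult_ac)
    finally show ?thesis .
  qed
  moreover have "0 \<le> K"
    by (simp add: K_def)
  ultimately show ?thesis
    using that by blast
qed

lemma A_resolvent: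
  assumes l: "l \<noteq> - of_real (1 / \<beta>)" and nz: "\<And>n. chr (\<mu> n) l \<noteq> 0"
  shows "l \<in> resolvent_set X N DA A"
proof -
  obtain d where d: "0 < d" "\<And>n. d * \<mu> n \<le> cmod (chr (\<mu> n) l)"
    using chr_lower_bound[OF assms] by blast
  obtain K where K: "0 \<le> K" "\<And>n p. weight n p \<le> K * weight n (blk (\<mu> n) p - l *\<^sub>C p)"
    using blk_resolvent_bound[OF d] by blast
  have XA: "A x - l *\<^sub>C x \<in> X" if "x \<in> DA" for x
    using A_D[OF that] by (simp add: X_diff X_scaleC)
  have cA: "coords n (A x - l *\<^sub>C x) = blk (\<mu> n) (coords n x) - l *\<^sub>C coords n x" if "x \<in> DA" for x n
    using A_D[OF that] by (simp add: coords_diff coords_scaleC)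
  have bound: "N x \<le> sqrt K * N (A x - l *\<^sub>C x)" if x: "x \<in> DA" for x
  proof -
    have S: "summable (\<lambda>n. weight n (coords n x))" "summable (\<lambda>n. weight n (coords n (A x - l *\<^sub>C x)))"
      using XA[OF x] A_D(1)[OF x] by (simp_all add: phase_space_iff)
    have "(\<Sum>n. weight n (coords n x)) \<le> (\<Sum>n. K * weight n (coords n (A x - l *\<^sub>C x)))"
      using K(2) by (intro suminf_le S summable_mult) (simp add: cA[OF x])
    also have "\<dots> = K * (\<Sum>n. weight n (coords n (A x - l *\<^sub>C x)))"
      by (rule suminf_mult[OF S(2)])
    finally show ?thesis
      using XA[OF x] A_D(1)[OF x] by (simp add: phase_norm_eq flip: real_sqrt_mult)
  qed
  have "inj_on (\<lambda>x. A x - l *\<^sub>C x) DA"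
  proof (rule inj_onI)
    fix x y assume x: "x \<in> DA" and y: "y \<in> DA" and eq: "A x - l *\<^sub>C x = A y - l *\<^sub>C y"
    show "x = y"
    proof (rule coords_inject)
      fix n
      obtain a b c where p: "coords n x = (a, b, c)"
        by (metis surj_pair)
      obtain a' b' c' where q: "coords n y = (a', b', c')"
        by (metis surj_pair)
      obtain f g h where e: "coords n (A x - l *\<^sub>C x) = (f, g, h)"
        by (metis surj_pair)
      have "blk (\<mu> n) (a, b, c) - l *\<^sub>C (a, b, c) = (f, g, h)"
        "blk (\<mu> n) (a', b', c') - l *\<^sub>C (a', b', c') = (f, g, h)"
        using cA[OF x, of n] cA[OF y, of n] eq e p q by simp_all
      then have "chr (\<mu> n) l * a = chr (\<mu> n) l * a'" "b = f + l * a" "c = g + l * b"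
        "b' = f + l * a'" "c' = g + l * b'"
        unfolding blk_minus_eq_iff by simp_all
      then show "coords n x = coords n y"
        using nz[of n] by (simp add: p q)
    qed
  qed
  moreover have "\<exists>x\<in>DA. A x - l *\<^sub>C x = y" if y: "y \<in> X" for y
  proof -
    have "\<exists>p. blk (\<mu> n) p - l *\<^sub>C p = coords n y" for n
    proof -
      obtain f g h where e: "coords n y = (f, g, h)"
        by (metis surj_pair)
      define a where "a = - (of_real \<alpha> * h + (1 + of_real \<alpha> * l) * (g + l * f) + of_real (\<beta> * \<mu> n) * f) / chr (\<mu> n) l"
      have "blk (\<mu> n) (a, f + l * a, g + l * (f + l * a)) - l *\<^sub>C (a, f + l * a, g + l * (f + l * a)) = (f, g, h)"
        unfolding blk_minus_eq_iff using nz[of n] by (simp add: a_def)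
      then show ?thesis
        unfolding e by blast
    qed
    then obtain p where p: "\<And>n. blk (\<mu> n) (p n) - l *\<^sub>C p n = coords n y"
      by metis
    have "summable (\<lambda>n. weight n (p n))"
    proof (rule summable_comparison_test'[of "\<lambda>n. K * weight n (coords n y)" 0])
      show "summable (\<lambda>n. K * weight n (coords n y))"
        using y by (intro summable_mult) (simp add: phase_space_iff)
      show "norm (weight n (p n)) \<le> K * weight n (coords n y)" for n
        using K(2)[of n "p n"] by (simp add: p weight_nonneg)
    qed
    then obtain x where x: "\<And>n. coords n x = p n" "x \<in> X"
      using coords_surj by blast
    have "x \<in> DA \<and> A x = y + l *\<^sub>C x"
    proof (rule A_I)
      show "coords n (y + l *\<^sub>C x) = blk (\<mu> n) (coords n x)" for n
        using p[of n] by (simp add: x coords_add coords_scaleC algebra_simps)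
    qed (use x y in \<open>auto intro: X_add X_scaleC\<close>)
    then show ?thesis
      by (intro bexI[of _ x]) auto
  qed
  ultimately have "bij_betw (\<lambda>x. A x - l *\<^sub>C x) DA X"
    using XA unfolding bij_betw_def by blast
  then show ?thesis
    using bound unfolding resolvent_set_def by blast
qed

section \<open>Spectrum and root spaces\<close>

lemma poly_char_poly_chr: "poly (char_poly \<alpha> \<beta> m) l = chr m l"
  by (simp add: poly_char_poly chr_def)

subsection \<open>Isolated eigenvalues\<close>

lemma finite_chr_roots: "finite {l. chr m l = 0}"
proof -
  have "char_poly \<alpha> \<beta> m \<noteq> 0"
    using alpha by (simp add: char_poly_eq)
  then have "finite {l. poly (char_poly \<alpha> \<beta> m) l = 0}"
    by (rule poly_roots_finite)
  then show ?thesis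
    by (simp add: poly_char_poly_chr)
qed

lemma one_plus_beta_neq_0: "(l :: complex) \<noteq> - of_real (1 / \<beta>) \<Longrightarrow> 1 + of_real \<beta> * l \<noteq> 0"
  using beta by (auto simp: field_simps add_eq_0_iff minus_equation_iff)

text \<open>Away from \<open>-1/\<beta>\<close> the characteristic equation can be solved for \<open>m\<close>.\<close>

lemma chr_root_solved:
  assumes "chr m l = 0" "l \<noteq> - of_real (1 / \<beta>)"
  shows "of_real m = - (l\<^sup>2 * (of_real \<alpha> * l + 1)) / (1 + of_real \<beta> * l)"
proof -
  have "of_real m * (1 + of_real \<beta> * l) = - (l\<^sup>2 * (of_real \<alpha> * l + 1))"
    using assms(1) unfolding chr_def of_real_mult by algebra
  then show ?thesis
    by (subst nonzero_eq_divide_eq[OF one_plus_beta_neq_0[OF assms(2)]])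
qed

lemma chr_root_unique:
  assumes "chr m l = 0" "chr m' l = 0" "l \<noteq> - of_real (1 / \<beta>)"
  shows "m = m'"
  using chr_root_solved[OF assms(1,3)] chr_root_solved[OF assms(2,3)] by (metis of_real_eq_iff)

lemma finite_mu_le: "finite {n. \<mu> n \<le> B}"
proof -
  have "eventually (\<lambda>n. B < \<mu> n) sequentially"
    using mu_top by (rule filterlim_at_top_dense[THEN iffD1, rule_format])
  then obtain M where M: "\<And>n. n \<ge> M \<Longrightarrow> B < \<mu> n"
    by (auto simp: eventually_sequentially)
  have "{n. \<mu> n \<le> B} \<subseteq> {..<M}"
  proof
    fix n assume "n \<in> {n. \<mu> n \<le> B}"
    then have "\<not> M \<le> n"
      using M[of n] by auto
    then show "n \<in> {..<M}"
      by simp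
  qed
  then show ?thesis
    using finite_subset by blast
qed

lemma eigenvalue_spectrum:
  assumes "eigenvalue DA A l"
  shows "l \<in> spectrum X N DA A"
proof -
  obtain x where x: "x \<in> DA" "x \<noteq> 0" "A x = l *\<^sub>C x"
    using assms unfolding eigenvalue_def by blast
  have zero: "0 \<in> DA \<and> A 0 = 0"
    by (intro A_I) (auto simp: coords_0 blk_0 intro: X_finite_support[of "{}"])
  have "\<not> inj_on (\<lambda>x. A x - l *\<^sub>C x) DA"
  proof
    assume inj: "inj_on (\<lambda>x. A x - l *\<^sub>C x) DA"
    have "x = 0"
      by (rule inj_onD[OF inj]) (simp_all add: x zero)
    then show False
      using x(2) by contradiction
  qed
  then show ?thesis
    unfolding spectrum_def resolvent_set_def bij_betw_def by blast
qed

lemma spectrum_cases: "l \<in> spectrum X N DA A \<Longrightarrow> l = - of_real (1 / \<beta>) \<or> eigenvalue DA A l"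
  using A_resolvent unfolding spectrum_def A_eigenvalue_iff by blast

text \<open>Near \<open>l \<noteq> -1/\<beta>\<close> the solution \<open>m\<close> stays bounded, which leaves finitely many of the \<open>\<mu>\<^sub>n\<close>.\<close>

lemma spectrum_isolated:
  assumes "eigenvalue DA A l" and l: "l \<noteq> - of_real (1 / \<beta>)"
  shows "l isolated_in spectrum X N DA A"
proof -
  define G where "G z = - (z\<^sup>2 * (of_real \<alpha> * z + 1)) / (1 + of_real \<beta> * z)" for z :: complex
  define B where "B = cmod (G l) + 1"
  have "isCont (\<lambda>z. cmod (G z)) l"
    unfolding G_def using one_plus_beta_neq_0[OF l] by (intro continuous_intros) auto
  then have "((\<lambda>z. cmod (G z)) \<longlongrightarrow> cmod (G l)) (nhds l)"
    unfolding isCont_def tendsto_at_iff_tendsto_nhds[of "\<lambda>z. cmod (G z)" l] .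
  then have "eventually (\<lambda>z. cmod (G z) < B) (nhds l)"
    by (rule order_tendstoD(2)) (simp add: B_def)
  moreover have "eventually (\<lambda>z. z \<noteq> - of_real (1 / \<beta>)) (nhds l)"
    using l by (rule t1_space_nhds)
  ultimately have "eventually (\<lambda>z. cmod (G z) < B \<and> z \<noteq> - of_real (1 / \<beta>)) (nhds l)"
    by eventually_elim simp
  then obtain e where e: "0 < e" "\<And>z. dist z l < e \<Longrightarrow> cmod (G z) < B \<and> z \<noteq> - of_real (1 / \<beta>)"
    unfolding eventually_nhds_metric by blast
  have "spectrum X N DA A \<inter> ball l e \<subseteq> (\<Union>n\<in>{n. \<mu> n \<le> B}. {z. chr (\<mu> n) z = 0})"
  proof
    fix z assume z: "z \<in> spectrum X N DA A \<inter> ball l e"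
    then have z': "cmod (G z) < B" "z \<noteq> - of_real (1 / \<beta>)"
      using e(2)[of z] by (auto simp: dist_commute)
    then obtain n where n: "chr (\<mu> n) z = 0"
      using z spectrum_cases A_eigenvalue_iff by blast
    have "complex_of_real (\<mu> n) = G z"
      unfolding G_def by (rule chr_root_solved[OF n z'(2)])
    then have "\<mu> n \<le> B"
      using z'(1) mu_pos[of n] norm_of_real[of "\<mu> n", where ?'a = complex] by simp
    then show "z \<in> (\<Union>n\<in>{n. \<mu> n \<le> B}. {z. chr (\<mu> n) z = 0})"
      using n by blast
  qed
  then have "finite (spectrum X N DA A \<inter> ball l e)"
    by (rule finite_subset) (intro finite_UN_I finite_mu_le finite_chr_roots)
  then have "\<not> l islimpt spectrum X N DA A"
    using e(1) by (auto simp: islimpt_eq_infinite_ball)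
  then show ?thesis
    using eigenvalue_spectrum[OF assms(1)] by (simp add: isolated_in_islimpt_iff)
qed

subsection \<open>Root spaces\<close>

definition supported :: "nat set \<Rightarrow> ('a \<times> 'a \<times> 'a) set" where
  "supported J = {x. \<forall>n. n \<notin> J \<longrightarrow> coords n x = 0}"

lemma embed_add: "embed n (p + q) = embed n p + embed n q"
  and embed_scaleC: "embed n (c *\<^sub>C p) = c *\<^sub>C embed n p"
  and embed_0: "embed n 0 = 0"
  by (cases p; cases q; simp add: embed_def scaleC_add_left scaleC_triple scaleC_complex_def
      scaleC_scaleC zero_prod_def)+

lemma block_eq_supported: "block (\<phi> n) = supported {n}"
proof
  show "block (\<phi> n) \<subseteq> supported {n}"
    by (auto simp: block_def supported_def coords_def cinner_scaleC_right orthonormal zero_prod_def)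
  show "supported {n} \<subseteq> block (\<phi> n)"
  proof
    fix x assume x: "x \<in> supported {n}"
    obtain a b c where p: "coords n x = (a, b, c)"
      by (metis surj_pair)
    have "x = embed n (a, b, c)"
      by (rule coords_inject) (use x p in \<open>auto simp: coords_embed supported_def\<close>)
    then show "x \<in> block (\<phi> n)"
      by (auto simp: block_def embed_def)
  qed
qed

lemma supported_DA:
  assumes "finite J" "x \<in> supported J"
  shows "x \<in> DA" "A x \<in> supported J"
proof -
  have b0: "n \<notin> J \<Longrightarrow> blk (\<mu> n) (coords n x) = 0" for n
    using assms(2) by (auto simp: supported_def blk_0)
  have "summable (\<lambda>n. weight n (blk (\<mu> n) (coords n x)))"
    by (rule summable_finite[OF assms(1)]) (simp add: b0 weight_eq_0_iff)
  then obtain z where z: "\<And>n. coords n z = blk (\<mu> n) (coords n x)" "z \<in> X"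
    using coords_surj[of "\<lambda>n. blk (\<mu> n) (coords n x)"] by blast
  have "x \<in> X"
    using X_finite_support[OF assms(1)] assms(2) by (auto simp: supported_def)
  then have "x \<in> DA \<and> A x = z"
    using z by (intro A_I) auto
  then show "x \<in> DA" "A x \<in> supported J"
    using z b0 by (auto simp: supported_def)
qed

lemma ker_pow_coords: "x \<in> ker_pow DA A l k \<Longrightarrow> coords n x \<in> ker_pow UNIV (blk (\<mu> n)) l k"
proof (induction k arbitrary: x)
  case (Suc k)
  then have "x \<in> DA" "coords n (A x - l *\<^sub>C x) \<in> ker_pow UNIV (blk (\<mu> n)) l k"
    by auto
  then show ?case
    using A_D(3)[of x n] by (simp add: coords_diff coords_scaleC)
qed (simp add: coords_0)

lemma ker_pow_supported:
  assumes "finite J"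
  shows "x \<in> supported J \<Longrightarrow> (\<And>n. coords n x \<in> ker_pow UNIV (blk (\<mu> n)) l k) \<Longrightarrow>
    x \<in> ker_pow (DA \<inter> supported J) A l k"
proof (induction k arbitrary: x)
  case 0
  then show ?case
    using coords_inject[of x 0] by (simp add: coords_0)
next
  case (Suc k)
  have x: "x \<in> DA" "A x \<in> supported J"
    using supported_DA[OF assms Suc.prems(1)] by blast+
  have "A x - l *\<^sub>C x \<in> ker_pow (DA \<inter> supported J) A l k"
  proof (rule Suc.IH)
    show "A x - l *\<^sub>C x \<in> supported J"
      using x Suc.prems(1) by (simp add: supported_def coords_diff coords_scaleC)
    show "coords n (A x - l *\<^sub>C x) \<in> ker_pow UNIV (blk (\<mu> n)) l k" for n
      using Suc.prems(2)[of n] A_D(3)[OF x(1), of n] by (simp add: coords_diff coords_scaleC)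
  qed
  then show ?case
    using x Suc.prems(1) by simp
qed

lemma ker_pow_mono: "E \<subseteq> F \<Longrightarrow> ker_pow E f l k \<subseteq> ker_pow F f l k"
  by (induction k) auto

lemma zero_in_ker_pow_blk: "0 \<in> ker_pow UNIV (blk m) l k"
  by (induction k) (simp_all add: blk_0)

lemma ker_pow_blk_trivial: "chr m l \<noteq> 0 \<Longrightarrow> ker_pow UNIV (blk m) l k = {0}"
proof (induction k)
  case (Suc k)
  have "blk m p - l *\<^sub>C p = 0 \<longleftrightarrow> p = 0" for p
    unfolding right_minus_eq blk_eigenvector_iff using Suc.prems by (auto simp: zero_prod_def)
  then show ?case
    using Suc by auto
qed simp

definition spread :: "nat set \<Rightarrow> (complex \<times> complex \<times> complex) set \<Rightarrow> ('a \<times> 'a \<times> 'a) set" where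
  "spread J V = {x. \<forall>n. coords n x \<in> (if n \<in> J then V else {0})}"

lemma spreadD: "x \<in> spread J V \<Longrightarrow> coords n x \<in> (if n \<in> J then V else {0})"
  unfolding spread_def by blast

text \<open>The exponent \<open>K\<close> is common to all blocks, so that the nilpotency of the blocks on \<open>V\<close> carries
  over to their sum.\<close>

lemma root_space_supported:
  assumes J: "finite J" "\<And>n. n \<in> J \<Longrightarrow> \<mu> n = m"
    and V: "\<And>k. ker_pow UNIV (blk m) l k \<subseteq> V" "V \<subseteq> ker_pow UNIV (blk m) l K"
  shows "root_space (DA \<inter> supported J) A l = spread J V"
proof
  show "root_space (DA \<inter> supported J) A l \<subseteq> spread J V"
  proof
    fix x assume "x \<in> root_space (DA \<inter> supported J) A l"
    then obtain k where k: "x \<in> ker_pow (DA \<inter> supported J) A l k"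
      unfolding root_space_def by blast
    then have "coords n x \<in> ker_pow UNIV (blk (\<mu> n)) l k" for n
      using ker_pow_coords ker_pow_mono[of "DA \<inter> supported J" DA] by blast
    moreover have "x \<in> supported J"
      using k by (cases k) (auto simp: supported_def coords_0)
    ultimately show "x \<in> spread J V"
      using J(2) V(1) by (auto simp: spread_def supported_def) blast
  qed
  show "spread J V \<subseteq> root_space (DA \<inter> supported J) A l"
  proof
    fix x assume x: "x \<in> spread J V"
    have "x \<in> ker_pow (DA \<inter> supported J) A l K"
    proof (rule ker_pow_supported[OF J(1)])
      have "coords n x = 0" if "n \<notin> J" for n
        using spreadD[OF x, of n] that by simp
      then show "x \<in> supported J"
        by (simp add: supported_def)
      show "coords n x \<in> ker_pow UNIV (blk (\<mu> n)) l K" for n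
        using spreadD[OF x, of n] J(2) V(2) zero_in_ker_pow_blk by (cases "n \<in> J") auto
    qed
    then show "x \<in> root_space (DA \<inter> supported J) A l"
      unfolding root_space_def by blast
  qed
qed

text \<open>The coordinates of an element of the root space lie in the root spaces of the blocks, which are
  trivial wherever \<open>l\<close> is not a root.\<close>

lemma root_space_eq_supported:
  assumes "finite J" "\<And>n. n \<notin> J \<Longrightarrow> chr (\<mu> n) l \<noteq> 0"
  shows "root_space DA A l = root_space (DA \<inter> supported J) A l"
proof -
  have "ker_pow DA A l k = ker_pow (DA \<inter> supported J) A l k" for k
  proof
    show "ker_pow DA A l k \<subseteq> ker_pow (DA \<inter> supported J) A l k"
    proof
      fix x assume "x \<in> ker_pow DA A l k"
      then have c: "coords n x \<in> ker_pow UNIV (blk (\<mu> n)) l k" for n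
        by (rule ker_pow_coords)
      have "coords n x = 0" if "n \<notin> J" for n
        using c[of n] ker_pow_blk_trivial[OF assms(2)[OF that]] by auto
      then have "x \<in> supported J"
        by (simp add: supported_def)
      then show "x \<in> ker_pow (DA \<inter> supported J) A l k"
        using ker_pow_supported[OF assms(1)] c by blast
    qed
  qed (intro ker_pow_mono Int_lower1)
  then show ?thesis
    by (simp add: root_space_def)
qed

lemma subspace_spread:
  assumes "cvec.subspace V"
  shows "cvec.subspace (spread J V)"
  unfolding cvec.subspace_def spread_def
  using assms by (auto simp: coords_0 coords_add coords_scaleC cvec.subspace_def)

lemma spread_span:
  assumes J: "finite J"
  shows "spread J (cvec.span B) = cvec.span ((\<lambda>(n, b). embed n b) ` (J \<times> B))" (is "_ = cvec.span ?E")
proof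
  have emb: "embed n v \<in> cvec.span ?E" if "n \<in> J" "v \<in> cvec.span B" for n v
    using that(2)
  proof (induction rule: cvec.span_induct_alt)
    case base
    then show ?case
      by (simp add: embed_0 cvec.span_zero)
  next
    case (step c x y)
    have "embed n x \<in> cvec.span ?E"
      using step.hyps that(1) by (intro cvec.span_base) auto
    then show ?case
      using step.IH by (simp add: embed_add embed_scaleC cvec.span_add cvec.span_scale)
  qed
  show "spread J (cvec.span B) \<subseteq> cvec.span ?E"
  proof
    fix x assume x: "x \<in> spread J (cvec.span B)"
    have "x = (\<Sum>n\<in>J. embed n (coords n x))"
    proof (rule coords_inject)
      fix m
      have "coords m (\<Sum>n\<in>J. embed n (coords n x)) = (\<Sum>n\<in>J. if m = n then coords n x else 0)"
        by (simp add: coords_sum coords_embed)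
      also have "\<dots> = coords m x"
        using x J by (auto simp: spread_def split: if_splits)
      finally show "coords m x = coords m (\<Sum>n\<in>J. embed n (coords n x))" ..
    qed
    also have "\<dots> \<in> cvec.span ?E"
      using x by (intro cvec.span_sum emb) (auto simp: spread_def split: if_splits)
    finally show "x \<in> cvec.span ?E" .
  qed
  show "cvec.span ?E \<subseteq> spread J (cvec.span B)"
    by (rule cvec.span_minimal[OF _ subspace_spread[OF cvec.subspace_span]])
      (auto simp: spread_def coords_embed cvec.span_zero cvec.span_base)
qed

lemma dim_spread:
  assumes J: "finite J" and B: "finite B" "cvec.independent B"
  shows "cvec.dim (spread J (cvec.span B)) = card J * card B"
proof -
  define E where "E = (\<lambda>(n, b). embed n b) ` (J \<times> B)"
  have b0: "b \<noteq> 0" if "b \<in> B" for b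
    using that B(2) cvec.dependent_zero by blast
  have inj: "inj_on (\<lambda>(n, b). embed n b) (J \<times> B)"
  proof (rule inj_onI, clarify)
    fix n b n' b' assume "b \<in> B" "b' \<in> B" "embed n b = embed n' b'"
    then show "n = n' \<and> b = b'"
      using coords_embed[of n n b] coords_embed[of n n' b'] b0[of b] by (auto split: if_splits)
  qed
  have finE: "finite E"
    using J B by (simp add: E_def)
  have "cvec.independent E"
    unfolding cvec.dependent_finite[OF finE]
  proof clarify
    fix u v assume v: "v \<in> E" "u v \<noteq> 0" and sum0: "(\<Sum>v\<in>E. u v *\<^sub>C v) = 0"
    obtain m b where mb: "m \<in> J" "b \<in> B" "v = embed m b"
      using v(1) by (auto simp: E_def)
    have "0 = coords m (\<Sum>v\<in>E. u v *\<^sub>C v)"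
      by (simp add: sum0 coords_0)
    also have "(\<Sum>v\<in>E. u v *\<^sub>C v) = (\<Sum>(n, b)\<in>J \<times> B. u (embed n b) *\<^sub>C embed n b)"
      unfolding E_def by (subst sum.reindex[OF inj]) (simp add: case_prod_unfold)
    also have "\<dots> = (\<Sum>n\<in>J. \<Sum>b\<in>B. u (embed n b) *\<^sub>C embed n b)"
      by (simp add: sum.cartesian_product)
    also have "coords m \<dots> = (\<Sum>n\<in>J. if m = n then (\<Sum>b\<in>B. u (embed n b) *\<^sub>C b) else 0)"
      by (auto simp: coords_sum coords_scaleC coords_embed intro!: sum.cong)
    also have "\<dots> = (\<Sum>b\<in>B. u (embed m b) *\<^sub>C b)"
      using J mb(1) by simp
    finally have "\<exists>b\<in>B. u (embed m b) \<noteq> 0 \<Longrightarrow> cvec.dependent B"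
      unfolding cvec.dependent_finite[OF B(1)] by (intro exI[of _ "\<lambda>b. u (embed m b)"]) auto
    then show False
      using v(2) mb B(2) by blast
  qed
  then have "cvec.dim (cvec.span E) = card E"
    by (rule cvec.dim_span_eq_card_independent)
  also have "card E = card J * card B"
    unfolding E_def by (simp add: card_image[OF inj] card_cartesian_product)
  finally show ?thesis
    using spread_span[OF J, of B] by (simp add: E_def)
qed

definition unit_triples :: "(complex \<times> complex \<times> complex) set" where
  "unit_triples = {(1, 0, 0), (0, 1, 0), (0, 0, 1)}"

lemma unit_triples_basis:
  "cvec.independent unit_triples" "cvec.span unit_triples = UNIV" "card unit_triples = 3"
proof -
  show "card unit_triples = 3"
    by (simp add: unit_triples_def)
  have fin: "finite unit_triples"
    by (simp add: unit_triples_def)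
  show "cvec.independent unit_triples"
    unfolding cvec.dependent_finite[OF fin]
    by (auto simp: unit_triples_def scaleC_triple scaleC_complex_def zero_prod_def)
  have "(a, b, c) \<in> cvec.span unit_triples" for a b c :: complex
  proof -
    have "(a, b, c) = a *\<^sub>C (1, 0, 0) + (b *\<^sub>C (0, 1, 0) + c *\<^sub>C (0, 0, 1))"
      by (simp add: scaleC_triple scaleC_complex_def)
    also have "\<dots> \<in> cvec.span unit_triples"
      by (intro cvec.span_add cvec.span_scale cvec.span_base) (auto simp: unit_triples_def)
    finally show ?thesis .
  qed
  then show "cvec.span unit_triples = UNIV"
    by auto
qed

lemma chr_roots_finite: "l \<noteq> - of_real (1 / \<beta>) \<Longrightarrow> finite {n. chr (\<mu> n) l = 0}"
proof (cases "\<exists>m. chr (\<mu> m) l = 0")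
  case True
  assume l: "l \<noteq> - of_real (1 / \<beta>)"
  obtain m where m: "chr (\<mu> m) l = 0"
    using True by blast
  have "{n. chr (\<mu> n) l = 0} \<subseteq> {n. \<mu> n \<le> \<mu> m}"
  proof
    fix n assume "n \<in> {n. chr (\<mu> n) l = 0}"
    then have "\<mu> n = \<mu> m"
      by (intro chr_root_unique[OF _ m l]) simp
    then show "n \<in> {n. \<mu> n \<le> \<mu> m}"
      by simp
  qed
  then show ?thesis
    using finite_mu_le finite_subset by blast
qed simp

lemma finite_alg_mult_A:
  assumes "l \<noteq> - of_real (1 / \<beta>)"
  shows "finite_alg_mult DA A l"
proof -
  define J where "J = {n. chr (\<mu> n) l = 0}"
  have J: "finite J"
    unfolding J_def by (rule chr_roots_finite[OF assms])
  have "root_space DA A l = root_space (DA \<inter> supported J) A l"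
    by (rule root_space_eq_supported[OF J]) (simp add: J_def)
  also have "\<dots> \<subseteq> supported J"
  proof
    fix x assume "x \<in> root_space (DA \<inter> supported J) A l"
    then obtain k where "x \<in> ker_pow (DA \<inter> supported J) A l k"
      unfolding root_space_def by blast
    then show "x \<in> supported J"
      by (cases k) (auto simp: supported_def coords_0)
  qed
  also have "supported J = spread J (cvec.span unit_triples)"
    by (auto simp: supported_def spread_def unit_triples_basis(2))
  also have "\<dots> = cvec.span ((\<lambda>(n, b). embed n b) ` (J \<times> unit_triples))"
    by (rule spread_span[OF J])
  finally show ?thesis
    unfolding finite_alg_mult_def using J by (intro exI[of _ "(\<lambda>(n, b). embed n b) ` (J \<times> unit_triples)"])
      (auto simp: unit_triples_def)
qed

lemma discrete_eigenvalue_A: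
  "eigenvalue DA A l \<Longrightarrow> l \<noteq> - of_real (1 / \<beta>) \<Longrightarrow> discrete_eigenvalue X N DA A l"
  unfolding discrete_eigenvalue_def using spectrum_isolated finite_alg_mult_A by blast

text \<open>At \<open>-1/\<beta>\<close> the cubic no longer depends on \<open>m\<close>.\<close>

lemma not_eigenvalue_A: "\<alpha> \<noteq> \<beta> \<Longrightarrow> \<not> eigenvalue DA A (- of_real (1 / \<beta>))"
proof
  assume "\<alpha> \<noteq> \<beta>" "eigenvalue DA A (- of_real (1 / \<beta>))"
  then obtain n where "chr (\<mu> n) (of_real (- (1 / \<beta>))) = 0"
    unfolding A_eigenvalue_iff by auto
  then have "\<alpha> * (- (1 / \<beta>)) ^ 3 + (- (1 / \<beta>))\<^sup>2 + \<beta> * \<mu> n * (- (1 / \<beta>)) + \<mu> n = 0"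
    by (intro root_real_eq) (simp only: poly_char_poly_chr)
  then have "\<beta> ^ 3 * (\<alpha> * (- (1 / \<beta>)) ^ 3 + (- (1 / \<beta>))\<^sup>2 + \<beta> * \<mu> n * (- (1 / \<beta>)) + \<mu> n) = 0"
    by simp
  then have "\<beta> - \<alpha> = 0"
    using beta by (simp add: field_simps power2_eq_square power3_eq_cube)
  then show False
    using \<open>\<alpha> \<noteq> \<beta>\<close> by simp
qed

subsection \<open>Multiplicities\<close>

text \<open>A symmetric operator has no generalised eigenvectors beyond the eigenvectors: here the \<open>k\<close>-th
  coordinate is multiplied by \<open>\<mu>\<^sub>k - \<mu>\<^sub>n\<close> in each step.\<close>

lemma alg_mult_L: "alg_mult D L (of_real (\<mu> n)) = card {k. \<mu> k = \<mu> n}"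
proof -
  define S where "S = {k. \<mu> k = \<mu> n}"
  define R where "R = {x. \<forall>k. k \<notin> S \<longrightarrow> cinner (\<phi> k) x = 0}"
  have finS: "finite S"
    unfolding S_def by (rule finite_subset[OF _ finite_mu_le[of "\<mu> n"]]) auto
  have kp: "x \<in> ker_pow D L (of_real (\<mu> n)) i \<Longrightarrow> x \<in> R" for x i
  proof (induction i arbitrary: x)
    case 0
    then show ?case
      by (simp add: R_def cinner.zero_right)
  next
    case (Suc i)
    then have x: "x \<in> D" and "L x - of_real (\<mu> n) *\<^sub>C x \<in> R"
      by auto
    then have "of_real (\<mu> k) * cinner (\<phi> k) x - of_real (\<mu> n) * cinner (\<phi> k) x = 0" if "k \<notin> S" for k
      using that L_iff[of x "L x"] by (simp add: R_def cinner.diff_right cinner_scaleC_right)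
    then have "of_real (\<mu> k - \<mu> n) * cinner (\<phi> k) x = 0" if "k \<notin> S" for k
      using that by (simp add: left_diff_distrib)
    then show ?case
      by (auto simp: R_def S_def)
  qed
  have "x \<in> ker_pow D L (of_real (\<mu> n)) 1" if "x \<in> R" for x
  proof -
    have "x \<in> D \<and> L x = of_real (\<mu> n) *\<^sub>C x"
      unfolding L_iff using that by (auto simp: R_def S_def cinner_scaleC_right)
    then show ?thesis
      by simp
  qed
  then have root: "root_space D L (of_real (\<mu> n)) = R"
    using kp unfolding root_space_def by blast
  have inj: "inj_on \<phi> S"
    by (rule inj_onI) (metis orthonormal zero_neq_one)
  have fin: "finite (\<phi> ` S)"
    using finS by simp
  have "cvec.independent (\<phi> ` S)"
    unfolding cvec.dependent_finite[OF fin]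
  proof clarify
    fix u k assume k: "k \<in> S" "u (\<phi> k) \<noteq> 0" and sum0: "(\<Sum>v\<in>\<phi> ` S. u v *\<^sub>C v) = 0"
    have "0 = cinner (\<phi> k) (\<Sum>v\<in>\<phi> ` S. u v *\<^sub>C v)"
      by (simp add: sum0 cinner.zero_right)
    also have "\<dots> = (\<Sum>i\<in>S. if k = i then u (\<phi> i) else 0)"
      by (auto simp: sum.reindex[OF inj] cinner.sum_right cinner_scaleC_right orthonormal intro!: sum.cong)
    finally show False
      using k finS by simp
  qed
  then have "cvec.dim (cvec.span (\<phi> ` S)) = card (\<phi> ` S)"
    by (rule cvec.dim_span_eq_card_independent)
  then have "cvec.dim (cvec.span (\<phi> ` S)) = card S"
    using card_image[OF inj] by simp
  moreover have "cvec.span (\<phi> ` S) = R"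
  proof
    have "cvec.subspace R"
      by (auto simp: cvec.subspace_def R_def cinner.zero_right cinner_add_right cinner_scaleC_right)
    then show "cvec.span (\<phi> ` S) \<subseteq> R"
      by (intro cvec.span_minimal) (auto simp: R_def orthonormal)
    show "R \<subseteq> cvec.span (\<phi> ` S)"
    proof
      fix x assume x: "x \<in> R"
      have "x = (\<Sum>i\<in>S. cinner (\<phi> i) x *\<^sub>C \<phi> i)"
      proof (rule coords_eqI)
        fix k
        have "cinner (\<phi> k) (\<Sum>i\<in>S. cinner (\<phi> i) x *\<^sub>C \<phi> i) = (\<Sum>i\<in>S. if k = i then cinner (\<phi> i) x else 0)"
          by (auto simp: cinner.sum_right cinner_scaleC_right orthonormal intro!: sum.cong)
        also have "\<dots> = cinner (\<phi> k) x"
          using x finS by (auto simp: R_def)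
        finally show "cinner (\<phi> k) x = cinner (\<phi> k) (\<Sum>i\<in>S. cinner (\<phi> i) x *\<^sub>C \<phi> i)" ..
      qed
      also have "\<dots> \<in> cvec.span (\<phi> ` S)"
        by (intro cvec.span_sum cvec.span_scale cvec.span_base) auto
      finally show "x \<in> cvec.span (\<phi> ` S)" .
    qed
  qed
  ultimately show ?thesis
    unfolding alg_mult_def root S_def by simp
qed

text \<open>If the root space of the block is \<open>d\<close>-dimensional, then that of \<open>A\<close> is the sum of the
  copies of it, one for each index with the same \<open>\<mu>\<^sub>n\<close>.\<close>

lemma alg_mult_A:
  assumes V: "\<And>k. ker_pow UNIV (blk (\<mu> n)) l k \<subseteq> cvec.span B" "cvec.span B \<subseteq> ker_pow UNIV (blk (\<mu> n)) l K"
    and B: "finite B" "cvec.independent B" and root: "chr (\<mu> n) l = 0" and l: "l \<noteq> - of_real (1 / \<beta>)"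
  shows "alg_mult (DA \<inter> block (\<phi> n)) A l = card B"
    and "alg_mult DA A l = card B * alg_mult D L (of_real (\<mu> n))"
proof -
  show "alg_mult (DA \<inter> block (\<phi> n)) A l = card B"
    unfolding alg_mult_def block_eq_supported
    using root_space_supported[OF _ _ V, of "{n}"] dim_spread[OF _ B, of "{n}"] by simp
  define S where "S = {k. \<mu> k = \<mu> n}"
  have finS: "finite S"
    unfolding S_def by (rule finite_subset[OF _ finite_mu_le[of "\<mu> n"]]) auto
  have "root_space DA A l = root_space (DA \<inter> supported S) A l"
    by (rule root_space_eq_supported[OF finS]) (use chr_root_unique[OF _ root l] in \<open>auto simp: S_def\<close>)
  also have "\<dots> = spread S (cvec.span B)"
    by (rule root_space_supported[OF finS _ V]) (simp add: S_def)
  finally show "alg_mult DA A l = card B * alg_mult D L (of_real (\<mu> n))"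
    unfolding alg_mult_L using dim_spread[OF finS B] by (simp add: alg_mult_def S_def mult.commute)
qed

text \<open>For a root \<open>l\<close> that is at least double, \<open>left_functional l (a, b, c) = c - 2 l b + l\<^sup>2 a\<close> is a left eigenvector
  of the block, to the remaining root \<open>l'\<close>; its kernel is spanned by the Jordan chain
  \<open>(1, l, l\<^sup>2)\<close>, \<open>(0, 1, 2 l)\<close>.\<close>

definition left_functional :: "complex \<Rightarrow> complex \<times> complex \<times> complex \<Rightarrow> complex" where
  "left_functional l = (\<lambda>(a, b, c). c - 2 * l * b + l\<^sup>2 * a)"

lemma blk_factored:
  assumes "char_poly \<alpha> \<beta> m = smult (of_real \<alpha>) ([:- l', 1:] * [:- l, 1:] * [:- l, 1:])"
  shows "blk m (a, b, c) - l *\<^sub>C (a, b, c)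
    = (b - l * a, c - l * b, l\<^sup>2 * l' * a - (l\<^sup>2 + 2 * l * l') * b + (l' + l) * c)"
proof -
  have a0: "complex_of_real \<alpha> \<noteq> 0"
    using alpha by simp
  have "1 / of_real \<alpha> = - (of_real \<alpha> * (l' + l + l)) / of_real \<alpha>"
    using vieta(1)[OF assms] by simp
  then have v1: "1 / of_real \<alpha> = - (l' + l + l)"
    using a0 by simp
  have v2: "of_real \<beta> * of_real m / of_real \<alpha> = l' * l + l' * l + l * l"
    using vieta(2)[OF assms] a0 by (simp add: field_simps)
  have v3: "of_real m / of_real \<alpha> = - (l' * l * l)"
    using vieta(3)[OF assms] a0 by (simp add: field_simps)
  have "- (of_real m / of_real \<alpha>) * (a + of_real \<beta> * b) - c / of_real \<alpha> - l * c
      = - (of_real m / of_real \<alpha>) * a - (of_real \<beta> * of_real m / of_real \<alpha>) * b - (1 / of_real \<alpha>) * c - l * c"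
    by (simp add: algebra_simps)
  also have "\<dots> = l\<^sup>2 * l' * a - (l\<^sup>2 + 2 * l * l') * b + (l' + l) * c"
    unfolding v1 v2 v3 by algebra
  finally show ?thesis
    by (simp add: blk_def scaleC_triple scaleC_complex_def)
qed

lemma left_functional_blk:
  assumes "char_poly \<alpha> \<beta> m = smult (of_real \<alpha>) ([:- l', 1:] * [:- l, 1:] * [:- l, 1:])"
  shows "left_functional l (blk m p - l *\<^sub>C p) = (l' - l) * left_functional l p"
proof -
  obtain a b c where p: "p = (a, b, c)"
    by (cases p)
  show ?thesis
    unfolding p blk_factored[OF assms] left_functional_def prod.case by algebra
qed

lemma left_functional_kernel:
  assumes "char_poly \<alpha> \<beta> m = smult (of_real \<alpha>) ([:- l', 1:] * [:- l, 1:] * [:- l, 1:])"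
  shows "left_functional l p = 0 \<Longrightarrow> p \<in> ker_pow UNIV (blk m) l 2"
proof -
  obtain a b c where p: "p = (a, b, c)"
    by (cases p)
  assume "left_functional l p = 0"
  then have c: "c = 2 * l * b - l\<^sup>2 * a"
    unfolding p left_functional_def prod.case by algebra
  have "blk m p - l *\<^sub>C p = (b - l * a, l * (b - l * a), l\<^sup>2 * (b - l * a))"
    unfolding p blk_factored[OF assms] c prod.inject
    by (intro conjI refl) algebra+
  moreover have "blk m (d, l * d, l\<^sup>2 * d) - l *\<^sub>C (d, l * d, l\<^sup>2 * d) = 0" for d
    unfolding blk_factored[OF assms] zero_prod_def prod.inject
    by (intro conjI) algebra+
  ultimately show ?thesis
    by (simp add: numeral_2_eq_2)
qed

definition chain :: "complex \<Rightarrow> (complex \<times> complex \<times> complex) set" where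
  "chain l = {(1, l, l\<^sup>2), (0, 1, 2 * l)}"

lemma chain_basis:
  "finite (chain l)" "cvec.independent (chain l)" "cvec.span (chain l) = {p. left_functional l p = 0}" "card (chain l) = 2"
proof -
  show fin: "finite (chain l)" and "card (chain l) = 2"
    by (simp_all add: chain_def)
  show "cvec.independent (chain l)"
    unfolding cvec.dependent_finite[OF fin]
    by (auto simp: chain_def scaleC_triple scaleC_complex_def zero_prod_def)
  show "cvec.span (chain l) = {p. left_functional l p = 0}"
  proof
    have "cvec.subspace {p. left_functional l p = 0}"
      by (auto simp: cvec.subspace_def left_functional_def zero_prod_def scaleC_triple scaleC_complex_def)
        (algebra+)
    then show "cvec.span (chain l) \<subseteq> {p. left_functional l p = 0}"
      by (intro cvec.span_minimal) (auto simp: chain_def left_functional_def power2_eq_square)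
    show "{p. left_functional l p = 0} \<subseteq> cvec.span (chain l)"
    proof
      fix p assume p: "p \<in> {p. left_functional l p = 0}"
      obtain a b c where abc: "p = (a, b, c)"
        by (cases p)
      have "c = 2 * l * b - l\<^sup>2 * a"
        using p unfolding abc left_functional_def mem_Collect_eq prod.case by algebra
      then have "p = a *\<^sub>C (1, l, l\<^sup>2) + (b - l * a) *\<^sub>C (0, 1, 2 * l)"
        by (simp add: abc scaleC_triple scaleC_complex_def power2_eq_square algebra_simps)
      also have "\<dots> \<in> cvec.span (chain l)"
        by (intro cvec.span_add cvec.span_scale cvec.span_base) (auto simp: chain_def)
      finally show "p \<in> cvec.span (chain l)" .
    qed
  qed
qed

lemma alg_mult_double:
  assumes fac: "char_poly \<alpha> \<beta> (\<mu> n) = smult (of_real \<alpha>) ([:- l', 1:] * [:- l, 1:] * [:- l, 1:])"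
    and "l' \<noteq> l" and l: "l \<noteq> - of_real (1 / \<beta>)"
  shows "alg_mult (DA \<inter> block (\<phi> n)) A l = 2"
    and "alg_mult DA A l = 2 * alg_mult D L (of_real (\<mu> n))"
proof -
  have 1: "ker_pow UNIV (blk (\<mu> n)) l k \<subseteq> cvec.span (chain l)" for k
  proof (induction k)
    case 0
    then show ?case
      by (simp add: cvec.span_zero)
  next
    case (Suc k)
    then show ?case
      using left_functional_blk[OF fac] \<open>l' \<noteq> l\<close> unfolding chain_basis(3) by fastforce
  qed
  have 2: "cvec.span (chain l) \<subseteq> ker_pow UNIV (blk (\<mu> n)) l 2"
    using left_functional_kernel[OF fac] unfolding chain_basis(3) by blast
  have "chr (\<mu> n) l = 0"
    using root_iff[OF fac, of l] alpha by (simp add: poly_char_poly_chr)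
  then show "alg_mult (DA \<inter> block (\<phi> n)) A l = 2"
    and "alg_mult DA A l = 2 * alg_mult D L (of_real (\<mu> n))"
    using alg_mult_A[OF 1 2 chain_basis(1,2) _ l] by (simp_all add: chain_basis)
qed

lemma alg_mult_triple:
  assumes fac: "char_poly \<alpha> \<beta> (\<mu> n) = smult (of_real \<alpha>) ([:- l, 1:] * [:- l, 1:] * [:- l, 1:])"
    and l: "l \<noteq> - of_real (1 / \<beta>)"
  shows "alg_mult (DA \<inter> block (\<phi> n)) A l = 3"
    and "alg_mult DA A l = 3 * alg_mult D L (of_real (\<mu> n))"
proof -
  have "p \<in> ker_pow UNIV (blk (\<mu> n)) l (Suc 2)" for p
    unfolding ker_pow.simps(2) using left_functional_kernel[OF fac] left_functional_blk[OF fac, of p] by simp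
  then have 2: "cvec.span unit_triples \<subseteq> ker_pow UNIV (blk (\<mu> n)) l (Suc 2)"
    by blast
  have 1: "ker_pow UNIV (blk (\<mu> n)) l k \<subseteq> cvec.span unit_triples" for k
    by (simp add: unit_triples_basis)
  have fin: "finite unit_triples"
    by (simp add: unit_triples_def)
  have "chr (\<mu> n) l = 0"
    using root_iff[OF fac, of l] alpha by (simp add: poly_char_poly_chr)
  then show "alg_mult (DA \<inter> block (\<phi> n)) A l = 3"
    and "alg_mult DA A l = 3 * alg_mult D L (of_real (\<mu> n))"
    using alg_mult_A[OF 1 2 fin unit_triples_basis(1) _ l] by (simp_all add: unit_triples_basis)
qed

subsection \<open>The essential spectrum\<close>

text \<open>For \<open>\<alpha> = \<beta>\<close> the number \<open>-1/\<beta>\<close> is a root for every \<open>n\<close>, but the cubic has the factor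
  \<open>l\<^sup>2 + \<mu>\<^sub>n\<close> then.\<close>

lemma chr_root_exists: "\<exists>l. chr (\<mu> n) l = 0 \<and> l \<noteq> - of_real (1 / \<beta>)"
proof (cases "\<alpha> = \<beta>")
  case True
  define l where "l = \<i> * of_real (sqrt (\<mu> n))"
  have l2: "l\<^sup>2 = - of_real (\<mu> n)"
    using mu_pos[of n] by (simp add: l_def power_mult_distrib flip: of_real_power)
  have "chr (\<mu> n) l = (of_real \<alpha> * l + 1) * (l\<^sup>2 + of_real (\<mu> n))"
    unfolding chr_def of_real_mult unfolding True by algebra
  then have "chr (\<mu> n) l = 0"
    by (simp add: l2)
  moreover have "Im l \<noteq> Im (- of_real (1 / \<beta>))"
    using mu_pos[of n] by (simp add: l_def)
  ultimately show ?thesis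
    by metis
next
  case False
  obtain x where x: "\<alpha> * x ^ 3 + x\<^sup>2 + \<beta> * \<mu> n * x + \<mu> n = 0"
    using real_root_exists[OF alpha beta mu_pos] by blast
  have "chr (\<mu> n) (of_real x) = of_real (\<alpha> * x ^ 3 + x\<^sup>2 + \<beta> * \<mu> n * x + \<mu> n)"
    by (simp add: chr_def)
  then have "chr (\<mu> n) (of_real x) = 0"
    by (simp only: x of_real_0)
  then show ?thesis
    using not_eigenvalue_A[OF False] A_eigenvalue_iff by metis
qed

text \<open>Each \<open>l\<close> other than \<open>-1/\<beta>\<close> is a root for finitely many \<open>n\<close> only.\<close>

lemma infinite_discrete_eigenvalues: "infinite {l. discrete_eigenvalue X N DA A l}"
proof
  assume fin: "finite {l. discrete_eigenvalue X N DA A l}"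
  have "UNIV \<subseteq> (\<Union>l\<in>{l. discrete_eigenvalue X N DA A l} - {- of_real (1 / \<beta>)}. {n. chr (\<mu> n) l = 0})"
  proof
    fix n
    obtain l where "chr (\<mu> n) l = 0" "l \<noteq> - of_real (1 / \<beta>)"
      using chr_root_exists by blast
    then show "n \<in> (\<Union>l\<in>{l. discrete_eigenvalue X N DA A l} - {- of_real (1 / \<beta>)}. {n. chr (\<mu> n) l = 0})"
      using discrete_eigenvalue_A A_eigenvalue_iff by blast
  qed
  moreover have "finite (\<Union>l\<in>{l. discrete_eigenvalue X N DA A l} - {- of_real (1 / \<beta>)}. {n. chr (\<mu> n) l = 0})"
    using fin by (intro finite_UN_I) (auto intro: chr_roots_finite)
  ultimately have "finite (UNIV :: nat set)"
    by (rule finite_subset)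
  then show False
    by simp
qed

lemma phase_norm_scaleC:
  assumes "x \<in> X"
  shows "N (c *\<^sub>C x) = cmod c * N x"
proof -
  have "summable (\<lambda>n. weight n (coords n x))"
    using assms by (simp add: phase_space_iff)
  then show ?thesis
    by (simp add: phase_norm_eq[OF assms] phase_norm_eq[OF X_scaleC[OF assms]] coords_scaleC
        weight_scaleC suminf_mult real_sqrt_mult)
qed

lemma phase_norm_embed_pos:
  assumes "p \<noteq> 0"
  shows "0 < N (embed n p)"
proof -
  have "(\<Sum>k. weight k (coords k (embed n p))) = (\<Sum>k\<in>{n}. weight k (coords k (embed n p)))"
    by (rule suminf_finite) (simp_all add: coords_embed weight_eq_0_iff)
  moreover have "0 < weight n p"
    using assms weight_eq_0_iff[of n p] weight_nonneg[of n p] by linarith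
  ultimately show ?thesis
    by (simp add: phase_norm_eq[OF embed_X] coords_embed)
qed

text \<open>If \<open>f n\<close> are eigenvalues converging to \<open>-1/\<beta>\<close>, then \<open>A + 1/\<beta>\<close> is not bounded below, as its
  values on the eigenvectors show.\<close>

lemma essential_spectrum_A:
  assumes "\<alpha> \<noteq> \<beta>" and f: "\<And>n. chr (\<mu> n) (f n) = 0" and lim: "f \<longlonglongrightarrow> - of_real (1 / \<beta>)"
  shows "essential_spectrum X N DA A = {- of_real (1 / \<beta>)}"
proof -
  define l where "l = - complex_of_real (1 / \<beta>)"
  have "l \<notin> resolvent_set X N DA A"
  proof
    assume "l \<in> resolvent_set X N DA A"
    then obtain K where K: "\<And>x. x \<in> DA \<Longrightarrow> N x \<le> K * N (A x - l *\<^sub>C x)"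
      unfolding resolvent_set_def by blast
    have ge: "1 \<le> K * cmod (f n - l)" for n
    proof -
      define x where "x = embed n (1, f n, (f n)\<^sup>2)"
      have x: "x \<in> DA" "A x = f n *\<^sub>C x"
        using embed_eigenvector[OF f] by (auto simp: x_def)
      have pos: "0 < N x"
        unfolding x_def by (rule phase_norm_embed_pos) (simp add: zero_prod_def)
      have "N x \<le> K * N ((f n - l) *\<^sub>C x)"
        using K[OF x(1)] by (simp add: x(2) cvec.scale_left_diff_distrib)
      also have "\<dots> = K * cmod (f n - l) * N x"
        by (simp add: phase_norm_scaleC[OF A_D(1)[OF x(1)]])
      finally show ?thesis
        using pos by simp
    qed
    have "(\<lambda>n. K * cmod (f n - l)) \<longlonglongrightarrow> K * cmod (l - l)"
      using lim unfolding l_def by (intro tendsto_intros)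
    then have "1 \<le> K * cmod (l - l)"
      by (rule LIMSEQ_le_const) (use ge in blast)
    then show False
      by simp
  qed
  then have "l \<in> spectrum X N DA A"
    by (simp add: spectrum_def)
  moreover have "\<not> discrete_eigenvalue X N DA A l"
    using not_eigenvalue_A[OF assms(1)] by (simp add: l_def discrete_eigenvalue_def)
  moreover have "z = l" if "z \<in> essential_spectrum X N DA A" for z
    using that spectrum_cases[of z] discrete_eigenvalue_A[of z]
    unfolding essential_spectrum_def l_def by blast
  ultimately show ?thesis
    unfolding l_def[symmetric] essential_spectrum_def by blast
qed

end

section \<open>The sequences of eigenvalues\<close>

locale labelled_eigenvalues = third_order_equation +
  fixes l1 l2 l3 :: "nat \<Rightarrow> complex"
  assumes labelled: "labelled_roots \<alpha> \<beta> (\<mu> n) (l1 n) (l2 n) (l3 n)"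
begin

lemma fac: "char_poly \<alpha> \<beta> (\<mu> n) = smult (of_real \<alpha>) ([:- l1 n, 1:] * [:- l2 n, 1:] * [:- l3 n, 1:])"
  by (rule labelled_rootsD[OF labelled])

lemma chr_root_iff: "chr (\<mu> n) z = 0 \<longleftrightarrow> z \<in> {l1 n, l2 n, l3 n}"
  using root_iff[OF fac, of n z] alpha by (simp add: poly_char_poly_chr)

lemma eigenvalues_A: "{l. eigenvalue DA A l} = (\<Union>n. {l1 n, l2 n, l3 n})"
  unfolding A_eigenvalue_iff chr_root_iff by blast

lemma nonreal_eigenvalue:
  assumes "z \<in> {l1 n, l2 n, l3 n}" "z \<notin> \<real>"
  shows "8 * \<alpha> * Re z ^ 3 + 8 * (Re z)\<^sup>2 + 2 * Re z * (1 / \<alpha> + \<beta> * \<mu> n) + \<mu> n * (\<beta> / \<alpha> - 1) = 0 \<and>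
    (Im z)\<^sup>2 = 1 / \<alpha> * (3 * \<alpha> * (Re z)\<^sup>2 + 2 * Re z + \<beta> * \<mu> n)"
  using assms(1) chr_root_iff[of n z] nonreal_root[OF alpha _ assms(2), of \<beta> "\<mu> n"]
  by (simp add: poly_char_poly_chr)

context
  assumes dissipative: "\<alpha> < \<beta>"
begin

lemma not_minus_one_over_beta: "chr (\<mu> n) l = 0 \<Longrightarrow> l \<noteq> - of_real (1 / \<beta>)"
  using not_eigenvalue_A A_eigenvalue_iff dissipative by blast

lemma finite_exceptional: "finite {n. \<not> (one_real_two_conj (l1 n) (l2 n) (l3 n) \<and> 0 < Im (l2 n))}"
proof -
  obtain B where B: "\<And>m. B < m \<Longrightarrow> 0 < disc \<alpha> \<beta> m"
    using disc_pos_large[OF alpha dissipative] by blast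
  have "{n. \<not> (one_real_two_conj (l1 n) (l2 n) (l3 n) \<and> 0 < Im (l2 n))} \<subseteq> {n. \<mu> n \<le> B}"
    using disc_cases(1)[OF labelled alpha mu_pos] B not_le by blast
  then show ?thesis
    using finite_mu_le finite_subset by blast
qed

lemma eventually_one_real: "eventually (\<lambda>n. one_real_two_conj (l1 n) (l2 n) (l3 n) \<and> 0 < Im (l2 n)) sequentially"
  using finite_exceptional by (simp add: cofinite_eq_sequentially[symmetric] eventually_cofinite)

lemma one_real_outside: "outside_m1_m2 \<alpha> \<beta> (\<mu> n) \<Longrightarrow> one_real_two_conj (l1 n) (l2 n) (l3 n)"
  using disc_pos_outside[OF alpha dissipative] disc_cases(1)[OF labelled alpha mu_pos] by blast

lemma case_below:
  assumes "\<alpha> / \<beta> < 1 / 9"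
  shows "m1 \<alpha> \<beta> \<in> \<real>" "m2 \<alpha> \<beta> \<in> \<real>"
    and "Re (m1 \<alpha> \<beta>) < \<mu> n \<Longrightarrow> \<mu> n < Re (m2 \<alpha> \<beta>) \<Longrightarrow> l1 n \<in> \<real> \<and> l2 n \<in> \<real> \<and> l3 n \<in> \<real>"
    and "of_real (\<mu> n) = m1 \<alpha> \<beta> \<or> of_real (\<mu> n) = m2 \<alpha> \<beta> \<Longrightarrow> disc \<alpha> \<beta> (\<mu> n) = 0"
proof -
  note M = m1_m2_real[OF alpha dissipative less_imp_le[OF assms]]
  show "m1 \<alpha> \<beta> \<in> \<real>" "m2 \<alpha> \<beta> \<in> \<real>"
    unfolding M(1,2) by (rule Reals_of_real)+
  show "disc \<alpha> \<beta> (\<mu> n) = 0" if "of_real (\<mu> n) = m1 \<alpha> \<beta> \<or> of_real (\<mu> n) = m2 \<alpha> \<beta>"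
  proof -
    have "\<mu> n = Re (m1 \<alpha> \<beta>) \<or> \<mu> n = Re (m2 \<alpha> \<beta>)"
      using that by (metis Re_complex_of_real)
    then show ?thesis
      unfolding M(3) by auto
  qed
  show "l1 n \<in> \<real> \<and> l2 n \<in> \<real> \<and> l3 n \<in> \<real>" if "Re (m1 \<alpha> \<beta>) < \<mu> n" "\<mu> n < Re (m2 \<alpha> \<beta>)"
  proof -
    have neg: "(\<mu> n - Re (m1 \<alpha> \<beta>)) * (\<mu> n - Re (m2 \<alpha> \<beta>)) < 0"
      using that by (intro mult_pos_neg) auto
    have "disc \<alpha> \<beta> (\<mu> n) < 0"
      unfolding M(3) by (rule mult_pos_neg[OF _ neg]) (use alpha beta in simp)
    then show ?thesis
      by (rule disc_cases(2)[OF labelled alpha mu_pos])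
  qed
qed

lemma case_equal:
  assumes "\<beta> = 9 * \<alpha>" "\<mu> n \<noteq> 3 / \<beta>\<^sup>2"
  shows "one_real_two_conj (l1 n) (l2 n) (l3 n)"
proof -
  have "\<alpha> / \<beta> \<le> 1 / 9"
    using assms(1) alpha by simp
  then have "disc \<alpha> \<beta> (\<mu> n) = 4 * \<alpha> * \<beta> ^ 3 * (\<mu> n - 3 / \<beta>\<^sup>2)\<^sup>2"
    using m1_m2_real(3)[OF alpha dissipative] m1_m2_coincide[OF alpha assms(1)] by (simp only: Re_complex_of_real power2_eq_square)
  moreover have "0 < (\<mu> n - 3 / \<beta>\<^sup>2)\<^sup>2"
    using assms(2) by simp
  ultimately have "0 < disc \<alpha> \<beta> (\<mu> n)"
    using alpha beta by simp
  then show ?thesis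
    using disc_cases(1)[OF labelled alpha mu_pos] by blast
qed

lemma real_eigenvalue_bounds:
  assumes "eigenvalue DA A l" "l \<in> \<real>"
  shows "- (1 / \<alpha>) < Re l \<and> Re l < - (1 / \<beta>)"
proof -
  obtain n where n: "chr (\<mu> n) l = 0"
    using assms(1) A_eigenvalue_iff by blast
  have "poly (char_poly \<alpha> \<beta> (\<mu> n)) (of_real (Re l)) = 0"
    using n assms(2) by (simp add: poly_char_poly_chr)
  then have "\<alpha> * Re l ^ 3 + (Re l)\<^sup>2 + \<beta> * \<mu> n * Re l + \<mu> n = 0"
    by (rule root_real_eq)
  then show ?thesis
    using real_root_bounds[OF alpha dissipative mu_pos] by blast
qed

lemma nonreal_eigenvalue_bounds:
  assumes "eigenvalue DA A l" "l \<notin> \<real>"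
  shows "- (1 / 2) * (1 / \<alpha> - 1 / \<beta>) < Re l \<and> Re l < 0"
proof -
  obtain n where n: "l \<in> {l1 n, l2 n, l3 n}"
    using assms(1) A_eigenvalue_iff chr_root_iff by blast
  show ?thesis
    using nonreal_root_bounds[OF labelled alpha dissipative mu_pos n assms(2)] by blast
qed

lemma double_eigenvalue:
  assumes "disc \<alpha> \<beta> (\<mu> n) = 0" "\<alpha> / \<beta> < 1 / 9"
  shows "l2 n = l3 n" "l2 n \<in> \<real>" "eigenvalue DA A (l2 n)"
    and "alg_mult (DA \<inter> block (\<phi> n)) A (l2 n) = 2"
    and "alg_mult DA A (l2 n) = 2 * alg_mult D L (of_real (\<mu> n))"
proof -
  have D: "l2 n \<in> \<real>" "l3 n = l2 n"
    using disc_cases(3)[OF labelled alpha mu_pos assms(1)] by auto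
  then show "l2 n = l3 n" "l2 n \<in> \<real>"
    by auto
  have ev: "chr (\<mu> n) (l2 n) = 0"
    by (simp add: chr_root_iff)
  then show "eigenvalue DA A (l2 n)"
    unfolding A_eigenvalue_iff by blast
  have fac': "char_poly \<alpha> \<beta> (\<mu> n) = smult (of_real \<alpha>) ([:- l1 n, 1:] * [:- l2 n, 1:] * [:- l2 n, 1:])"
    using fac[of n] unfolding D(2) .
  have "l1 n \<noteq> l2 n"
  proof
    assume "l1 n = l2 n"
    then have "\<beta> = 9 * \<alpha>"
      using triple_root[of \<alpha> \<beta> "\<mu> n" "l2 n"] fac' alpha by simp
    then show False
      using assms(2) alpha by simp
  qed
  then show "alg_mult (DA \<inter> block (\<phi> n)) A (l2 n) = 2"
    and "alg_mult DA A (l2 n) = 2 * alg_mult D L (of_real (\<mu> n))"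
    using alg_mult_double[OF fac' _ not_minus_one_over_beta[OF ev]] by auto
qed

lemma triple_eigenvalue:
  assumes "\<beta> = 9 * \<alpha>" "\<mu> n = 3 / \<beta>\<^sup>2"
  shows "l1 n = - of_real (3 / \<beta>)" "l2 n = l1 n" "l3 n = l1 n" "eigenvalue DA A (l1 n)"
    and "alg_mult (DA \<inter> block (\<phi> n)) A (l1 n) = 3"
    and "alg_mult DA A (l1 n) = 3 * alg_mult D L (of_real (\<mu> n))"
proof -
  have "disc \<alpha> \<beta> (\<mu> n) = 0"
    unfolding disc_eq[OF less_imp_neq[OF alpha, symmetric]] assms(2) unfolding assms(1)
    using alpha by (simp add: field_simps eval_nat_numeral)
  then have D: "l3 n = l2 n"
    using disc_cases(3)[OF labelled alpha mu_pos] by auto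
  have fac': "char_poly \<alpha> \<beta> (\<mu> n) = smult (of_real \<alpha>) ([:- l1 n, 1:] * [:- l2 n, 1:] * [:- l2 n, 1:])"
    using fac[of n] unfolding D .
  have l: "l1 n = - of_real (3 / \<beta>)" "l2 n = - of_real (3 / \<beta>)"
    using triple_root_value[OF fac' alpha assms] by blast+
  then show "l1 n = - of_real (3 / \<beta>)" "l2 n = l1 n" "l3 n = l1 n"
    using D by simp_all
  have ev: "chr (\<mu> n) (l1 n) = 0"
    by (simp add: chr_root_iff)
  then show "eigenvalue DA A (l1 n)"
    unfolding A_eigenvalue_iff by blast
  have fac'': "char_poly \<alpha> \<beta> (\<mu> n) = smult (of_real \<alpha>) ([:- l1 n, 1:] * [:- l1 n, 1:] * [:- l1 n, 1:])"
    using fac' unfolding l .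
  show "alg_mult (DA \<inter> block (\<phi> n)) A (l1 n) = 3"
    and "alg_mult DA A (l1 n) = 3 * alg_mult D L (of_real (\<mu> n))"
    using alg_mult_triple[OF fac'' not_minus_one_over_beta[OF ev]] by auto
qed

lemma Re_l2_antimono:
  assumes "\<mu> n < \<mu> m" "outside_m1_m2 \<alpha> \<beta> (\<mu> n)" "outside_m1_m2 \<alpha> \<beta> (\<mu> m)"
  shows "Re (l2 m) < Re (l2 n)"
proof -
  note orc = one_real_outside[OF assms(2)] one_real_outside[OF assms(3)]
  have "Re (l1 n) < Re (l1 m)"
    by (rule real_root_mono[OF labelled labelled orc alpha dissipative mu_pos assms(1)])
  then show ?thesis
    unfolding one_real_sum[OF fac orc(1) alpha] one_real_sum[OF fac orc(2) alpha] by simp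
qed

subsection \<open>Limits\<close>

text \<open>The real root satisfies \<open>\<beta> x + 1 = - x\<^sup>2 (\<alpha> x + 1) / m\<close> with bounded numerator.\<close>

lemma l1_limit: "l1 \<longlonglongrightarrow> - of_real (1 / \<beta>)"
proof -
  have bound: "\<bar>Re (l1 n) + 1 / \<beta>\<bar> \<le> 1 / (\<alpha>\<^sup>2 * \<beta>) * inverse (\<mu> n)"
    if "one_real_two_conj (l1 n) (l2 n) (l3 n)" for n
  proof -
    define x where "x = Re (l1 n)"
    have l1: "l1 n = of_real x"
      using that by (simp add: one_real_two_conj_def x_def)
    have "poly (char_poly \<alpha> \<beta> (\<mu> n)) (of_real x) = 0"
      using chr_root_iff[of n "l1 n"] by (simp add: l1 poly_char_poly_chr)
    then have eq: "\<alpha> * x ^ 3 + x\<^sup>2 + \<beta> * \<mu> n * x + \<mu> n = 0"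
      by (rule root_real_eq)
    have x: "- (1 / \<alpha>) < x" "x < - (1 / \<beta>)"
      using real_root_bounds[OF alpha dissipative mu_pos eq] by auto
    have x0: "x < 0"
      using x(2) beta by (meson divide_pos_pos less_trans neg_less_0_iff_less zero_less_one)
    have ax: "0 < \<alpha> * x + 1" "\<alpha> * x + 1 < 1"
      using x(1) x0 alpha by (simp_all add: field_simps mult_pos_neg)
    have "\<bar>x\<bar> \<le> 1 / \<alpha>"
      using x(1) x0 by simp
    then have "\<bar>x\<bar>\<^sup>2 \<le> (1 / \<alpha>)\<^sup>2"
      by (rule power_mono) simp
    then have "x\<^sup>2 * (\<alpha> * x + 1) \<le> (1 / \<alpha>)\<^sup>2 * 1"
      using ax by (intro mult_mono) auto
    moreover have "\<mu> n * (- (\<beta> * x + 1)) = x\<^sup>2 * (\<alpha> * x + 1)"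
      using eq by (simp add: power2_eq_square power3_eq_cube algebra_simps)
    ultimately have "\<mu> n * (- (\<beta> * x + 1)) \<le> (1 / \<alpha>)\<^sup>2"
      by simp
    then have "- (\<beta> * x + 1) \<le> (1 / \<alpha>)\<^sup>2 / \<mu> n"
      using mu_pos[of n] by (simp add: pos_le_divide_eq mult.commute)
    then have "- (\<beta> * x + 1) / \<beta> \<le> (1 / \<alpha>)\<^sup>2 / \<mu> n / \<beta>"
      using beta by (intro divide_right_mono) auto
    moreover have "- (\<beta> * x + 1) / \<beta> = - (x + 1 / \<beta>)"
      using beta by (simp add: field_simps)
    moreover have "(1 / \<alpha>)\<^sup>2 / \<mu> n / \<beta> = 1 / (\<alpha>\<^sup>2 * \<beta>) * inverse (\<mu> n)"
      by (simp add: power_divide field_simps)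
    ultimately show ?thesis
      using x(2) unfolding x_def[symmetric] by linarith
  qed
  have "(\<lambda>n. Re (l1 n) + 1 / \<beta>) \<longlonglongrightarrow> 0"
  proof (rule Lim_null_comparison)
    show "eventually (\<lambda>n. norm (Re (l1 n) + 1 / \<beta>) \<le> 1 / (\<alpha>\<^sup>2 * \<beta>) * inverse (\<mu> n)) sequentially"
      using eventually_one_real by eventually_elim (use bound in auto)
    have "(\<lambda>n. 1 / (\<alpha>\<^sup>2 * \<beta>) * inverse (\<mu> n)) \<longlonglongrightarrow> 1 / (\<alpha>\<^sup>2 * \<beta>) * 0"
      by (intro tendsto_intros tendsto_inverse_0_at_top mu_top)
    then show "(\<lambda>n. 1 / (\<alpha>\<^sup>2 * \<beta>) * inverse (\<mu> n)) \<longlonglongrightarrow> 0"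
      by simp
  qed
  then have "(\<lambda>n. complex_of_real ((Re (l1 n) + 1 / \<beta>) - 1 / \<beta>)) \<longlonglongrightarrow> of_real (0 - 1 / \<beta>)"
    by (intro tendsto_intros)
  moreover have "eventually (\<lambda>n. complex_of_real ((Re (l1 n) + 1 / \<beta>) - 1 / \<beta>) = l1 n) sequentially"
    using eventually_one_real by eventually_elim (simp add: one_real_two_conj_def)
  ultimately have "l1 \<longlonglongrightarrow> of_real (0 - 1 / \<beta>)"
    by (rule Lim_transform_eventually)
  then show ?thesis
    by simp
qed

lemma Re_l2_limit: "(\<lambda>n. Re (l2 n)) \<longlonglongrightarrow> - (1 / 2) * (1 / \<alpha> - 1 / \<beta>)"
proof -
  have "(\<lambda>n. (- (1 / \<alpha>) - Re (l1 n)) / 2) \<longlonglongrightarrow> (- (1 / \<alpha>) - Re (- of_real (1 / \<beta>))) / 2"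
    by (intro tendsto_intros l1_limit) auto
  moreover have "eventually (\<lambda>n. (- (1 / \<alpha>) - Re (l1 n)) / 2 = Re (l2 n)) sequentially"
    using eventually_one_real by eventually_elim (simp add: one_real_sum[OF fac _ alpha])
  ultimately have "(\<lambda>n. Re (l2 n)) \<longlonglongrightarrow> (- (1 / \<alpha>) - Re (- of_real (1 / \<beta>))) / 2"
    by (rule Lim_transform_eventually)
  moreover have "(- p - (- q)) / 2 = - (1 / 2) * (p - q)" for p q :: real
    by (simp add: field_simps)
  ultimately show ?thesis
    by (simp only: uminus_complex.sel Re_complex_of_real)
qed

text \<open>In the formula for \<open>(Im l2)\<^sup>2\<close>, divided by \<open>\<mu>\<^sub>n\<close>, only the term \<open>\<beta>/\<alpha>\<close> survives, as the real parts
  converge.\<close>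

lemma Im_l2_ratio_limit: "(\<lambda>n. Im (l2 n) / sqrt (\<mu> n)) \<longlonglongrightarrow> sqrt (\<beta> / \<alpha>)"
proof -
  have "(\<lambda>n. sqrt (1 / \<alpha> * (3 * \<alpha> * (Re (l2 n))\<^sup>2 + 2 * Re (l2 n)) * inverse (\<mu> n) + \<beta> / \<alpha>))
      \<longlonglongrightarrow> sqrt (1 / \<alpha> * (3 * \<alpha> * (- (1 / 2) * (1 / \<alpha> - 1 / \<beta>))\<^sup>2 + 2 * (- (1 / 2) * (1 / \<alpha> - 1 / \<beta>))) * 0 + \<beta> / \<alpha>)"
    by (intro tendsto_intros Re_l2_limit tendsto_inverse_0_at_top mu_top)
  moreover have "eventually (\<lambda>n. sqrt (1 / \<alpha> * (3 * \<alpha> * (Re (l2 n))\<^sup>2 + 2 * Re (l2 n)) * inverse (\<mu> n) + \<beta> / \<alpha>)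
      = Im (l2 n) / sqrt (\<mu> n)) sequentially"
    using eventually_one_real
  proof eventually_elim
    case (elim n)
    have "l2 n \<notin> \<real>"
      using elim unfolding one_real_two_conj_def by blast
    then have "(Im (l2 n))\<^sup>2 = 1 / \<alpha> * (3 * \<alpha> * (Re (l2 n))\<^sup>2 + 2 * Re (l2 n) + \<beta> * \<mu> n)"
      using nonreal_eigenvalue[of "l2 n" n] by blast
    then have "(Im (l2 n) / sqrt (\<mu> n))\<^sup>2
        = 1 / \<alpha> * (3 * \<alpha> * (Re (l2 n))\<^sup>2 + 2 * Re (l2 n) + \<beta> * \<mu> n) / \<mu> n"
      using mu_pos[of n] by (simp add: power_divide)
    also have "\<dots> = 1 / \<alpha> * (3 * \<alpha> * (Re (l2 n))\<^sup>2 + 2 * Re (l2 n)) * inverse (\<mu> n) + \<beta> / \<alpha>"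
      using mu_pos[of n] alpha by (simp add: field_simps)
    finally have eq: "(Im (l2 n) / sqrt (\<mu> n))\<^sup>2
        = 1 / \<alpha> * (3 * \<alpha> * (Re (l2 n))\<^sup>2 + 2 * Re (l2 n)) * inverse (\<mu> n) + \<beta> / \<alpha>" .
    have "0 \<le> Im (l2 n) / sqrt (\<mu> n)"
      using elim mu_pos[of n] by simp
    then show ?case
      unfolding eq[symmetric] by (rule real_sqrt_unique[OF refl])
  qed
  ultimately have "(\<lambda>n. Im (l2 n) / sqrt (\<mu> n)) \<longlonglongrightarrow>
      sqrt (1 / \<alpha> * (3 * \<alpha> * (- (1 / 2) * (1 / \<alpha> - 1 / \<beta>))\<^sup>2 + 2 * (- (1 / 2) * (1 / \<alpha> - 1 / \<beta>))) * 0 + \<beta> / \<alpha>)"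
    by (rule Lim_transform_eventually)
  then show ?thesis
    by simp
qed

lemma Im_l2_at_top: "filterlim (\<lambda>n. Im (l2 n)) at_top sequentially"
proof -
  have "filterlim (\<lambda>n. Im (l2 n) / sqrt (\<mu> n) * sqrt (\<mu> n)) at_top sequentially"
    using alpha beta
    by (intro filterlim_tendsto_pos_mult_at_top[OF Im_l2_ratio_limit] filterlim_compose[OF sqrt_at_top mu_top]) simp
  moreover have "Im (l2 n) / sqrt (\<mu> n) * sqrt (\<mu> n) = Im (l2 n)" for n
    using mu_pos[of n] by simp
  ultimately show ?thesis
    by simp
qed

lemma Im_l2_asymp: "(\<lambda>n. Im (l2 n) - sqrt (\<beta> / \<alpha>) * sqrt (\<mu> n)) \<in> o(\<lambda>n. sqrt (\<mu> n))"
proof (rule smalloI_tendsto)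
  have "(\<lambda>n. Im (l2 n) / sqrt (\<mu> n) - sqrt (\<beta> / \<alpha>)) \<longlonglongrightarrow> sqrt (\<beta> / \<alpha>) - sqrt (\<beta> / \<alpha>)"
    by (intro tendsto_intros Im_l2_ratio_limit)
  moreover have "(Im (l2 n) - sqrt (\<beta> / \<alpha>) * sqrt (\<mu> n)) / sqrt (\<mu> n) = Im (l2 n) / sqrt (\<mu> n) - sqrt (\<beta> / \<alpha>)" for n
    using mu_pos[of n] by (simp add: diff_divide_distrib)
  ultimately show "(\<lambda>n. (Im (l2 n) - sqrt (\<beta> / \<alpha>) * sqrt (\<mu> n)) / sqrt (\<mu> n)) \<longlonglongrightarrow> 0"
    by simp
  show "eventually (\<lambda>n. sqrt (\<mu> n) \<noteq> 0) sequentially"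
    using mu_pos by (intro always_eventually allI) (simp add: less_imp_neq[symmetric])
qed

lemma limit_comparison:
  shows "\<alpha> / \<beta> < 1 / 3 \<Longrightarrow> lim (\<lambda>n. Re (l2 n)) < Re (lim l1)"
    and "\<alpha> / \<beta> = 1 / 3 \<Longrightarrow> lim (\<lambda>n. Re (l2 n)) = Re (lim l1)"
    and "\<alpha> / \<beta> > 1 / 3 \<Longrightarrow> lim (\<lambda>n. Re (l2 n)) > Re (lim l1)"
  unfolding limI[OF l1_limit] limI[OF Re_l2_limit] using alpha beta by (simp_all add: field_simps)

end

end

theorem proposition4:
  fixes D :: "'a::complex_hilbert set" and L :: "'a \<Rightarrow> 'a"
    and \<mu> :: "nat \<Rightarrow> real" and \<phi> :: "nat \<Rightarrow> 'a"
    and \<alpha> \<beta> :: real and s :: "real \<times> real \<times> real"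
    and X DA :: "('a \<times> 'a \<times> 'a) set" and N :: "'a \<times> 'a \<times> 'a \<Rightarrow> real"
    and A :: "'a \<times> 'a \<times> 'a \<Rightarrow> 'a \<times> 'a \<times> 'a"
  defines "X \<equiv> phase_space \<mu> \<phi> s" and "N \<equiv> phase_norm \<mu> \<phi> s"
    and "DA \<equiv> A_dom \<alpha> \<beta> D L \<mu> \<phi> s" and "A \<equiv> A_op \<alpha> \<beta> L"
  assumes "0 < \<alpha>" and "0 < \<beta>"
    and "self_adjoint D L" and "strictly_positive D L" and "compact_resolvent D L"
    and "eigen_enumeration D L \<mu> \<phi>"
    and "s \<in> phase_exponents"
  shows
    "infinite {l. discrete_eigenvalue X N DA A l} \<and>
     (\<forall>l. eigenvalue DA A l \<and> (\<alpha> \<noteq> \<beta> \<or> l \<noteq> - complex_of_real (1 / \<beta>))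
        \<longrightarrow> discrete_eigenvalue X N DA A l) \<and>
     (\<exists>l1 l2 l3. \<forall>n. labelled_roots \<alpha> \<beta> (\<mu> n) (l1 n) (l2 n) (l3 n)) \<and>
     (\<forall>l1 l2 l3. (\<forall>n. labelled_roots \<alpha> \<beta> (\<mu> n) (l1 n) (l2 n) (l3 n)) \<longrightarrow>
       {l. eigenvalue DA A l} = (\<Union>n. {l1 n, l2 n, l3 n}) \<and>
       (\<forall>n. \<forall>l \<in> {l1 n, l2 n, l3 n}. l \<notin> \<real> \<longrightarrow>
          8 * \<alpha> * Re l ^ 3 + 8 * (Re l)\<^sup>2 + 2 * Re l * (1 / \<alpha> + \<beta> * \<mu> n) + \<mu> n * (\<beta> / \<alpha> - 1) = 0 \<and>
          (Im l)\<^sup>2 = 1 / \<alpha> * (3 * \<alpha> * (Re l)\<^sup>2 + 2 * Re l + \<beta> * \<mu> n)) \<and>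
       (\<alpha> < \<beta> \<longrightarrow>
         \<comment> \<open>1(a)\<close>
         (1 / 9 < \<alpha> / \<beta> \<longrightarrow> (\<forall>n. one_real_two_conj (l1 n) (l2 n) (l3 n))) \<and>
         \<comment> \<open>1(b)\<close>
         (\<alpha> / \<beta> < 1 / 9 \<longrightarrow>
            finite {n. \<not> one_real_two_conj (l1 n) (l2 n) (l3 n)} \<and>
            m1 \<alpha> \<beta> \<in> \<real> \<and> m2 \<alpha> \<beta> \<in> \<real> \<and> 0 < Re (m1 \<alpha> \<beta>) \<and> Re (m1 \<alpha> \<beta>) < Re (m2 \<alpha> \<beta>) \<and>
            finite {n. Re (m1 \<alpha> \<beta>) < \<mu> n \<and> \<mu> n < Re (m2 \<alpha> \<beta>)} \<and>
            (\<forall>n. Re (m1 \<alpha> \<beta>) < \<mu> n \<and> \<mu> n < Re (m2 \<alpha> \<beta>) \<longrightarrow> l1 n \<in> \<real> \<and> l2 n \<in> \<real> \<and> l3 n \<in> \<real>) \<and>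
            (\<forall>n. complex_of_real (\<mu> n) = m1 \<alpha> \<beta> \<or> complex_of_real (\<mu> n) = m2 \<alpha> \<beta> \<longrightarrow>
               l2 n = l3 n \<and> l2 n \<in> \<real> \<and> eigenvalue DA A (l2 n) \<and>
               alg_mult (DA \<inter> block (\<phi> n)) A (l2 n) = 2 \<and>
               alg_mult DA A (l2 n) = 2 * alg_mult D L (complex_of_real (\<mu> n))) \<and>
            (\<forall>n. outside_m1_m2 \<alpha> \<beta> (\<mu> n) \<longrightarrow> one_real_two_conj (l1 n) (l2 n) (l3 n))) \<and>
         \<comment> \<open>1(c)\<close>
         (\<alpha> / \<beta> = 1 / 9 \<longrightarrow>
            m1 \<alpha> \<beta> = m2 \<alpha> \<beta> \<and> m1 \<alpha> \<beta> = complex_of_real (3 / \<beta>\<^sup>2) \<and> 0 < 3 / \<beta>\<^sup>2 \<and>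
            (\<forall>n. \<mu> n \<noteq> 3 / \<beta>\<^sup>2 \<longrightarrow> one_real_two_conj (l1 n) (l2 n) (l3 n)) \<and>
            (\<forall>n. \<mu> n = 3 / \<beta>\<^sup>2 \<longrightarrow>
               l1 n = - complex_of_real (3 / \<beta>) \<and> l2 n = l1 n \<and> l3 n = l1 n \<and>
               eigenvalue DA A (l1 n) \<and>
               alg_mult (DA \<inter> block (\<phi> n)) A (l1 n) = 3 \<and>
               alg_mult DA A (l1 n) = 3 * alg_mult D L (complex_of_real (\<mu> n)))) \<and>
         \<comment> \<open>2(a)\<close>
         (\<forall>l. eigenvalue DA A l \<and> l \<in> \<real> \<longrightarrow> - (1 / \<alpha>) < Re l \<and> Re l < - (1 / \<beta>)) \<and>
         (\<forall>l. eigenvalue DA A l \<and> l \<notin> \<real> \<longrightarrow>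
            - (1 / 2) * (1 / \<alpha> - 1 / \<beta>) < Re l \<and> Re l < 0) \<and>
         \<comment> \<open>2(b)\<close>
         (\<forall>n m. \<mu> n < \<mu> m \<and> outside_m1_m2 \<alpha> \<beta> (\<mu> n) \<and> outside_m1_m2 \<alpha> \<beta> (\<mu> m) \<longrightarrow>
            Re (l2 n) > Re (l2 m)) \<and>
         \<comment> \<open>2(c)\<close>
         l1 \<longlonglongrightarrow> - complex_of_real (1 / \<beta>) \<and>
         \<not> eigenvalue DA A (- complex_of_real (1 / \<beta>)) \<and>
         essential_spectrum X N DA A = {- complex_of_real (1 / \<beta>)} \<and>
         (\<lambda>n. Re (l2 n)) \<longlonglongrightarrow> - (1 / 2) * (1 / \<alpha> - 1 / \<beta>) \<and>
         filterlim (\<lambda>n. Im (l2 n)) at_top sequentially \<and>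
         (\<lambda>n. Im (l2 n) - sqrt (\<beta> / \<alpha>) * sqrt (\<mu> n)) \<in> o(\<lambda>n. sqrt (\<mu> n)) \<and>
         \<comment> \<open>2(d)\<close>
         (\<alpha> / \<beta> < 1 / 3 \<longrightarrow> lim (\<lambda>n. Re (l2 n)) < Re (lim l1)) \<and>
         (\<alpha> / \<beta> = 1 / 3 \<longrightarrow> lim (\<lambda>n. Re (l2 n)) = Re (lim l1)) \<and>
         (\<alpha> / \<beta> > 1 / 3 \<longrightarrow> lim (\<lambda>n. Re (l2 n)) > Re (lim l1))))"
proof -
  obtain s1 s2 s3 where s: "s = (s1, s2, s3)"
    by (cases s)
  have exps: "0 \<le> s3" "s3 \<le> s2" "s2 \<le> s1" "s1 \<le> s3 + 1"
    using \<open>s \<in> phase_exponents\<close> by (auto simp: s phase_exponents_def)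
  have L: "positive_operator D L"
    using \<open>self_adjoint D L\<close> \<open>strictly_positive D L\<close> by unfold_locales
  have "orthonormal_basis \<phi>"
    by (rule positive_operator.eigenvectors_complete[OF L \<open>compact_resolvent D L\<close> \<open>eigen_enumeration D L \<mu> \<phi>\<close>])
  then have E: "third_order_equation D L \<phi> \<mu> \<alpha> \<beta> s1 s2 s3"
    using L \<open>0 < \<alpha>\<close> \<open>0 < \<beta>\<close> \<open>eigen_enumeration D L \<mu> \<phi>\<close> exps
    by (auto simp: third_order_equation_def third_order_equation_axioms_def eigen_enumeration_def)
  interpret E: third_order_equation D L \<phi> \<mu> \<alpha> \<beta> s1 s2 s3
    by (rule E)
  note defs = X_def N_def DA_def A_def s
  show ?thesis
  proof (intro conjI allI impI ballI)
    show "infinite {l. discrete_eigenvalue X N DA A l}"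
      unfolding defs by (rule E.infinite_discrete_eigenvalues)
    show "discrete_eigenvalue X N DA A l"
      if "eigenvalue DA A l \<and> (\<alpha> \<noteq> \<beta> \<or> l \<noteq> - complex_of_real (1 / \<beta>))" for l
      using that E.discrete_eigenvalue_A E.not_eigenvalue_A unfolding defs by blast
    have "\<forall>n. \<exists>l1 l2 l3. labelled_roots \<alpha> \<beta> (\<mu> n) l1 l2 l3"
      using labelled_roots_exist[OF \<open>0 < \<alpha>\<close> \<open>0 < \<beta>\<close> E.mu_pos] by blast
    then show "\<exists>l1 l2 l3. \<forall>n. labelled_roots \<alpha> \<beta> (\<mu> n) (l1 n) (l2 n) (l3 n)"
      by metis
  next
    fix l1 l2 l3
    assume "\<forall>n. labelled_roots \<alpha> \<beta> (\<mu> n) (l1 n) (l2 n) (l3 n)"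
    then interpret F: labelled_eigenvalues D L \<phi> \<mu> \<alpha> \<beta> s1 s2 s3 l1 l2 l3
      by unfold_locales blast
    show "{l. eigenvalue DA A l} = (\<Union>n. {l1 n, l2 n, l3 n})"
      unfolding defs by (rule F.eigenvalues_A)
    {
      fix n l assume l: "l \<in> {l1 n, l2 n, l3 n}" "l \<notin> \<real>"
      show "8 * \<alpha> * Re l ^ 3 + 8 * (Re l)\<^sup>2 + 2 * Re l * (1 / \<alpha> + \<beta> * \<mu> n) + \<mu> n * (\<beta> / \<alpha> - 1) = 0"
        and "(Im l)\<^sup>2 = 1 / \<alpha> * (3 * \<alpha> * (Re l)\<^sup>2 + 2 * Re l + \<beta> * \<mu> n)"
        using F.nonreal_eigenvalue[OF l] by blast+
    }
    assume less: "\<alpha> < \<beta>"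
    {
      assume "1 / 9 < \<alpha> / \<beta>"
      then show "one_real_two_conj (l1 n) (l2 n) (l3 n)" for n
        using disc_pos[OF \<open>0 < \<alpha>\<close> less] disc_cases(1)[OF F.labelled \<open>0 < \<alpha>\<close> E.mu_pos] by blast
    }
    {
      assume lt: "\<alpha> / \<beta> < 1 / 9"
      note M = m1_m2_real[OF \<open>0 < \<alpha>\<close> less less_imp_le[OF lt]]
      show "finite {n. \<not> one_real_two_conj (l1 n) (l2 n) (l3 n)}"
        by (rule finite_subset[OF _ F.finite_exceptional[OF less]]) blast
      show "m1 \<alpha> \<beta> \<in> \<real>" "m2 \<alpha> \<beta> \<in> \<real>"
        by (rule F.case_below[OF less lt])+
      show "0 < Re (m1 \<alpha> \<beta>)" "Re (m1 \<alpha> \<beta>) < Re (m2 \<alpha> \<beta>)"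
        by (rule M(4)) (rule M(6)[OF lt])
      show "finite {n. Re (m1 \<alpha> \<beta>) < \<mu> n \<and> \<mu> n < Re (m2 \<alpha> \<beta>)}"
        by (rule finite_subset[OF _ E.finite_mu_le[of "Re (m2 \<alpha> \<beta>)"]]) auto
      {
        fix n assume "Re (m1 \<alpha> \<beta>) < \<mu> n \<and> \<mu> n < Re (m2 \<alpha> \<beta>)"
        then show "l1 n \<in> \<real>" "l2 n \<in> \<real>" "l3 n \<in> \<real>"
          using F.case_below(3)[OF less lt, of n] by blast+
      }
      {
        fix n assume "complex_of_real (\<mu> n) = m1 \<alpha> \<beta> \<or> complex_of_real (\<mu> n) = m2 \<alpha> \<beta>"
        then have "disc \<alpha> \<beta> (\<mu> n) = 0"
          by (rule F.case_below(4)[OF less lt])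
        note double = F.double_eigenvalue[OF less this lt]
        show "l2 n = l3 n" "l2 n \<in> \<real>" "eigenvalue DA A (l2 n)"
          "alg_mult (DA \<inter> block (\<phi> n)) A (l2 n) = 2"
          "alg_mult DA A (l2 n) = 2 * alg_mult D L (complex_of_real (\<mu> n))"
          unfolding defs by (rule double)+
      }
      show "one_real_two_conj (l1 n) (l2 n) (l3 n)" if "outside_m1_m2 \<alpha> \<beta> (\<mu> n)" for n
        using that by (rule F.one_real_outside[OF less])
    }
    {
      assume "\<alpha> / \<beta> = 1 / 9"
      then have eq: "\<beta> = 9 * \<alpha>"
        using \<open>0 < \<beta>\<close> by (simp add: field_simps)
      note M = m1_m2_coincide[OF \<open>0 < \<alpha>\<close> eq]
      show "m1 \<alpha> \<beta> = m2 \<alpha> \<beta>" "m1 \<alpha> \<beta> = complex_of_real (3 / \<beta>\<^sup>2)"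
        by (simp_all only: M)
      show "0 < 3 / \<beta>\<^sup>2"
        using \<open>0 < \<beta>\<close> by simp
      show "one_real_two_conj (l1 n) (l2 n) (l3 n)" if "\<mu> n \<noteq> 3 / \<beta>\<^sup>2" for n
        using that by (rule F.case_equal[OF less eq])
      {
        fix n assume "\<mu> n = 3 / \<beta>\<^sup>2"
        note triple = F.triple_eigenvalue[OF less eq this]
        show "l1 n = - complex_of_real (3 / \<beta>)" "l2 n = l1 n" "l3 n = l1 n" "eigenvalue DA A (l1 n)"
          "alg_mult (DA \<inter> block (\<phi> n)) A (l1 n) = 3"
          "alg_mult DA A (l1 n) = 3 * alg_mult D L (complex_of_real (\<mu> n))"
          unfolding defs by (rule triple)+
      }
    }
    {
      fix l assume "eigenvalue DA A l \<and> l \<in> \<real>"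
      then show "- (1 / \<alpha>) < Re l" "Re l < - (1 / \<beta>)"
        using F.real_eigenvalue_bounds[OF less, of l] unfolding defs by blast+
    }
    {
      fix l assume "eigenvalue DA A l \<and> l \<notin> \<real>"
      then show "- (1 / 2) * (1 / \<alpha> - 1 / \<beta>) < Re l" "Re l < 0"
        using F.nonreal_eigenvalue_bounds[OF less, of l] unfolding defs by blast+
    }
    show "Re (l2 n) > Re (l2 m)"
      if "\<mu> n < \<mu> m \<and> outside_m1_m2 \<alpha> \<beta> (\<mu> n) \<and> outside_m1_m2 \<alpha> \<beta> (\<mu> m)" for n m
      using that F.Re_l2_antimono[OF less] by blast
    show "l1 \<longlonglongrightarrow> - complex_of_real (1 / \<beta>)"
      by (rule F.l1_limit[OF less])
    show "\<not> eigenvalue DA A (- complex_of_real (1 / \<beta>))"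
      unfolding defs using less by (intro E.not_eigenvalue_A) simp
    show "essential_spectrum X N DA A = {- complex_of_real (1 / \<beta>)}"
      unfolding defs using less F.chr_root_iff
      by (intro E.essential_spectrum_A[OF _ _ F.l1_limit[OF less]]) auto
    show "(\<lambda>n. Re (l2 n)) \<longlonglongrightarrow> - (1 / 2) * (1 / \<alpha> - 1 / \<beta>)"
      by (rule F.Re_l2_limit[OF less])
    show "filterlim (\<lambda>n. Im (l2 n)) at_top sequentially"
      by (rule F.Im_l2_at_top[OF less])
    show "(\<lambda>n. Im (l2 n) - sqrt (\<beta> / \<alpha>) * sqrt (\<mu> n)) \<in> o(\<lambda>n. sqrt (\<mu> n))"
      by (rule F.Im_l2_asymp[OF less])
    show "lim (\<lambda>n. Re (l2 n)) < Re (lim l1)" if "\<alpha> / \<beta> < 1 / 3"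
      using that by (rule F.limit_comparison[OF less])
    show "lim (\<lambda>n. Re (l2 n)) = Re (lim l1)" if "\<alpha> / \<beta> = 1 / 3"
      using that by (rule F.limit_comparison[OF less])
    show "lim (\<lambda>n. Re (l2 n)) > Re (lim l1)" if "\<alpha> / \<beta> > 1 / 3"
      using that by (rule F.limit_comparison[OF less])
  qed
qed

end
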